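(* Let $(S_n)$ be the elephant random walk with memory parameter $p\in[0,1]$ and first-step parameter $q\in[0,1]$, and let $V_n=4\sum_{k=1}^{n-1}(S_k/k)^2$. Let $0<p_0<1$ with $p_0\ne3/4$. Under the null hypothesis $\mathcal{H}_0$: $p=p_0$, $$V_n(\widehat{p}_n-p_0)^2\longrightarrow\chi^2\quad\text{in distribution as }n\to\infty,$$ where $\chi^2$ has a Chi-square distribution with one degree of freedom. Moreover, under the alternative hypothesis $\mathcal{H}_1$: $p\ne p_0$, $$\lim_{n\to\infty}V_n(\widehat{p}_n-p_0)^2=+\infty\qquad\text{almost surely}.$$
   Context: Elephant random walk (ERW): fix $q\in[0,1]$ and $p\in[0,1]$. Set $S_0=0$. The first step $X_1$ equals $+1$ with probability $q$ and $-1$ with probability $1-q$. For each $n\ge 1$, an integer $k$ is chosen uniformly at random among $1,\dots,n$ (independently of the past), and $X_{n+1}=X_k$ with probability $p$, $X_{n+1}=-X_k$ with probability $1-p$. The position is $S_{n+1}=S_n+X_{n+1}$, so $S_n=X_1+\cdots+X_n$. Equivalently, with $\mathcal{F}_n=\sigma(X_1,\dots,X_n)$, $\mathbb{P}(X_{n+1}=1\mid\mathcal{F}_n)=\frac12\bigl(1+(2p-1)\frac{S_n}{n}\bigr)$ and $\mathbb{P}(X_{n+1}=-1\mid\mathcal{F}_n)=\frac12\bigl(1-(2p-1)\frac{S_n}{n}\bigr)$ for all $n\ge1$. Estimator: for all $n\ge2$, $$\widehat{p}_n=\frac{\sum_{k=1}^{n-1}\frac{S_k}{k}\bigl(X_{k+1}+\frac{S_k}{k}\bigr)}{2\sum_{k=1}^{n-1}\bigl(\frac{S_k}{k}\bigr)^2}.$$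 *)

theory Defs
  imports "HOL-Probability.Probability"
begin

text \<open>
  \<open>K n\<close> is the uniformly chosen index in \<open>{1..n}\<close> that determines the step at time \<open>Suc n\<close>, and
  \<open>B n\<close> tells whether the step \<open>X (K n)\<close> is repeated (with probability \<open>p\<close>) or reversed. Steps are
  indexed from 1; \<open>X 0\<close>, \<open>K 0\<close> and \<open>B 0\<close> play no role. The law \<open>pair_pmf\<close> makes \<open>K n\<close>
  and \<open>B n\<close> independent of each other; \<open>indep_past\<close> makes the pair independent of
  \<open>X 1, \<dots>, X n\<close>.
\<close>

locale elephant_random_walk = prob_space M for M :: "'a measure" +
  fixes p q :: real
    and X :: "nat \<Rightarrow> 'a \<Rightarrow> real"
    and K :: "nat \<Rightarrow> 'a \<Rightarrow> nat"
    and B :: "nat \<Rightarrow> 'a \<Rightarrow> bool"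
  assumes p_range: "0 \<le> p" "p \<le> 1"
    and q_range: "0 \<le> q" "q \<le> 1"
    and X_measurable: "\<And>n. n \<ge> 1 \<Longrightarrow> X n \<in> borel_measurable M"
    and KB_measurable: "\<And>n. n \<ge> 1 \<Longrightarrow> (\<lambda>\<omega>. (K n \<omega>, B n \<omega>)) \<in> measurable M (count_space UNIV)"
    and first_step: "prob {\<omega> \<in> space M. X 1 \<omega> = 1} = q"
                    "prob {\<omega> \<in> space M. X 1 \<omega> = -1} = 1 - q"
    and KB_law: "\<And>n. n \<ge> 1 \<Longrightarrow> distr M (count_space UNIV) (\<lambda>\<omega>. (K n \<omega>, B n \<omega>)) =
                    measure_pmf (pair_pmf (pmf_of_set {1..n}) (bernoulli_pmf p))"
    and indep_past: "\<And>n. n \<ge> 1 \<Longrightarrow> indep_set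
                    (sigma_sets (space M) {X k -` A \<inter> space M | k A. k \<in> {1..n} \<and> A \<in> sets borel})
                    {(\<lambda>\<omega>. (K n \<omega>, B n \<omega>)) -` A \<inter> space M | A. True}"
    and next_step: "\<And>n. n \<ge> 1 \<Longrightarrow> AE \<omega> in M.
                    X (Suc n) \<omega> = (if B n \<omega> then X (K n \<omega>) \<omega> else - X (K n \<omega>) \<omega>)"

definition erw_position :: "(nat \<Rightarrow> 'a \<Rightarrow> real) \<Rightarrow> nat \<Rightarrow> 'a \<Rightarrow> real" where
  "erw_position X n \<omega> = (\<Sum>k=1..n. X k \<omega>)"

definition erw_estimator :: "(nat \<Rightarrow> 'a \<Rightarrow> real) \<Rightarrow> nat \<Rightarrow> 'a \<Rightarrow> real" where
  "erw_estimator X n \<omega> =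
    (\<Sum>k=1..n-1. erw_position X k \<omega> / real k * (X (k+1) \<omega> + erw_position X k \<omega> / real k)) /
    (2 * (\<Sum>k=1..n-1. (erw_position X k \<omega> / real k)\<^sup>2))"

definition erw_V :: "(nat \<Rightarrow> 'a \<Rightarrow> real) \<Rightarrow> nat \<Rightarrow> 'a \<Rightarrow> real" where
  "erw_V X n \<omega> = 4 * (\<Sum>k=1..n-1. (erw_position X k \<omega> / real k)\<^sup>2)"

text \<open>The law of the sum of squares of \<open>d\<close> independent standard normal variables.\<close>

definition chi_square_distribution :: "nat \<Rightarrow> real measure" where
  "chi_square_distribution d =
    distr (PiM {..<d} (\<lambda>_. std_normal_distribution)) borel (\<lambda>z. \<Sum>i<d. (z i)\<^sup>2)"

end

theory Submission
  imports Defs "HOL-Real_Asymp.Real_Asymp"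
begin

text \<open>
  Put \<open>a = 2 p - 1\<close>, \<open>Y k = S k / k\<close> and \<open>xi k = X (k + 1) - a Y k\<close>. With the martingale
  \<open>N n = \<Sum>k<n. Y k xi k\<close> and \<open>W n = \<Sum>k<n. (Y k)\<^sup>2\<close> the test statistic equals
  \<open>(N n + 2 (p - p0) W n)\<^sup>2 / W n\<close>. For every \<open>p\<close>, second and fourth moments of the walk over dyadic
  blocks show \<open>W n \<longrightarrow> \<infinity>\<close> almost surely, and a maximal inequality for an exponential supermartingale gives
  \<open>N n = o(W n)\<close>; this settles \<open>p \<noteq> p0\<close>. If \<open>p = p0\<close>, the statistic is \<open>(N n)\<^sup>2 / W n\<close>. For \<open>a < 1/2\<close>
  the ratio of \<open>W n\<close> and \<open>ln n / (1 - 2 a)\<close> tends to one in mean, and the central limit theorem for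
  martingales applies to \<open>N n\<close>. For \<open>a > 1/2\<close> the walk, rescaled by a deterministic sequence of order
  \<open>n powr a\<close>, is a martingale \<open>L n\<close> converging in mean square to a limit without atom at zero;
  asymptotically the limit cancels in \<open>(N n)\<^sup>2 / W n\<close>, which leaves the square of a martingale with
  deterministic weights, to which the central limit theorem applies.
\<close>

subsection \<open>One-step identities\<close>

text \<open>The alternative leaves \<open>p\<close> anywhere in [0,1], so the divergence of
  \<open>W\<close> has to be proved for every \<open>a\<close>, including
  \<open>\<bar>a\<bar> = 1\<close> and the critical value \<open>a = 1/2\<close>; this is why
  conditional moments over a block are compared with the scale that the walk has at the start of the
  block. Under the null hypothesis the obstacle is that \<open>W\<close> has a deterministic rate
  only for \<open>a < 1/2\<close>. For \<open>a > 1/2\<close> the quotient of \<open>W n\<close> and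
  its rate \<open>s n\<close> approaches the square of a random limit, and norming \<open>N\<close>
  deterministically would lead to a mixture of normal laws. Freezing \<open>L\<close> at a fixed
  time \<open>m\<close> lets the random factor drop out of the ratio without any notion of stable
  convergence. At \<open>a = 1/2\<close>, which \<open>p0 \<noteq> 3/4\<close> excludes, the factor
  \<open>1 - 2 a\<close> in front of \<open>W\<close> in \<open>W_identity\<close> vanishes and the
  increments of the rescaled walk are no longer square summable. The steps take the values 1 and -1
  at every point, not only almost surely, so that each function of finitely many steps is
  simple.\<close>

locale reinforced_walk = prob_space M for M :: "'a measure" +
  fixes a :: real and X :: "nat \<Rightarrow> 'a \<Rightarrow> real"
  assumes abs_a_le_1: "\<bar>a\<bar> \<le> 1"
    and X_measurable: "\<And>n. n \<ge> 1 \<Longrightarrow> X n \<in> borel_measurable M"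
    and X_cases: "\<And>n w. n \<ge> 1 \<Longrightarrow> X n w = 1 \<or> X n w = -1"
    and expectation_step: "\<And>n f. n \<ge> 1 \<Longrightarrow>
          (\<And>w w'. (\<And>k. k \<in> {1..n} \<Longrightarrow> X k w = X k w') \<Longrightarrow> f w = f w') \<Longrightarrow>
          expectation (\<lambda>w. f w * X (Suc n) w) =
          a * expectation (\<lambda>w. f w * ((\<Sum>k=1..n. X k w) / real n))"
begin

abbreviation E :: "('a \<Rightarrow> 'b::{banach, second_countable_topology}) \<Rightarrow> 'b" where
  "E \<equiv> lebesgue_integral M"

text \<open>A function is determined at time \<open>n\<close> if it depends on \<open>X 1, \<dots>, X n\<close> only. There are no
  conditional expectations below: an identity for \<open>E (f * Z)\<close> with arbitrary \<open>f\<close> determined at time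
  \<open>n\<close> takes the place of one for the conditional expectation of \<open>Z\<close>.\<close>

definition determined :: "nat \<Rightarrow> ('a \<Rightarrow> 'b) \<Rightarrow> bool" where
  "determined n f \<longleftrightarrow> (\<forall>w w'. (\<forall>k\<in>{1..n}. X k w = X k w') \<longrightarrow> f w = f w')"

definition S :: "nat \<Rightarrow> 'a \<Rightarrow> real" where "S n w = (\<Sum>k=1..n. X k w)"
definition Y :: "nat \<Rightarrow> 'a \<Rightarrow> real" where "Y n w = S n w / real n"
definition xi :: "nat \<Rightarrow> 'a \<Rightarrow> real" where "xi n w = X (Suc n) w - a * Y n w"

section \<open>Closure properties of functions of the first steps\<close>

lemma det_const: "determined n (\<lambda>_. c)"
  by (simp add: determined_def)

lemma det_X: "k \<in> {1..n} \<Longrightarrow> determined n (X k)"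
  by (auto simp: determined_def)

lemma det_comp: "determined n f \<Longrightarrow> determined n (\<lambda>w. F (f w))"
  unfolding determined_def by metis

lemma det_comp2: "determined n f \<Longrightarrow> determined n g \<Longrightarrow> determined n (\<lambda>w. F (f w) (g w))"
  unfolding determined_def by metis

lemma det_if: "determined n P \<Longrightarrow> determined n f \<Longrightarrow> determined n g \<Longrightarrow>
    determined n (\<lambda>w. if P w then f w else g w)"
  unfolding determined_def by metis

lemma det_sum: "(\<And>i. i \<in> I \<Longrightarrow> determined n (f i)) \<Longrightarrow> determined n (\<lambda>w. \<Sum>i\<in>I. f i w)"
  unfolding determined_def by (auto intro!: sum.cong)

lemma det_mono: "determined m f \<Longrightarrow> m \<le> n \<Longrightarrow> determined n f"
  unfolding determined_def by (meson atLeastAtMost_iff order_trans)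

lemma det_S: "k \<le> n \<Longrightarrow> determined n (S k)"
  unfolding S_def by (intro det_sum det_X) auto

lemma det_Y: "k \<le> n \<Longrightarrow> determined n (Y k)"
  unfolding Y_def by (rule det_comp[OF det_S])

lemma det_xi: "k < n \<Longrightarrow> determined n (xi k)"
  unfolding xi_def by (intro det_comp2[where F="\<lambda>x y. x - a * y"] det_X det_Y) auto

lemmas det_plus = det_comp2[where F="(+)"]
  and det_minus = det_comp2[where F="(-)"]
  and det_times = det_comp2[where F="(*)"]
  and det_divide = det_comp2[where F="(/)"]
  and det_power = det_comp[where F="\<lambda>x. x ^ n" for n]
  and det_uminus = det_comp[where F=uminus]
  and det_abs = det_comp[where F=abs]
  and det_exp = det_comp[where F=exp]
  and det_of_real = det_comp[where F=complex_of_real]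
  and det_le = det_comp2[where F="(\<le>)"]
  and det_less = det_comp2[where F="(<)"]

lemmas det_intros = det_const det_X det_S det_Y det_xi det_plus det_minus det_times det_divide
  det_power det_uminus det_abs det_exp det_of_real det_le det_less det_if det_sum

text \<open>The set \<open>H w\<close> of times at which the step is 1 encodes the first
  \<open>n\<close> steps, so \<open>f\<close> factors through a map into the finite set
  \<open>Pow {1..n}\<close>. All later integrability goes back to this.\<close>

lemma measurable_determined:
  assumes "determined n f"
  shows "f \<in> M \<rightarrow>\<^sub>M count_space UNIV" and "finite (range f)"
proof -
  define H where "H w = {k \<in> {1..n}. X k w = 1}" for w
  define g where "g s = f (SOME w. H w = s)" for s
  have agree: "\<forall>k\<in>{1..n}. X k w = X k w'" if "H w = H w'" for w w'
  proof
    fix k assume k: "k \<in> {1..n}"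
    have "k \<in> H w \<longleftrightarrow> k \<in> H w'" using that by simp
    thus "X k w = X k w'" using k X_cases[of k w] X_cases[of k w'] unfolding H_def by auto
  qed
  have f: "f = (\<lambda>w. g (H w))"
  proof
    fix w
    have "H (SOME w'. H w' = H w) = H w" by (rule someI) (rule refl)
    thus "f w = g (H w)" using assms agree unfolding determined_def g_def by metis
  qed
  have "range H \<subseteq> Pow {1..n}" by (auto simp: H_def)
  hence fin: "finite (range H)" by (rule finite_subset) simp
  have "range f = g ` range H" unfolding f by auto
  thus "finite (range f)" using fin by simp
  have "(\<lambda>w. H w) \<in> M \<rightarrow>\<^sub>M count_space (Pow {1..n})"
  proof (subst measurable_count_space_eq2, simp, intro conjI ballI)
    show "H \<in> space M \<rightarrow> Pow {1..n}" by (auto simp: H_def)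
    fix s assume s: "s \<in> Pow {1..n}"
    have "H -` {s} \<inter> space M = {w\<in>space M. \<forall>k\<in>{1..n}. (X k w = 1 \<longleftrightarrow> k \<in> s)}"
    proof (intro set_eqI iffI)
      fix w assume "w \<in> {w\<in>space M. \<forall>k\<in>{1..n}. (X k w = 1 \<longleftrightarrow> k \<in> s)}"
      thus "w \<in> H -` {s} \<inter> space M" using s unfolding H_def by blast
    qed (auto simp: H_def)
    also have "... \<in> sets M"
    proof (rule sets.sets_Collect_finite_All)
      fix k assume "k \<in> {1..n}"
      hence [measurable]: "X k \<in> borel_measurable M" by (intro X_measurable) auto
      show "{w\<in>space M. X k w = 1 \<longleftrightarrow> k \<in> s} \<in> sets M" by measurable
    qed auto
    finally show "H -` {s} \<inter> space M \<in> sets M" .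
  qed
  from measurable_compose[OF this, of g "count_space UNIV"]
  show "f \<in> M \<rightarrow>\<^sub>M count_space UNIV" unfolding f by simp
qed

lemma borel_measurable_determined: "determined n f \<Longrightarrow> f \<in> borel_measurable M"
  by (rule measurable_compose[OF measurable_determined(1), of _ _ "\<lambda>x. x"]) auto

lemma determined_bounded:
  fixes f :: "'a \<Rightarrow> 'b::real_normed_vector"
  assumes "determined n f" obtains C where "\<And>w. norm (f w) \<le> C"
proof -
  have "bounded (range f)" using measurable_determined(2)[OF assms] by (rule finite_imp_bounded)
  thus ?thesis using that unfolding bounded_iff by auto
qed

lemma integrable_determined:
  fixes f :: "'a \<Rightarrow> 'b::{banach, second_countable_topology}"
  assumes "determined n f" shows "integrable M f"
proof -
  obtain C where "\<And>w. norm (f w) \<le> C" using determined_bounded[OF assms] by blast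
  thus ?thesis by (intro integrable_const_bound[where B=C] borel_measurable_determined[OF assms]) auto
qed


section \<open>Expectations of steps and of the martingale differences \<open>xi\<close>\<close>

lemma expectation_add:
  fixes f g :: "'a \<Rightarrow> 'b::{banach, second_countable_topology}"
  assumes "determined n f" "determined n g"
  shows "E (\<lambda>w. f w + g w) = E f + E g"
  using assms by (intro Bochner_Integration.integral_add integrable_determined)

lemma expectation_add3:
  fixes f g h :: "'a \<Rightarrow> 'b::{banach, second_countable_topology}"
  assumes "determined n f" "determined n g" "determined n h"
  shows "E (\<lambda>w. f w + (g w + h w)) = E f + (E g + E h)"
  using assms by (simp add: expectation_add[of n] det_plus)

lemma abs_X: "k \<ge> 1 \<Longrightarrow> \<bar>X k w\<bar> = 1"
  using X_cases[of k w] by auto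

lemma X_sq: "k \<ge> 1 \<Longrightarrow> (X k w)^2 = 1"
  using X_cases[of k w] by auto

lemma abs_S_le: "\<bar>S n w\<bar> \<le> real n"
proof -
  have "\<bar>S n w\<bar> \<le> (\<Sum>k=1..n. \<bar>X k w\<bar>)" unfolding S_def by (rule sum_abs)
  also have "... = (\<Sum>k=1..n. 1)" by (intro sum.cong) (auto simp: abs_X)
  finally show ?thesis by simp
qed

lemma abs_Y_le_1: "\<bar>Y n w\<bar> \<le> 1"
  using abs_S_le[of n w] by (cases "n = 0") (auto simp: Y_def abs_divide)

lemma Y_sq_le_1: "(Y n w)^2 \<le> 1"
  using abs_Y_le_1[of n w] by (simp add: abs_square_le_1)

lemma abs_aY_le_1: "\<bar>a * Y n w\<bar> \<le> 1"
  unfolding abs_mult using abs_a_le_1 abs_Y_le_1[of n w] by (simp add: mult_le_one)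

lemma abs_xi_le: "\<bar>xi n w\<bar> \<le> 2"
  using abs_X[of "Suc n" w] abs_aY_le_1[of n w] unfolding xi_def by simp

lemma S_Suc: "S (Suc n) w = S n w + X (Suc n) w"
  by (simp add: S_def)

lemma S_1_sq: "(S 1 w)^2 = 1"
  by (simp add: S_def X_sq)

lemma X_Suc_eq: "X (Suc n) w = a * Y n w + xi n w"
  by (simp add: xi_def)

lemma expectation_X:
  fixes f :: "'a \<Rightarrow> real"
  assumes "n \<ge> 1" "determined n f"
  shows "E (\<lambda>w. f w * X (Suc n) w) = a * E (\<lambda>w. f w * Y n w)"
  unfolding Y_def S_def
  by (rule expectation_step) (use assms in \<open>auto simp: determined_def\<close>)

lemma expectation_X_complex:
  fixes f :: "'a \<Rightarrow> complex"
  assumes n: "n \<ge> 1" and f: "determined n f"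
  shows "E (\<lambda>w. f w * complex_of_real (X (Suc n) w)) =
    of_real a * E (\<lambda>w. f w * complex_of_real (Y n w))"
proof (rule complex_eqI)
  have i: "integrable M (\<lambda>w. f w * complex_of_real (X (Suc n) w))"
       "integrable M (\<lambda>w. f w * complex_of_real (Y n w))"
    by (rule integrable_determined[of "Suc n"]; (intro det_intros det_mono[OF f]; simp))+
  have R: "determined n (\<lambda>w. Re (f w))" "determined n (\<lambda>w. Im (f w))" by (rule det_comp[OF f])+
  show "Re (E (\<lambda>w. f w * complex_of_real (X (Suc n) w))) =
    Re (of_real a * E (\<lambda>w. f w * complex_of_real (Y n w)))"
    using integral_bounded_linear[OF bounded_linear_Re i(1)]
      integral_bounded_linear[OF bounded_linear_Re i(2)] expectation_X[OF n R(1)] by simp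
  show "Im (E (\<lambda>w. f w * complex_of_real (X (Suc n) w))) =
    Im (of_real a * E (\<lambda>w. f w * complex_of_real (Y n w)))"
    using integral_bounded_linear[OF bounded_linear_Im i(1)]
      integral_bounded_linear[OF bounded_linear_Im i(2)] expectation_X[OF n R(2)] by simp
qed

lemma expectation_xi:
  fixes f :: "'a \<Rightarrow> real"
  assumes "n \<ge> 1" "determined n f"
  shows "E (\<lambda>w. f w * xi n w) = 0"
proof -
  have "E (\<lambda>w. f w * xi n w) =
      E (\<lambda>w. f w * X (Suc n) w - a * (f w * Y n w))"
    by (simp add: xi_def algebra_simps)
  also have "... = E (\<lambda>w. f w * X (Suc n) w) - E (\<lambda>w. a * (f w * Y n w))"
    by (rule Bochner_Integration.integral_diff;
        rule integrable_determined[of "Suc n"]; intro det_intros det_mono[OF assms(2)]; simp)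
  finally show ?thesis using expectation_X[OF assms] by simp
qed

text \<open>\<open>X^2 = 1\<close> writes \<open>xi^2\<close> as \<open>1 - a^2 Y^2\<close> plus a
  multiple of \<open>xi\<close>: the conditional variance of a step with conditional mean
  \<open>a Y\<close>.\<close>

lemma expectation_xi_sq:
  fixes f :: "'a \<Rightarrow> real"
  assumes "n \<ge> 1" "determined n f"
  shows "E (\<lambda>w. f w * (xi n w)^2) = E (\<lambda>w. f w * (1 - a^2 * (Y n w)^2))"
proof -
  have "f w * (xi n w)^2 = f w * (1 - a^2 * (Y n w)^2) + (- 2 * a * f w * Y n w) * xi n w" for w
  proof -
    have "(X (Suc n) w)^2 = 1" by (rule X_sq) simp
    hence sq: "(xi n w)^2 = 1 - a^2 * (Y n w)^2 - 2 * a * Y n w * xi n w"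
      unfolding xi_def by (simp add: power2_eq_square algebra_simps)
    show ?thesis unfolding sq by (simp add: algebra_simps)
  qed
  hence "E (\<lambda>w. f w * (xi n w)^2) =
     E (\<lambda>w. f w * (1 - a^2 * (Y n w)^2) + (- 2 * a * f w * Y n w) * xi n w)" by simp
  also have "... = E (\<lambda>w. f w * (1 - a^2 * (Y n w)^2)) +
      E (\<lambda>w. (- 2 * a * f w * Y n w) * xi n w)"
    by (rule expectation_add[of "Suc n"]; intro det_intros det_mono[OF assms(2)]; simp)
  also have "E (\<lambda>w. (- 2 * a * f w * Y n w) * xi n w) = 0"
    by (rule expectation_xi[OF assms(1)]) (intro det_intros assms(2); simp)
  finally show ?thesis by simp
qed

lemma one_minus_aY_bounds: "1 - a^2 \<le> 1 - a^2 * (Y n w)^2" "0 \<le> 1 - a^2 * (Y n w)^2" "1 - a^2 * (Y n w)^2 \<le> 1"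
  using Y_sq_le_1[of n w] abs_a_le_1 mult_le_one[of "a^2" "(Y n w)^2"] mult_left_mono[of "(Y n w)^2" 1 "a^2"]
  by (auto simp: abs_square_le_1)

lemma expectation_mono:
  fixes f g :: "'a \<Rightarrow> real"
  assumes "determined n f" "determined n g" "\<And>w. f w \<le> g w"
  shows "E f \<le> E g"
  by (rule integral_mono) (use assms integrable_determined in auto)

lemma expectation_xi_sq_le:
  fixes f :: "'a \<Rightarrow> real"
  assumes "n \<ge> 1" "determined n f" "\<And>w. 0 \<le> f w"
  shows "E (\<lambda>w. f w * (xi n w)^2) \<le> E f"
  unfolding expectation_xi_sq[OF assms(1,2)]
  using assms(3) one_minus_aY_bounds
  by (intro expectation_mono[of n]) (intro det_intros assms | simp add: mult_left_le)+

text \<open>Increments at different times are orthogonal, and the conditional variance of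
  \<open>xi\<close> is at most 1.\<close>

lemma martingale_sq_le:
  fixes H :: "nat \<Rightarrow> 'a \<Rightarrow> real"
  assumes "m \<ge> 1" "\<And>k. k \<ge> m \<Longrightarrow> determined k (H k)"
  shows "E (\<lambda>w. (\<Sum>k=m..<n. H k w * xi k w)^2) \<le> (\<Sum>k=m..<n. E (\<lambda>w. (H k w)^2))"
proof (induction n)
  case (Suc n)
  show ?case
  proof (cases "m \<le> n")
    case True
    define T where "T w = (\<Sum>k=m..<n. H k w * xi k w)" for w
    have Hd: "determined n (H k)" if "k \<in> {m..n}" for k
      using that by (intro det_mono[OF assms(2)]) auto
    have T: "determined n T" unfolding T_def using Hd by (intro det_intros) auto
    have "E (\<lambda>w. (\<Sum>k=m..<Suc n. H k w * xi k w)^2) =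
      E (\<lambda>w. (T w)^2 + ((2 * T w * H n w) * xi n w + (H n w)^2 * (xi n w)^2))"
      using True by (simp add: T_def power2_eq_square algebra_simps)
    also have "... = E (\<lambda>w. (T w)^2) + (E (\<lambda>w. (2 * T w * H n w) * xi n w) +
        E (\<lambda>w. (H n w)^2 * (xi n w)^2))"
      by (rule expectation_add3[of "Suc n"]; intro det_intros det_mono[OF T] det_mono[OF Hd[of n]]; use True in simp)
    also have "E (\<lambda>w. (2 * T w * H n w) * xi n w) = 0"
      by (rule expectation_xi; (intro det_intros T Hd)?; use True assms(1) in simp)
    also have "E (\<lambda>w. (H n w)^2 * (xi n w)^2) \<le> E (\<lambda>w. (H n w)^2)"
      by (rule expectation_xi_sq_le; (intro det_intros Hd)?; use True assms(1) in simp)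
    also have "E (\<lambda>w. (T w)^2) \<le> (\<Sum>k=m..<n. E (\<lambda>w. (H k w)^2))"
      unfolding T_def by (rule Suc.IH)
    finally show ?thesis using True by simp
  qed simp
qed simp

text \<open>The weight \<open>f\<close> turns this into a recursion for moments conditional on time
  \<open>m\<close>, as the block estimates need; \<open>f = 1\<close> gives the unconditional
  moments.\<close>

lemma second_moment_Suc:
  fixes f :: "'a \<Rightarrow> real"
  assumes "determined m f" "1 \<le> m" "m \<le> n"
  shows "E (\<lambda>w. f w * (S (Suc n) w)^2) =
    (1 + 2 * a / n) * E (\<lambda>w. f w * (S n w)^2) + E f"
proof -
  have f: "determined n f" by (rule det_mono[OF assms(1,3)])
  have "(S (Suc n) w)^2 = (S n w)^2 + 2 * S n w * X (Suc n) w + 1" for w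
    unfolding S_Suc power2_sum X_sq[of "Suc n", simplified] by simp
  hence "E (\<lambda>w. f w * (S (Suc n) w)^2) =
    E (\<lambda>w. f w * (S n w)^2 + (2 * (f w * S n w * X (Suc n) w) + f w))"
    by (simp add: algebra_simps)
  also have "... = E (\<lambda>w. f w * (S n w)^2) +
     (E (\<lambda>w. 2 * (f w * S n w * X (Suc n) w)) + E f)"
    by (rule expectation_add3[of "Suc n"]; intro det_intros det_mono[OF f]; simp)
  also have "E (\<lambda>w. 2 * (f w * S n w * X (Suc n) w)) = 2 * (a * E (\<lambda>w. f w * S n w * Y n w))"
    using expectation_X[of n "\<lambda>w. f w * S n w"] assms by (simp add: det_intros f)
  also have "E (\<lambda>w. f w * S n w * Y n w) = E (\<lambda>w. f w * (S n w)^2) / n"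
    by (simp add: Y_def power2_eq_square mult.assoc flip: integral_divide_zero)
  finally show ?thesis by (simp add: algebra_simps)
qed

lemma fourth_moment_Suc:
  fixes f :: "'a \<Rightarrow> real"
  assumes "determined m f" "1 \<le> m" "m \<le> n"
  shows "E (\<lambda>w. f w * (S (Suc n) w)^4) =
    (1 + 4 * a / n) * E (\<lambda>w. f w * (S n w)^4) +
    (6 + 4 * a / n) * E (\<lambda>w. f w * (S n w)^2) + E f"
proof -
  have f: "determined n f" by (rule det_mono[OF assms(1,3)])
  \<comment> \<open>Odd powers of the step equal the step and even powers equal 1, so the quartic is
    linear in it.\<close>
  have "(S (Suc n) w)^4 = (S n w)^4 + 4 * (S n w)^3 * X (Suc n) w + 6 * (S n w)^2
          + 4 * S n w * X (Suc n) w + 1" for w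
    using X_cases[of "Suc n" w] unfolding S_Suc by (auto simp: algebra_simps power4_eq_xxxx power3_eq_cube power2_eq_square)
  hence "E (\<lambda>w. f w * (S (Suc n) w)^4) =
    E (\<lambda>w. (f w * (S n w)^4 + 6 * (f w * (S n w)^2))
       + ((f w * (4 * (S n w)^3 + 4 * S n w)) * X (Suc n) w + f w))"
    by (simp add: algebra_simps)
  also have "... = (E (\<lambda>w. f w * (S n w)^4) + E (\<lambda>w. 6 * (f w * (S n w)^2))) +
     (E (\<lambda>w. (f w * (4 * (S n w)^3 + 4 * S n w)) * X (Suc n) w) + E f)"
    by (subst Bochner_Integration.integral_add, rule_tac [3] arg_cong2[where f="(+)"],
          rule_tac [3] Bochner_Integration.integral_add, rule_tac [5] Bochner_Integration.integral_add;
          rule integrable_determined[of "Suc n"]; intro det_intros det_mono[OF f]; simp)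
  also have "E (\<lambda>w. (f w * (4 * (S n w)^3 + 4 * S n w)) * X (Suc n) w) =
     a * E (\<lambda>w. (f w * (4 * (S n w)^3 + 4 * S n w)) * Y n w)"
    by (rule expectation_X; (intro det_intros f)?; use assms in simp)
  also have "E (\<lambda>w. (f w * (4 * (S n w)^3 + 4 * S n w)) * Y n w) =
     E (\<lambda>w. 4 / n * (f w * (S n w)^4) + 4 / n * (f w * (S n w)^2))"
    using assms by (intro arg_cong[where f=E] ext)
       (simp add: Y_def field_simps power4_eq_xxxx power3_eq_cube power2_eq_square)
  also have "... = E (\<lambda>w. 4 / n * (f w * (S n w)^4)) + E (\<lambda>w. 4 / n * (f w * (S n w)^2))"
    by (rule expectation_add[of "Suc n"]; intro det_intros det_mono[OF f]; simp)
  finally show ?thesis unfolding integral_mult_right_zero by (simp add: algebra_simps)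
qed

end

lemma exp_minus_le_quadratic:
  fixes y :: real assumes "0 \<le> y" shows "exp (- y) \<le> 1 - y + y^2"
proof -
  have "1 \<le> 1 + y ^ 3" using assms by simp
  also have "... = (1 - y + y^2) * (1 + y)" by (simp add: algebra_simps power2_eq_square power3_eq_cube)
  finally have "1 / (1 + y) \<le> 1 - y + y^2" using assms by (simp add: field_simps)
  moreover have "exp (- y) \<le> 1 / (1 + y)"
    using exp_ge_add_one_self[of y] assms by (simp add: exp_minus field_simps)
  ultimately show ?thesis by simp
qed

context reinforced_walk begin

subsection \<open>Divergence of the quadratic variation\<close>

definition W :: "nat \<Rightarrow> 'a \<Rightarrow> real" where "W n w = (\<Sum>k=1..<n. (Y k w)^2)"
definition N :: "nat \<Rightarrow> 'a \<Rightarrow> real" where "N n w = (\<Sum>k=1..<n. Y k w * xi k w)"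

lemma W_mono: "m \<le> n \<Longrightarrow> W m w \<le> W n w"
  unfolding W_def by (intro sum_mono2) auto

lemma W_nonneg: "0 \<le> W n w"
  unfolding W_def by (intro sum_nonneg) auto

lemma det_W: "n \<le> Suc m \<Longrightarrow> determined m (W n)"
  unfolding W_def by (intro det_intros) auto

lemma det_N: "n \<le> m \<Longrightarrow> determined m (N n)"
  unfolding N_def by (intro det_intros) auto

lemma expectation_nonneg:
  fixes f :: "'a \<Rightarrow> real"
  shows "(\<And>w. 0 \<le> f w) \<Longrightarrow> 0 \<le> E f"
  by (rule Bochner_Integration.integral_nonneg) auto

text \<open>As \<open>a \<ge> -1\<close>, a step multiplies the moment by at least
  \<open>1 - 2 / (m + j)\<close> and adds \<open>E f\<close>. For \<open>j \<le> m / 4\<close> the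
  damping costs per step at most \<open>2 / m\<close> times the initial value plus a quarter of
  \<open>E f\<close>, so more than half of the added \<open>E f\<close> survives.\<close>

lemma second_moment_lower:
  fixes f :: "'a \<Rightarrow> real"
  assumes f: "determined m f" "\<And>w. 0 \<le> f w" and m: "m \<ge> 2" and j: "4 * j \<le> m"
  shows "E (\<lambda>w. f w * (S (m + j) w)^2) \<ge>
    (1 - 2 * j / m) * E (\<lambda>w. f w * (S m w)^2) + j / 2 * E f"
  using j
proof (induction j)
  case (Suc j)
  define x where "x = E (\<lambda>w. f w * (S m w)^2)"
  define u where "u = E (\<lambda>w. f w * (S (m + j) w)^2)"
  define F where "F = E f"
  define l where "l = (1 - 2 * j / m) * x + j / 2 * F"
  have pos: "x \<ge> 0" "u \<ge> 0" "F \<ge> 0"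
    unfolding x_def u_def F_def using f(2) by (auto intro!: expectation_nonneg)
  have IH: "l \<le> u" using Suc by (simp add: l_def x_def u_def F_def)
  have jm: "real j / m \<le> 1/4" using Suc.prems m by (simp add: field_simps)
  have "2 * (real j / m) \<le> 1" using jm by linarith
  hence "0 \<le> 1 - 2 * j / m" by simp
  hence l0: "0 \<le> l" using pos unfolding l_def by (intro add_nonneg_nonneg mult_nonneg_nonneg) auto
  have "l \<le> x + j / 2 * F" unfolding l_def using pos by (simp add: mult_left_le_one_le jm algebra_simps)
  hence "2 / real (m + j) * l \<le> 2 / m * (x + j / 2 * F)"
    using m l0 by (intro mult_mono) (auto simp: frac_le)
  also have "... = 2 / m * x + real j / m * F" by (simp add: algebra_simps)
  also have "... \<le> 2 / m * x + 1/4 * F" using jm pos by (intro add_left_mono mult_right_mono)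
  finally have l2: "2 / real (m + j) * l \<le> 2 / m * x + 1/4 * F" .
  have "(1 - 2 * Suc j / m) * x + Suc j / 2 * F = l - 2 / m * x + F / 2"
    unfolding l_def using m by (simp add: field_simps)
  also have "... \<le> l - 2 / real (m + j) * l + F" using l2 pos by simp
  also have "... = (1 - 2 / real (m + j)) * l + F" by (simp add: algebra_simps)
  also have "... \<le> (1 - 2 / real (m + j)) * u + F" using m IH by (intro add_right_mono mult_left_mono) auto
  also have "... \<le> (1 + 2 * a / real (m + j)) * u + F"
  proof -
    have "- (2 / real (m + j)) \<le> 2 * a / real (m + j)"
      unfolding minus_divide_left using abs_a_le_1 by (intro divide_right_mono) auto
    thus ?thesis using pos by (intro add_right_mono mult_right_mono) auto
  qed
  also have "... = E (\<lambda>w. f w * (S (m + Suc j) w)^2)"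
    using second_moment_Suc[of m f "m + j"] f m by (simp add: u_def F_def)
  finally show ?case by (simp add: x_def F_def)
qed simp

text \<open>The coefficients are chosen such that \<open>E (f * (S\<^sup>4 + 10 n S\<^sup>2 + 7 n\<^sup>2))\<close> grows by a factor of at most
  \<open>1 + 6 / n\<close> per step.\<close>

lemma fourth_moment_growth:
  fixes f :: "'a \<Rightarrow> real"
  assumes f: "determined m f" "\<And>w. 0 \<le> f w" and m: "m \<ge> 1" and n: "m \<le> n"
  defines "G \<equiv> \<lambda>n. E (\<lambda>w. f w * (S n w)^4) +
              10 * n * E (\<lambda>w. f w * (S n w)^2) + 7 * (real n)^2 * E f"
  shows "G n \<le> (n / m) ^ 6 * G m"
  using n
proof (induction n rule: dec_induct)
  case base
  show ?case using m by simp
next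
  case (step n)
  define m4 where "m4 = E (\<lambda>w. f w * (S n w)^4)"
  define u where "u = E (\<lambda>w. f w * (S n w)^2)"
  define F where "F = E f"
  have n: "real n \<ge> 1" using step m by simp
  have pos: "m4 \<ge> 0" "u \<ge> 0" "F \<ge> 0"
    unfolding m4_def u_def F_def using f(2) by (auto intro!: expectation_nonneg)
  have a: "a / n \<le> 1 / n" using abs_a_le_1 n by (intro divide_right_mono) auto
  have aw: "a / n * m4 \<le> 1 / n * m4" and au: "a / n * u \<le> 1 / n * u" and nu: "1 / n * u \<le> u"
    using mult_right_mono[OF a pos(1)] mult_right_mono[OF a pos(2)] mult_right_mono[of "1 / real n" 1 u] n pos
    by auto
  have au': "a * u \<le> u" using abs_a_le_1 pos mult_right_mono[of a 1 u] by simp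
  have w': "E (\<lambda>w. f w * (S (Suc n) w)^4) \<le> m4 + 4 / n * m4 + 10 * u + F"
  proof -
    have "E (\<lambda>w. f w * (S (Suc n) w)^4) = (1 + 4 * a / n) * m4 + (6 + 4 * a / n) * u + F"
      unfolding m4_def u_def F_def by (rule fourth_moment_Suc[OF f(1) m step(1)])
    also have "... = m4 + 4 * (a / n * m4) + 6 * u + 4 * (a / n * u) + F" by (simp add: algebra_simps)
    also have "... \<le> m4 + 4 * (1 / n * m4) + 6 * u + 4 * u + F"
      using aw order_trans[OF au nu] by (intro add_mono mult_left_mono) auto
    finally show ?thesis by simp
  qed
  have u': "E (\<lambda>w. f w * (S (Suc n) w)^2) \<le> u + 2 / n * u + F"
  proof -
    have "E (\<lambda>w. f w * (S (Suc n) w)^2) = (1 + 2 * a / n) * u + F"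
      unfolding m4_def u_def F_def by (rule second_moment_Suc[OF f(1) m step(1)])
    also have "... = u + 2 * (a / n * u) + F" by (simp add: algebra_simps)
    also have "... \<le> u + 2 * (1 / n * u) + F"
      using au by (intro add_mono mult_left_mono) auto
    finally show ?thesis by simp
  qed
  have "G (Suc n) \<le> (m4 + 4 / n * m4 + 10 * u + F) + 10 * Suc n * (u + 2 / n * u + F) + 7 * (real (Suc n))^2 * F"
    unfolding G_def F_def[symmetric] using w' u' by (intro add_mono mult_left_mono) auto
  also have "... = m4 + 4 / n * m4 + (10 * n + 40 + 20 / n) * u + (7 * (real n)^2 + 24 * n + 18) * F"
    using n by (simp add: field_simps power2_eq_square)
  also have "... \<le> m4 + 6 / n * m4 + (10 * n + 60) * u + (7 * (real n)^2 + 42 * n) * F"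
  proof -
    have "4 / n * m4 \<le> 6 / n * m4" using n pos by (intro mult_right_mono divide_right_mono) auto
    moreover have "(10 * n + 40 + 20 / n) * u \<le> (10 * n + 60) * u"
      using n pos by (intro mult_right_mono) (auto simp: field_simps)
    moreover have "(7 * (real n)^2 + 24 * n + 18) * F \<le> (7 * (real n)^2 + 42 * n) * F"
      using n pos by (intro mult_right_mono) auto
    ultimately show ?thesis by linarith
  qed
  also have "... = (1 + 6 * (1 / n)) * G n"
  proof -
    have "G n = m4 + 10 * n * u + 7 * (real n)^2 * F" by (simp add: G_def m4_def u_def F_def)
    thus ?thesis using n by (simp add: field_simps power2_eq_square)
  qed
  \<comment> \<open>Bernoulli's inequality replaces \<open>1 + 6 / n\<close> by a power whose
    product over the steps telescopes.\<close>
  also have "... \<le> (1 + 1 / n) ^ 6 * G n"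
  proof (rule mult_right_mono)
    have "-1 \<le> 1 / real n" by (rule order_trans[of _ 0]) auto
    thus "1 + 6 * (1 / n) \<le> (1 + 1 / n) ^ 6" using Bernoulli_inequality[of "1 / real n" 6] by simp
    show "0 \<le> G n" using pos unfolding G_def
      by (auto simp: m4_def[symmetric] u_def[symmetric] F_def[symmetric])
  qed
  also have "... \<le> (1 + 1 / n) ^ 6 * ((n / m) ^ 6 * G m)"
    using step.IH by (intro mult_left_mono) auto
  also have "... = ((1 + 1 / n) * (n / m)) ^ 6 * G m" by (simp add: power_mult_distrib power_divide)
  also have "(1 + 1 / n) * (n / m) = Suc n / m" using n m by (simp add: field_simps)
  finally show ?case .
qed

text \<open>On the block \<open>{4 r..<5 r}\<close> the sum \<open>T\<close> of the \<open>Y\<^sup>2\<close> has first and second conditional moments of order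
  \<open>b\<close> and \<open>b\<^sup>2\<close>, where \<open>b = 1 + (S m)\<^sup>2 / m\<close> and \<open>m = 4 r\<close>; hence \<open>exp (- T)\<close>, which is at most
  \<open>1 - l T + (l T)\<^sup>2\<close> for \<open>l = 1 / (1000 b)\<close>, contracts by a fixed factor, even if \<open>\<bar>a\<bar> = 1\<close>.\<close>

lemma block_contraction:
  fixes f :: "'a \<Rightarrow> real"
  assumes f: "determined (4 * r) f" "\<And>w. 0 \<le> f w" and r: "r \<ge> 2"
  shows "E (\<lambda>w. f w * exp (- (\<Sum>j<r. (Y (4 * r + j) w)^2))) \<le> (1 - 1/400000) * E f"
proof -
  define m where "m = 4 * r"
  define b where "b w = 1 + (S m w)^2 / m" for w
  define l where "l w = 1 / (1000 * b w)" for w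
  define T where "T w = (\<Sum>j<r. (Y (m + j) w)^2)" for w
  have b1: "b w \<ge> 1" for w unfolding b_def by simp
  have l0: "0 \<le> l w" "l w \<le> 1" "0 < l w" for w using b1[of w] unfolding l_def by (auto simp: field_simps)
  have T0: "T w \<ge> 0" for w unfolding T_def by (intro sum_nonneg) auto
  have f: "determined m f" "\<And>w. 0 \<le> f w" using f by (auto simp: m_def)
  have det_l: "determined m l" unfolding l_def b_def by (intro det_intros) simp
  have det_fl: "determined m (\<lambda>w. f w * l w)" "determined m (\<lambda>w. f w * (l w)^2)"
    by (intro det_intros f det_l)+
  have det_Y': "determined (m + r) (Y (m + j))" if "j < r" for j using that by (intro det_Y) auto
  have det_S': "determined (m + r) (S (m + j))" if "j < r" for j using that by (intro det_S) auto
  have det_T: "determined (m + r) T" unfolding T_def by (intro det_intros) auto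
  have det': "determined (m + r) f" "determined (m + r) l" by (rule det_mono[OF f(1)] det_mono[OF det_l]; simp)+
  have fl0: "0 \<le> f w * l w" "0 \<le> f w * (l w)^2" for w using f(2) l0 by auto
  have r': "real r \<ge> 2" using r by simp
  have E1: "E f / 200000 \<le> E (\<lambda>w. (f w * l w) * T w)"
  proof -
    define x where "x = E (\<lambda>w. (f w * l w) * (S m w)^2)"
    define F where "F = E (\<lambda>w. f w * l w)"
    have pos: "x \<ge> 0" "F \<ge> 0" unfolding x_def F_def using fl0 by (auto intro!: expectation_nonneg)
    have S2: "E (\<lambda>w. (f w * l w) * (S (m + j) w)^2) \<ge> x / 2 + j / 2 * F" if "j < r" for j
    proof -
      have "x / 2 + j / 2 * F \<le> (1 - 2 * j / m) * x + j / 2 * F"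
        using that pos(1) mult_right_mono[of "1/2" "1 - 2 * j / m" x] r by (simp add: m_def field_simps)
      also have "... \<le> E (\<lambda>w. (f w * l w) * (S (m + j) w)^2)"
        unfolding x_def F_def using that r second_moment_lower[OF det_fl(1) fl0(1), of j] by (simp add: m_def)
      finally show ?thesis .
    qed
    have gauss: "(\<Sum>j<r. real j) \<ge> (real r)^2 / 4"
    proof -
      have "(\<Sum>j<r. real j) = real r * (real r - 1) / 2" by (induction r) (auto simp: field_simps)
      moreover have "real r * (real r / 2) \<le> real r * (real r - 1)" using r' by (intro mult_left_mono) auto
      ultimately show ?thesis by (simp add: power2_eq_square)
    qed
    have "E f / 1000 = E (\<lambda>w. (f w * l w) * b w)"
      unfolding l_def using b1 by (simp add: less_le_trans[OF zero_less_one, THEN less_imp_neq, symmetric])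
    also have "... = E (\<lambda>w. f w * l w + (1 / m) * ((f w * l w) * (S m w)^2))"
      by (simp add: b_def algebra_simps)
    also have "... = F + E (\<lambda>w. (1 / m) * ((f w * l w) * (S m w)^2))" unfolding F_def
      by (intro Bochner_Integration.integral_add; rule integrable_determined[of m]; intro det_intros f det_l; simp)
    also have "... = F + x / m" by (simp add: x_def)
    \<comment> \<open>The constant 200 below is \<open>8 * 25\<close>. Summing \<open>S2\<close>
      over \<open>j\<close> contributes at least \<open>r x / 2 + r^2 F / 8\<close>, and the factor
      8 compensates its smaller coefficient; 25 comes from \<open>m + j \<le> 5 r\<close> in the
      denominator of \<open>Y\<close>.\<close>
    also have "... \<le> 8 * (x / (2 * r) + F / 8)" using pos r by (simp add: m_def field_simps)
    also have "... \<le> 200 * (1 / (25 * (real r)^2) * (r * x / 2 + (real r)^2 / 4 * F / 2))"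
      using r pos by (simp add: field_simps power2_eq_square)
    also have "... \<le> 200 * (1 / (25 * (real r)^2) * (r * x / 2 + (\<Sum>j<r. real j) * F / 2))"
      using gauss pos by (intro mult_left_mono add_left_mono divide_right_mono mult_right_mono) auto
    also have "r * x / 2 + (\<Sum>j<r. real j) * F / 2 = (\<Sum>j<r. x / 2 + j / 2 * F)"
      by (simp add: sum.distrib sum_distrib_right sum_divide_distrib)
    also have "200 * (1 / (25 * (real r)^2) * ...) \<le>
        200 * (1 / (25 * (real r)^2) * (\<Sum>j<r. E (\<lambda>w. (f w * l w) * (S (m + j) w)^2)))"
      using S2 by (intro mult_left_mono sum_mono) auto
    also have "1 / (25 * (real r)^2) * (\<Sum>j<r. E (\<lambda>w. (f w * l w) * (S (m + j) w)^2)) =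
        E (\<lambda>w. \<Sum>j<r. (f w * l w) * (1 / (25 * (real r)^2) * (S (m + j) w)^2))"
      by (subst Bochner_Integration.integral_sum)
         (auto simp: sum_distrib_left sum_divide_distrib simp flip: integral_mult_right_zero
            intro!: integrable_determined[of "m+r"] det_intros det' sum.cong)
    also have "... \<le> E (\<lambda>w. (f w * l w) * T w)"
    proof (rule expectation_mono[of "m + r"])
      fix w
      have "1 / (25 * (real r)^2) * (S (m + j) w)^2 \<le> (Y (m + j) w)^2" if "j < r" for j
      proof -
        have "(S (m + j) w)^2 / (real (5 * r))^2 \<le> (S (m + j) w)^2 / (real (m + j))^2"
          using that r by (intro divide_left_mono power_mono) (auto simp: m_def)
        thus ?thesis by (simp add: Y_def power_divide power_mult_distrib)
      qed
      hence "(\<Sum>j<r. 1 / (25 * (real r)^2) * (S (m + j) w)^2) \<le> (\<Sum>j<r. (Y (m + j) w)^2)"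
        by (intro sum_mono) auto
      thus "(\<Sum>j<r. (f w * l w) * (1 / (25 * (real r)^2) * (S (m + j) w)^2)) \<le> (f w * l w) * T w"
        unfolding T_def sum_distrib_left[symmetric] using fl0 by (intro mult_left_mono)
    qed (auto intro!: det_intros det' det_T)
    finally show ?thesis by simp
  qed
  \<comment> \<open>Cauchy-Schwarz over the \<open>r\<close> summands of \<open>T\<close> reduces
    the claim to fourth moments, which grow by at most \<open>(5/4)^6 < 4\<close> over the block. At
    time \<open>m\<close> the potential of \<open>fourth_moment_growth\<close> is at most of order
    \<open>m^2 b^2\<close>, and \<open>l^2\<close> offsets \<open>b^2\<close>.\<close>
  have E2: "E (\<lambda>w. (f w * (l w)^2) * (T w)^2) \<le> 5/2 * E f / 1000000"
  proof -
    define F where "F = E (\<lambda>w. f w * (l w)^2)"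
    define Gm where "Gm = E (\<lambda>w. (f w * (l w)^2) * (S m w)^4) +
              10 * m * E (\<lambda>w. (f w * (l w)^2) * (S m w)^2) + 7 * (real m)^2 * F"
    have "Gm = E (\<lambda>w. (f w * (l w)^2) * (S m w)^4 + 10 * m * ((f w * (l w)^2) * (S m w)^2)
        + 7 * (real m)^2 * (f w * (l w)^2))"
      unfolding Gm_def F_def integral_mult_right_zero[symmetric]
      by (subst Bochner_Integration.integral_add, rule_tac [3] arg_cong2[where f="(+)", OF _ refl],
          rule_tac [3] Bochner_Integration.integral_add[symmetric];
          rule integrable_determined[of m]; intro det_intros f det_l; simp)
    also have "... \<le> E (\<lambda>w. 10 * (real m)^2 / 1000000 * f w)"
    proof (rule expectation_mono[of m])
      fix w
      have lb: "(l w)^2 * (b w)^2 = 1 / 1000000" using b1[of w] by (simp add: l_def power_divide power_mult_distrib)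
      have mb: "real m * b w = m + (S m w)^2" using r by (simp add: b_def m_def field_simps)
      have "(S m w)^4 + 10 * m * (S m w)^2 + 7 * (real m)^2 \<le> 10 * (m + (S m w)^2)^2"
      proof -
        have "(S m w)^4 = ((S m w)^2)^2" by simp
        moreover have "0 \<le> m * (S m w)^2" "0 \<le> ((S m w)^2)^2" "0 \<le> (real m)^2" by auto
        ultimately show ?thesis unfolding power2_sum by simp
      qed
      also have "... = 10 * (real m)^2 * (b w)^2" by (simp add: mb[symmetric] power_mult_distrib)
      finally have "(f w * (l w)^2) * ((S m w)^4 + 10 * m * (S m w)^2 + 7 * (real m)^2) \<le>
          (f w * (l w)^2) * (10 * (real m)^2 * (b w)^2)"
        using fl0 by (intro mult_left_mono)
      also have "... = f w * (10 * (real m)^2) * ((l w)^2 * (b w)^2)" by (simp add: algebra_simps)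
      finally show "(f w * (l w)^2) * (S m w)^4 + 10 * m * ((f w * (l w)^2) * (S m w)^2)
        + 7 * (real m)^2 * (f w * (l w)^2) \<le> 10 * (real m)^2 / 1000000 * f w"
        unfolding lb by (simp add: algebra_simps)
    qed (intro det_intros f det_l; simp)+
    finally have Gm: "Gm \<le> 10 * (real m)^2 / 1000000 * E f" by simp
    have Ef: "0 \<le> E f" using f(2) by (rule expectation_nonneg)
    have S4: "E (\<lambda>w. (f w * (l w)^2) * (S (m + j) w)^4) \<le> 640 * (real r)^2 / 1000000 * E f"
      if "j < r" for j
    proof -
      have jm: "real (m + j) / m \<le> 5/4" using that by (simp add: m_def field_simps)
      have Gm0: "0 \<le> Gm" unfolding Gm_def F_def using fl0 by (auto intro!: expectation_nonneg add_nonneg_nonneg)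
      have "E (\<lambda>w. (f w * (l w)^2) * (S (m + j) w)^4) \<le> (real (m + j) / m) ^ 6 * Gm"
      proof (rule order_trans)
        have m1: "1 \<le> m" "m \<le> m + j" using r by (auto simp: m_def)
        show "E (\<lambda>w. (f w * (l w)^2) * (S (m + j) w)^4) +
              10 * real (m + j) * E (\<lambda>w. (f w * (l w)^2) * (S (m + j) w)^2) + 7 * (real (m + j))^2 * F
              \<le> (real (m + j) / m) ^ 6 * Gm"
          using fourth_moment_growth[OF det_fl(2) fl0(2) m1] unfolding Gm_def F_def by simp
        have "0 \<le> E (\<lambda>w. (f w * (l w)^2) * (S (m + j) w)^2)" "0 \<le> F"
          unfolding F_def using fl0 by (auto intro!: expectation_nonneg)
        thus "E (\<lambda>w. (f w * (l w)^2) * (S (m + j) w)^4) \<le>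
           E (\<lambda>w. (f w * (l w)^2) * (S (m + j) w)^4) +
              10 * real (m + j) * E (\<lambda>w. (f w * (l w)^2) * (S (m + j) w)^2) + 7 * (real (m + j))^2 * F"
          by simp
      qed
      also have "... \<le> (5/4) ^ 6 * Gm" using jm Gm0 by (intro mult_right_mono power_mono) auto
      also have "... \<le> 4 * Gm" using Gm0 by (intro mult_right_mono) (auto simp: power_divide)
      also have "... \<le> 4 * (10 * (real m)^2 / 1000000 * E f)" using Gm by (intro mult_left_mono) auto
      finally show ?thesis by (simp add: m_def power_mult_distrib mult_ac)
    qed
    have "E (\<lambda>w. (f w * (l w)^2) * (T w)^2) \<le>
        E (\<lambda>w. \<Sum>j<r. r / (real m) ^ 4 * ((f w * (l w)^2) * (S (m + j) w)^4))"
    proof (rule expectation_mono[of "m + r"])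
      fix w
      have "(T w)^2 \<le> r * (\<Sum>j<r. ((Y (m + j) w)^2)^2)"
        unfolding T_def using sum_squared_le_sum_of_squares[of "\<lambda>j. (Y (m + j) w)^2" "{..<r}"] by (simp add: mult.commute)
      also have "... \<le> r * (\<Sum>j<r. (S (m + j) w)^4 / (real m) ^ 4)"
      proof (intro mult_left_mono sum_mono)
        fix j
        have "(S (m + j) w)^4 / (real (m + j)) ^ 4 \<le> (S (m + j) w)^4 / (real m) ^ 4"
          using r by (intro divide_left_mono power_mono) (auto simp: m_def)
        thus "((Y (m + j) w)^2)^2 \<le> (S (m + j) w)^4 / (real m) ^ 4" by (simp add: Y_def power_divide flip: power_mult)
      qed auto
      finally have "(f w * (l w)^2) * (T w)^2 \<le> (f w * (l w)^2) * (r * (\<Sum>j<r. (S (m + j) w)^4 / (real m) ^ 4))"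
        using fl0 by (intro mult_left_mono)
      thus "(f w * (l w)^2) * (T w)^2 \<le> (\<Sum>j<r. r / (real m) ^ 4 * ((f w * (l w)^2) * (S (m + j) w)^4))"
        by (simp add: sum_distrib_left algebra_simps)
    qed (auto intro!: det_intros det' det_T)
    also have "... = (\<Sum>j<r. r / (real m) ^ 4 * E (\<lambda>w. (f w * (l w)^2) * (S (m + j) w)^4))"
      by (subst Bochner_Integration.integral_sum)
         (auto intro!: integrable_determined[of "m+r"] det_intros det' sum.cong)
    also have "... \<le> (\<Sum>j<r. r / (real m) ^ 4 * (640 * (real r)^2 / 1000000 * E f))"
      using S4 by (intro sum_mono mult_left_mono) auto
    also have "... = 5/2 * E f / 1000000"
      using r by (simp add: m_def field_simps power4_eq_xxxx power2_eq_square)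
    finally show ?thesis .
  qed
  have "E (\<lambda>w. f w * exp (- T w)) \<le>
      E (\<lambda>w. f w + (- ((f w * l w) * T w) + (f w * (l w)^2) * (T w)^2))"
  proof (rule expectation_mono[of "m + r"])
    fix w
    have "l w * T w \<le> T w" using l0 T0 by (simp add: mult_left_le_one_le)
    hence "exp (- T w) \<le> exp (- (l w * T w))" by simp
    also have "... \<le> 1 - l w * T w + (l w * T w)^2" using l0 T0 by (intro exp_minus_le_quadratic) simp
    finally have "f w * exp (- T w) \<le> f w * (1 - l w * T w + (l w * T w)^2)" using f by (intro mult_left_mono)
    thus "f w * exp (- T w) \<le> f w + (- ((f w * l w) * T w) + (f w * (l w)^2) * (T w)^2)"
      by (simp add: algebra_simps power_mult_distrib)
  qed (auto intro!: det_intros det' det_T)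
  also have "... = E f + (E (\<lambda>w. - ((f w * l w) * T w)) + E (\<lambda>w. (f w * (l w)^2) * (T w)^2))"
    by (rule expectation_add3[of "m + r"]; intro det_intros det' det_T; simp)
  \<comment> \<open>The factor 1000 in \<open>l\<close> makes the linear gain
    \<open>1/200000\<close> twice the quadratic loss \<open>1/400000\<close>.\<close>
  also have "... \<le> E f - E f / 200000 + 5/2 * E f / 1000000"
    using E1 E2 by simp
  also have "... = (1 - 1/400000) * E f" by simp
  finally show ?thesis by (simp add: T_def m_def)
qed

end

lemma exp_le_quadratic:
  fixes x :: real assumes "\<bar>x\<bar> \<le> 1" shows "exp x \<le> 1 + x + x^2"
proof (cases "x \<ge> 0")
  case True
  thus ?thesis using exp_bound[of x] assms by auto
next
  case False
  thus ?thesis using exp_minus_le_quadratic[of "-x"] by simp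
qed

context reinforced_walk begin

text \<open>\<open>block_contraction\<close> is applied with the weight
  \<open>exp (- W (4 * r))\<close>, where \<open>r = 2 ^ Suc i\<close>. The block
  \<open>{4 * r..<5 * r}\<close> lies in \<open>{4 * r..<8 * r}\<close>, so successive blocks are
  disjoint, and the terms of \<open>W\<close> left out would only lower the exponential. The shift
  to \<open>Suc i\<close> secures \<open>r \<ge> 2\<close>.\<close>

lemma expectation_exp_minus_W:
  "E (\<lambda>w. exp (- W (4 * 2 ^ Suc i) w)) \<le> (1 - 1/400000) ^ i"
proof (induction i)
  case 0
  have "E (\<lambda>w. exp (- W (4 * 2 ^ Suc 0) w)) \<le> E (\<lambda>w. 1)"
    by (rule expectation_mono[of 8]) (auto intro!: det_intros det_W simp: W_nonneg)
  thus ?case by (simp add: prob_space)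
next
  case (Suc i)
  define r :: nat where "r = 2 ^ Suc i"
  have r: "r \<ge> 2" unfolding r_def using one_le_power[of "2::nat" i] by simp
  have "E (\<lambda>w. exp (- W (4 * (2 * r)) w)) \<le>
    E (\<lambda>w. exp (- W (4 * r) w) * exp (- (\<Sum>j<r. (Y (4 * r + j) w)^2)))"
  proof (rule expectation_mono[of "8 * r"])
    fix w
    have "W (4 * r) w + (\<Sum>j<r. (Y (4 * r + j) w)^2) = W (4 * r + r) w"
    proof -
      have "{1..<4 * r + r} = {1..<4 * r} \<union> {4 * r..<4 * r + r}" using r by auto
      hence "W (4 * r + r) w = W (4 * r) w + (\<Sum>k=4 * r..<4 * r + r. (Y k w)^2)"
        unfolding W_def by (simp add: sum.union_disjoint)
      also have "(\<Sum>k=4 * r..<4 * r + r. (Y k w)^2) = (\<Sum>j<r. (Y (4 * r + j) w)^2)"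
        by (rule sum.reindex_bij_witness[of _ "\<lambda>j. 4 * r + j" "\<lambda>k. k - 4 * r"]) auto
      finally show ?thesis by simp
    qed
    also have "... \<le> W (4 * (2 * r)) w" by (rule W_mono) simp
    finally show "exp (- W (4 * (2 * r)) w) \<le> exp (- W (4 * r) w) * exp (- (\<Sum>j<r. (Y (4 * r + j) w)^2))"
      by (simp flip: exp_add)
  qed (auto intro!: det_intros det_W)
  also have "... \<le> (1 - 1/400000) * E (\<lambda>w. exp (- W (4 * r) w))"
    by (rule block_contraction) (auto intro!: det_intros det_W r)
  also have "... \<le> (1 - 1/400000) * (1 - 1/400000) ^ i"
    using Suc.IH unfolding r_def[symmetric] by (intro mult_left_mono) auto
  finally show ?case by (simp add: r_def)
qed

lemma markov_determined:
  fixes f :: "'a \<Rightarrow> real"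
  assumes "determined n f" "\<And>w. 0 \<le> f w" "c > 0"
  shows "prob {w \<in> space M. f w \<ge> c} \<le> E f / c"
  using integral_Markov_inequality_measure[OF integrable_determined[OF assms(1)], of "space M" c] assms
  by auto

text \<open>Markov's inequality for \<open>exp (- W)\<close> bounds the probability that
  \<open>W\<close> never exceeds a level \<open>v\<close> by \<open>exp v\<close> times a geometric
  sequence; monotonicity of \<open>W\<close> does the rest.\<close>

lemma AE_W_at_top: "AE w in M. filterlim (\<lambda>n. W n w) at_top sequentially"
proof -
  have ex: "AE w in M. \<exists>n. W n w > v" for v :: real
  proof -
    define A where "A = {w \<in> space M. \<forall>n. W n w \<le> v}"
    have [measurable]: "W n \<in> borel_measurable M" for n
      by (rule borel_measurable_determined[OF det_W[OF order_refl[THEN le_SucI]]])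
    have [measurable]: "A \<in> sets M" unfolding A_def by measurable
    have bound: "prob A \<le> exp v * (1 - 1/400000) ^ i" for i
    proof -
      have "prob A \<le> prob {w \<in> space M. exp (- W (4 * 2 ^ Suc i) w) \<ge> exp (- v)}"
        by (rule finite_measure_mono) (auto simp: A_def)
      also have "... \<le> E (\<lambda>w. exp (- W (4 * 2 ^ Suc i) w)) / exp (- v)"
        by (rule markov_determined[of "4 * 2 ^ Suc i"]) (auto intro!: det_intros det_W)
      also have "... \<le> (1 - 1/400000) ^ i / exp (- v)"
        by (intro divide_right_mono expectation_exp_minus_W) simp
      finally show ?thesis by (simp add: exp_minus field_simps)
    qed
    have "(\<lambda>i. exp v * (1 - 1/400000) ^ i) \<longlonglongrightarrow> exp v * 0"
      by (intro tendsto_mult_left LIMSEQ_power_zero) simp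
    hence "prob A \<le> exp v * 0" by (rule LIMSEQ_le_const) (use bound in auto)
    hence "prob A = 0" using measure_nonneg[of M A] by simp
    hence "AE w in M. w \<notin> A" using \<open>A \<in> sets M\<close> by (simp add: AE_iff_measurable[OF _ refl] prob_eq_0)
    with AE_space show ?thesis by eventually_elim (auto simp: A_def not_le)
  qed
  have "AE w in M. \<forall>v::nat. \<exists>n. W n w > v" using ex by (simp add: AE_all_countable)
  thus ?thesis
  proof eventually_elim
    case (elim w)
    show ?case unfolding filterlim_at_top
    proof
      fix Z :: real
      obtain v :: nat where "Z \<le> v" using real_arch_simple by blast
      moreover obtain n where "W n w > v" using elim by blast
      ultimately have "\<forall>m\<ge>n. Z \<le> W m w" using W_mono by (smt (verit))
      thus "\<forall>\<^sub>F n in sequentially. Z \<le> W n w" unfolding eventually_sequentially by blast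
    qed
  qed
qed

subsection \<open>Comparison of the martingale with its quadratic variation\<close>

text \<open>Since \<open>\<bar>xi\<bar> \<le> 2\<close>, the bound 1/2 on \<open>H\<close> keeps
  \<open>H xi\<close> in the range of \<open>exp x \<le> 1 + x + x^2\<close>. Given the past, the
  right-hand side has mean at most \<open>1 + H^2 \<le> exp (H^2)\<close>.\<close>

lemma exponential_supermartingale:
  fixes H :: "nat \<Rightarrow> 'a \<Rightarrow> real"
  assumes H: "\<And>k. k \<ge> 1 \<Longrightarrow> determined k (H k)" "\<And>k w. \<bar>H k w\<bar> \<le> 1/2"
  shows "E (\<lambda>w. exp (\<Sum>k=1..<n. H k w * xi k w - (H k w)^2)) \<le> 1"
proof (induction n)
  case 0
  show ?case by (simp add: prob_space)
next
  case (Suc n)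
  show ?case
  proof (cases "n = 0")
    case True
    thus ?thesis by (simp add: prob_space)
  next
    case False
    define Q where "Q w = exp (\<Sum>k=1..<n. H k w * xi k w - (H k w)^2)" for w
    have Hd: "determined n (H k)" if "k \<in> {1..n}" for k
      using that by (intro det_mono[OF H(1)]) auto
    have Q: "determined n Q" unfolding Q_def using Hd by (intro det_intros) auto
    have Hn: "determined n (H n)" using Hd[of n] False by simp
    define R where "R w = Q w * exp (- ((H n w)^2))" for w
    have R: "determined n R" unfolding R_def by (intro det_intros Q Hn)
    have R0: "R w \<ge> 0" for w by (simp add: R_def Q_def)
    have "E (\<lambda>w. exp (\<Sum>k=1..<Suc n. H k w * xi k w - (H k w)^2)) \<le>
      E (\<lambda>w. R w + ((R w * H n w) * xi n w + (R w * (H n w)^2) * (xi n w)^2))"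
    proof (rule expectation_mono[of "Suc n"])
      have "determined (Suc n) (H k)" if "k \<in> {1..n}" for k using det_mono[OF Hd[OF that]] by simp
      thus "determined (Suc n) (\<lambda>w. exp (\<Sum>k=1..<Suc n. H k w * xi k w - (H k w)^2))"
        by (intro det_intros) auto
      show "determined (Suc n) (\<lambda>w. R w + ((R w * H n w) * xi n w + (R w * (H n w)^2) * (xi n w)^2))"
        by (intro det_intros det_mono[OF R] det_mono[OF Hn]) auto
      fix w
      have "\<bar>H n w * xi n w\<bar> \<le> 1/2 * 2"
        unfolding abs_mult using H(2) abs_xi_le by (intro mult_mono) auto
      hence "exp (H n w * xi n w) \<le> 1 + H n w * xi n w + (H n w * xi n w)^2"
        by (intro exp_le_quadratic) simp
      hence "R w * exp (H n w * xi n w) \<le> R w * (1 + H n w * xi n w + (H n w * xi n w)^2)"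
        using R0 by (intro mult_left_mono)
      moreover have "exp (\<Sum>k=1..<Suc n. H k w * xi k w - (H k w)^2) = R w * exp (H n w * xi n w)"
        using False by (simp add: R_def Q_def exp_add exp_diff exp_minus field_simps)
      ultimately show "exp (\<Sum>k=1..<Suc n. H k w * xi k w - (H k w)^2) \<le>
         R w + ((R w * H n w) * xi n w + (R w * (H n w)^2) * (xi n w)^2)"
        by (simp add: algebra_simps power_mult_distrib)
    qed
    also have "... = E R + (E (\<lambda>w. (R w * H n w) * xi n w) +
        E (\<lambda>w. (R w * (H n w)^2) * (xi n w)^2))"
      by (rule expectation_add3[of "Suc n"]; intro det_intros det_mono[OF R] det_mono[OF Hn]; simp)
    also have "E (\<lambda>w. (R w * H n w) * xi n w) = 0"
      by (rule expectation_xi; (intro det_intros R Hn)?; use False in simp)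
    also have "E (\<lambda>w. (R w * (H n w)^2) * (xi n w)^2) \<le> E (\<lambda>w. R w * (H n w)^2)"
      by (rule expectation_xi_sq_le; (intro det_intros R Hn)?; use False R0 in simp)
    also have "E R + (0 + E (\<lambda>w. R w * (H n w)^2)) = E (\<lambda>w. R w + R w * (H n w)^2)"
      by (subst Bochner_Integration.integral_add; (rule integrable_determined[of n])?; (intro det_intros R Hn)?; simp)
    also have "... \<le> E Q"
    proof (rule expectation_mono[of n])
      fix w
      have "1 + (H n w)^2 \<le> exp ((H n w)^2)" by (rule exp_ge_add_one_self)
      hence "R w * (1 + (H n w)^2) \<le> R w * exp ((H n w)^2)" using R0 by (intro mult_left_mono)
      also have "... = Q w" by (simp add: R_def exp_minus)
      finally show "R w + R w * (H n w)^2 \<le> Q w" by (simp add: algebra_simps)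
    qed (intro det_intros R Hn Q)+
    also have "... \<le> 1" using Suc.IH unfolding Q_def .
    finally show ?thesis by simp
  qed
qed

text \<open>Ville's inequality for \<open>exp (s l N - l\<^sup>2 W)\<close>, stopped at the first crossing by setting the weights \<open>H\<close>
  to zero from then on.\<close>

lemma crossing_probability:
  assumes s: "\<bar>s\<bar> = 1" and l: "0 < l" "l \<le> 1/2" "l \<le> d / 2" and v: "0 < v"
  shows "prob {w \<in> space M. \<exists>j\<in>{1..n}. s * N j w \<ge> d * W j w \<and> W j w \<ge> v} \<le> exp (- (l^2 * v))"
proof -
  define c where "c j w \<longleftrightarrow> s * N j w \<ge> d * W j w \<and> W j w \<ge> v" for j w
  define H where "H k w = (if \<exists>j\<in>{1..k}. c j w then 0 else s * l * Y k w)" for k w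
  define Z where "Z w = (\<Sum>k=1..<n. H k w * xi k w - (H k w)^2)" for w
  have detc: "determined k (c j)" if "j \<le> k" for j k
    unfolding c_def using that
    by (intro det_comp2[where F="(\<and>)"] det_intros det_N det_W) auto
  have detC: "determined k (\<lambda>w. \<exists>j\<in>{1..k}. c j w)" for k
    using detc unfolding determined_def by (metis atLeastAtMost_iff)
  have detH: "determined k (H k)" for k
    unfolding H_def by (intro det_if detC det_intros) auto
  have detZ: "determined n Z" unfolding Z_def by (intro det_intros det_mono[OF detH]) auto
  have sl: "s^2 = 1" using s by (metis power2_abs power_one)
  have "prob {w \<in> space M. \<exists>j\<in>{1..n}. c j w} \<le> prob {w \<in> space M. exp (Z w) \<ge> exp (l^2 * v)}"
  proof (rule finite_measure_mono)
    show "{w \<in> space M. exp (l^2 * v) \<le> exp (Z w)} \<in> sets M"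
      using borel_measurable_determined[OF det_exp[OF detZ]] by measurable
    show "{w \<in> space M. \<exists>j\<in>{1..n}. c j w} \<subseteq> {w \<in> space M. exp (Z w) \<ge> exp (l^2 * v)}"
    proof
      fix w assume "w \<in> {w \<in> space M. \<exists>j\<in>{1..n}. c j w}"
      then obtain j where j: "j \<in> {1..n}" "c j w" and w: "w \<in> space M" by blast
      define j0 where "j0 = (LEAST j. j \<ge> 1 \<and> c j w)"
      have j0: "j0 \<ge> 1" "c j0 w" "j0 \<le> n"
        using LeastI[of "\<lambda>j. j \<ge> 1 \<and> c j w" j] Least_le[of "\<lambda>j. j \<ge> 1 \<and> c j w" j] j unfolding j0_def by auto
      have before: "\<not> c k w" if "1 \<le> k" "k < j0" for k
        using not_less_Least[of k "\<lambda>j. j \<ge> 1 \<and> c j w"] that unfolding j0_def by auto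
      have "Z w = (\<Sum>k=1..<n. if k < j0 then s * l * (Y k w * xi k w) - l^2 * (Y k w)^2 else 0)"
        unfolding Z_def
      proof (intro sum.cong refl)
        fix k assume k: "k \<in> {1..<n}"
        show "H k w * xi k w - (H k w)^2 = (if k < j0 then s * l * (Y k w * xi k w) - l^2 * (Y k w)^2 else 0)"
        proof (cases "k < j0")
          case True
          hence "\<not> (\<exists>j\<in>{1..k}. c j w)" using before by auto
          thus ?thesis using True by (simp add: H_def power_mult_distrib sl)
        next
          case False
          hence "\<exists>j\<in>{1..k}. c j w" using j0 by auto
          thus ?thesis using False by (simp add: H_def)
        qed
      qed
      also have "... = (\<Sum>k=1..<j0. s * l * (Y k w * xi k w) - l^2 * (Y k w)^2)"
      proof -
        have "{1..<n} \<inter> {k. k < j0} = {1..<j0}" using j0 by auto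
        thus ?thesis by (simp add: sum.If_cases)
      qed
      also have "... = l * (s * N j0 w) - l^2 * W j0 w"
        by (simp add: N_def W_def sum_subtractf sum_distrib_left mult_ac)
      \<comment> \<open>At the crossing \<open>s N \<ge> d W\<close>, and \<open>2 l \<le> d\<close>
        then leaves at least \<open>l^2 W \<ge> l^2 v\<close> in the exponent.\<close>
      also have "... \<ge> l * (d * W j0 w) - l^2 * W j0 w"
        using j0 l by (intro diff_right_mono mult_left_mono) (auto simp: c_def)
      finally have "Z w \<ge> l * (d * W j0 w) - l^2 * W j0 w" .
      moreover have "2 * l * W j0 w \<le> d * W j0 w" using l W_nonneg by (intro mult_right_mono) auto
      hence "l * (2 * l * W j0 w) \<le> l * (d * W j0 w)" using l by (intro mult_left_mono) auto
      moreover have "l^2 * v \<le> l^2 * W j0 w" using j0 by (intro mult_left_mono) (auto simp: c_def)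
      ultimately have "Z w \<ge> l^2 * v" by (simp add: power2_eq_square)
      thus "w \<in> {w \<in> space M. exp (Z w) \<ge> exp (l^2 * v)}" using w by simp
    qed
  qed
  also have "... \<le> E (\<lambda>w. exp (Z w)) / exp (l^2 * v)"
    by (rule markov_determined[OF det_exp[OF detZ]]) auto
  also have "... \<le> 1 / exp (l^2 * v)"
  proof (intro divide_right_mono)
    have "\<bar>H k w\<bar> \<le> 1/2" for k w
    proof -
      have "\<bar>s * l * Y k w\<bar> \<le> 1 * (1/2) * 1"
        unfolding abs_mult using s l abs_Y_le_1 by (intro mult_mono) auto
      thus ?thesis by (simp add: H_def)
    qed
    thus "E (\<lambda>w. exp (Z w)) \<le> 1" unfolding Z_def
      by (intro exponential_supermartingale detH)
  qed simp
  finally show ?thesis by (simp add: exp_minus field_simps c_def)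
qed

text \<open>In \<open>crossing_probability\<close> first \<open>n\<close> and then \<open>v\<close>
  tends to infinity. Off a null set there is a level \<open>v\<close> beyond which no crossing
  occurs, and \<open>W\<close> eventually exceeds it. The sign \<open>s\<close> serves to bound both
  \<open>N\<close> and \<open>- N\<close>.\<close>

lemma AE_N_less:
  assumes s: "\<bar>s\<bar> = 1" and d: "d > 0"
  shows "AE w in M. \<forall>\<^sub>F n in sequentially. s * N n w < d * W n w"
proof -
  define l where "l = min (1/2) (d/2)"
  have l: "0 < l" "l \<le> 1/2" "l \<le> d / 2" using d by (auto simp: l_def)
  define C where "C v n = {w \<in> space M. \<exists>j\<in>{1..n}. s * N j w \<ge> d * W j w \<and> W j w \<ge> real v}" for v n :: nat
  have [measurable]: "W n \<in> borel_measurable M" "N n \<in> borel_measurable M" for n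
    by (rule borel_measurable_determined[OF det_W[OF order_refl[THEN le_SucI]]]
             borel_measurable_determined[OF det_N[OF order_refl]])+
  have [measurable]: "C v n \<in> sets M" for v n unfolding C_def by measurable
  have "prob (\<Union>n. C v n) \<le> exp (- (l^2 * v))" if "v > 0" for v
  proof -
    have "(\<lambda>n. prob (C v n)) \<longlonglongrightarrow> prob (\<Union>n. C v n)"
      by (rule finite_Lim_measure_incseq) (auto simp: incseq_def C_def intro: order_trans)
    thus ?thesis
      by (rule LIMSEQ_le_const2) (use crossing_probability[OF s l, of v] that in \<open>auto simp: C_def\<close>)
  qed
  hence le: "prob (\<Inter>v. \<Union>n. C v n) \<le> exp (- (l^2 * v))" if "v > 0" for v :: nat
    using that by (intro order_trans[OF finite_measure_mono[of "\<Inter>v. \<Union>n. C v n" "\<Union>n. C v n"]]) auto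
  have "(\<lambda>v. exp (- (l^2 * real v))) \<longlonglongrightarrow> 0" using l by real_asymp
  hence "prob (\<Inter>v. \<Union>n. C v n) \<le> 0"
    by (rule LIMSEQ_le_const) (use le in \<open>auto intro!: exI[of _ 1]\<close>)
  hence "prob (\<Inter>v. \<Union>n. C v n) = 0" by (intro antisym measure_nonneg)
  hence "AE w in M. w \<notin> (\<Inter>v. \<Union>n. C v n)" by (simp add: prob_eq_0)
  with AE_W_at_top AE_space show ?thesis
  proof eventually_elim
    case (elim w)
    then obtain v where v: "\<And>n. w \<notin> C v n" by auto
    have "\<forall>\<^sub>F n in sequentially. W n w \<ge> v" using elim(1) by (simp add: filterlim_at_top)
    with eventually_ge_at_top[of 1] show ?case
    proof eventually_elim
      case (elim n)
      thus ?case using v[of n] \<open>w \<in> space M\<close> unfolding C_def by force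
    qed
  qed
qed

text \<open>With \<open>d = \<bar>c\<bar> / 2\<close>, eventually \<open>\<bar>N\<bar>\<close> is at
  most half of \<open>\<bar>c\<bar> W\<close>, so the quotient is at least
  \<open>(c / 2)^2 W\<close>.\<close>

theorem AE_statistic_at_top:
  assumes c: "c \<noteq> 0"
  shows "AE w in M. filterlim (\<lambda>n. (N n w + c * W n w)^2 / W n w) at_top sequentially"
proof -
  have d: "\<bar>c\<bar> / 2 > 0" using c by simp
  have "\<bar>1::real\<bar> = 1" "\<bar>-1::real\<bar> = 1" by auto
  from AE_N_less[OF this(1) d] AE_N_less[OF this(2) d] AE_W_at_top show ?thesis
  proof eventually_elim
    case (elim w)
    have "filterlim (\<lambda>n. (c / 2)^2 * W n w) at_top sequentially"
      using elim(3) c by (intro filterlim_tendsto_pos_mult_at_top[OF tendsto_const]) auto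
    moreover have "\<forall>\<^sub>F n in sequentially. W n w \<ge> 1" using elim(3) by (simp add: filterlim_at_top)
    with elim(1,2) have "\<forall>\<^sub>F n in sequentially. (c / 2)^2 * W n w \<le> (N n w + c * W n w)^2 / W n w"
    proof eventually_elim
      case (elim n)
      hence "\<bar>N n w\<bar> \<le> \<bar>c\<bar> / 2 * W n w" by auto
      moreover have "\<bar>c * W n w\<bar> = \<bar>c\<bar> * W n w" using elim by (simp add: abs_mult)
      moreover have "\<bar>c * W n w\<bar> \<le> \<bar>N n w + c * W n w\<bar> + \<bar>N n w\<bar>"
        using abs_triangle_ineq4[of "N n w + c * W n w" "N n w"] by simp
      moreover have "\<bar>c / 2 * W n w\<bar> = \<bar>c * W n w\<bar> / 2" by (simp add: abs_mult)
      ultimately have "\<bar>c / 2 * W n w\<bar> \<le> \<bar>N n w + c * W n w\<bar>" by linarith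
      hence "(c / 2 * W n w)^2 \<le> (N n w + c * W n w)^2" by (simp only: abs_le_square_iff)
      thus ?case using elim by (simp add: field_simps power2_eq_square)
    qed
    ultimately show ?case by (rule filterlim_at_top_mono)
  qed
qed

end

subsection \<open>A martingale central limit theorem\<close>

text \<open>The product of the first two factors is the characteristic function at \<open>x\<close> of a centred
  \<open>\<plusminus>1\<close>-valued variable with mean \<open>b\<close> before centring.\<close>

lemma two_point_char_bound:
  fixes x b :: real
  assumes x: "\<bar>x\<bar> \<le> 1" and b: "\<bar>b\<bar> \<le> 1"
  shows "cmod (iexp (- (b * x)) * (of_real (cos x) + \<i> * of_real (b * sin x)) * of_real (exp (x^2 / 2)) - 1)
    \<le> 4 * (\<bar>x\<bar> ^ 3 + x^2 * b^2)"
proof -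
  \<comment> \<open>\<open>u\<close> and \<open>v\<close> are the centred values multiplied by
    \<open>x\<close>, taken with probabilities \<open>p\<close> and \<open>r\<close>: mean zero and
    second moment \<open>x^2 (1 - b^2)\<close>. Replacing the latter by \<open>x^2\<close> costs the
    term with \<open>b^2\<close> in the bound.\<close>
  define u where "u = x * (1 - b)"
  define v where "v = - x * (1 + b)"
  define p where "p = (1 + b) / 2"
  define r where "r = (1 - b) / 2"
  define \<phi> where "\<phi> = iexp (- (b * x)) * (of_real (cos x) + \<i> * of_real (b * sin x))"
  define T where "T y = (\<Sum>k\<le>2. (\<i> * complex_of_real y) ^ k / fact k)" for y
  have pr: "0 \<le> p" "0 \<le> r" "p + r = 1" using b by (auto simp: p_def r_def field_simps)
  have Teq: "T y = 1 + \<i> * y - of_real (y^2 / 2)" for y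
    by (simp add: T_def numeral_2_eq_2 power2_eq_square algebra_simps)
  have app: "cmod (iexp y - T y) \<le> 8 / 6 * \<bar>x\<bar> ^ 3" if "\<bar>y\<bar> \<le> 2 * \<bar>x\<bar>" for y
  proof -
    have "cmod (iexp y - T y) \<le> \<bar>y\<bar> ^ Suc 2 / fact (Suc 2)" unfolding T_def by (rule iexp_approx1)
    also have "... = \<bar>y\<bar> ^ 3 / 6" by (simp add: eval_nat_numeral)
    also have "... \<le> (2 * \<bar>x\<bar>) ^ 3 / 6" using that by (intro divide_right_mono power_mono) auto
    finally show ?thesis by (simp add: power_mult_distrib)
  qed
  have u: "\<bar>u\<bar> \<le> 2 * \<bar>x\<bar>" and v: "\<bar>v\<bar> \<le> 2 * \<bar>x\<bar>"
    using b mult_left_mono[of "\<bar>1 - b\<bar>" 2 "\<bar>x\<bar>"] mult_left_mono[of "\<bar>1 + b\<bar>" 2 "\<bar>x\<bar>"]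
    by (auto simp: u_def v_def abs_mult mult.commute abs_le_iff)
  have iexp_pm: "iexp x = of_real (cos x) + \<i> * of_real (sin x)" "iexp (- x) = of_real (cos x) - \<i> * of_real (sin x)"
    unfolding cis_conv_exp[symmetric] by (simp_all add: complex_eq_iff)
  have "\<phi> = iexp (- (b * x)) * (of_real p * iexp x + of_real r * iexp (- x))"
    unfolding \<phi>_def iexp_pm by (simp add: p_def r_def field_simps)
  also have "... = of_real p * iexp u + of_real r * iexp v"
    by (simp add: u_def v_def algebra_simps flip: exp_add)
  finally have \<phi>: "\<phi> = of_real p * iexp u + of_real r * iexp v" .
  have "p * u + r * v = 0" by (simp add: p_def r_def u_def v_def field_simps)
  moreover have "p * u^2 + r * v^2 = x^2 * (1 - b^2)"
    by (simp add: p_def r_def u_def v_def field_simps power2_eq_square)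
  moreover have "of_real p * T u + of_real r * T v =
      of_real (p + r) + \<i> * of_real (p * u + r * v) - of_real ((p * u^2 + r * v^2) / 2)"
    unfolding Teq by (simp add: field_simps)
  ultimately have Teq': "of_real p * T u + of_real r * T v = of_real (1 - x^2 * (1 - b^2) / 2)"
    using pr by simp
  have "cmod (\<phi> - of_real (1 - x^2 * (1 - b^2) / 2)) =
      cmod (of_real p * (iexp u - T u) + of_real r * (iexp v - T v))"
    unfolding \<phi> Teq'[symmetric] by (simp add: algebra_simps)
  also have "... \<le> p * cmod (iexp u - T u) + r * cmod (iexp v - T v)"
    by (rule order_trans[OF norm_triangle_ineq]) (use pr in \<open>simp add: norm_mult\<close>)
  also have "... \<le> p * (8 / 6 * \<bar>x\<bar> ^ 3) + r * (8 / 6 * \<bar>x\<bar> ^ 3)"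
    using pr app u v by (intro add_mono mult_left_mono) auto
  also have "... = (p + r) * (8 / 6 * \<bar>x\<bar> ^ 3)" by (simp only: distrib_right)
  also have "... = 8 / 6 * \<bar>x\<bar> ^ 3" using pr by simp
  finally have 1: "cmod (\<phi> - of_real (1 - x^2 * (1 - b^2) / 2)) \<le> 8 / 6 * \<bar>x\<bar> ^ 3" .
  have x2: "x^2 \<le> 1" using x by (simp add: abs_square_le_1)
  have 2: "\<bar>1 - x^2 / 2 - exp (- (x^2 / 2))\<bar> \<le> \<bar>x\<bar> ^ 3 / 4"
  proof -
    have "exp (- (x^2 / 2)) \<le> 1 - x^2 / 2 + (x^2 / 2)^2" by (rule exp_minus_le_quadratic) simp
    moreover have "1 - x^2 / 2 \<le> exp (- (x^2 / 2))" using exp_ge_add_one_self[of "- (x^2 / 2)"] by simp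
    moreover have "(x^2 / 2)^2 = \<bar>x\<bar> ^ 4 / 4" by (simp add: power_divide flip: power_mult)
    moreover have "\<bar>x\<bar> ^ 4 \<le> \<bar>x\<bar> ^ 3" using x by (intro power_decreasing) auto
    ultimately show ?thesis by linarith
  qed
  have "cmod (\<phi> - of_real (exp (- (x^2 / 2)))) = cmod ((\<phi> - of_real (1 - x^2 * (1 - b^2) / 2)) +
      (of_real (1 - x^2 / 2 - exp (- (x^2 / 2))) + of_real (x^2 * b^2 / 2)))"
    by (rule arg_cong[where f=cmod]) (simp add: algebra_simps diff_divide_distrib)
  also have "... \<le> 8 / 6 * \<bar>x\<bar> ^ 3 + (\<bar>x\<bar> ^ 3 / 4 + x^2 * b^2 / 2)"
    by (intro norm_triangle_le add_mono 1) (use 2 in \<open>auto simp: norm_of_real simp del: of_real_diff of_real_divide of_real_mult\<close>)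
  also have "... \<le> 2 * (\<bar>x\<bar> ^ 3 + x^2 * b^2)"
  proof -
    have k: "8 / 6 * A + (A / 4 + B / 2) \<le> 2 * (A + B)" if "0 \<le> A" "0 \<le> B" for A B :: real
      using that by simp
    show ?thesis by (rule k) auto
  qed
  finally have 3: "cmod (\<phi> - of_real (exp (- (x^2 / 2)))) \<le> 2 * (\<bar>x\<bar> ^ 3 + x^2 * b^2)" .
  have "\<phi> * of_real (exp (x^2 / 2)) - 1 = (\<phi> - of_real (exp (- (x^2 / 2)))) * of_real (exp (x^2 / 2))"
    by (simp add: algebra_simps exp_minus flip: of_real_mult)
  hence "cmod (\<phi> * of_real (exp (x^2 / 2)) - 1) = cmod (\<phi> - of_real (exp (- (x^2 / 2)))) * exp (x^2 / 2)"
    by (simp add: norm_mult)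
  also have "... \<le> 2 * (\<bar>x\<bar> ^ 3 + x^2 * b^2) * 2"
  proof (intro mult_mono 3)
    have "exp (x^2 / 2) \<le> 1 + x^2 / 2 + (x^2 / 2)^2" using x2 by (intro exp_le_quadratic) simp
    also have "(x^2 / 2)^2 \<le> (1 / 2)^2" using x2 by (intro power_mono) auto
    finally show "exp (x^2 / 2) \<le> 2" using x2 by (simp add: power2_eq_square)
  qed auto
  finally show ?thesis by (simp add: \<phi>_def)
qed

lemma abs_exp_diff_le:
  fixes u v :: real assumes "u \<le> m" "v \<le> m" shows "\<bar>exp u - exp v\<bar> \<le> exp m * \<bar>u - v\<bar>"
proof -
  have *: "exp u - exp v \<le> exp m * \<bar>u - v\<bar>" if "v \<le> u" "u \<le> m" for u v :: real
  proof -
    have "exp u - exp v = exp u * (1 - exp (v - u))" by (simp add: exp_diff field_simps)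
    also have "... \<le> exp u * (u - v)" using exp_ge_add_one_self[of "v - u"] by (intro mult_left_mono) (linarith, simp)
    also have "... \<le> exp m * (u - v)" using that by (intro mult_right_mono) auto
    finally show ?thesis using that by simp
  qed
  show ?thesis using *[of u v] *[of v u] assms by (cases "u \<le> v") (auto simp: abs_minus_commute abs_if)
qed

context reinforced_walk begin

text \<open>The factor \<open>exp (t\<^sup>2 / 2 * \<Sum>H\<^sup>2)\<close> compensates the characteristic function step by step, so that the
  increments telescope.\<close>

lemma martingale_char_bound:
  fixes H :: "nat \<Rightarrow> 'a \<Rightarrow> real"
  assumes H: "\<And>k. k \<ge> 1 \<Longrightarrow> determined k (H k)"
    and e: "\<And>k w. k \<in> {1..<n} \<Longrightarrow> \<bar>H k w\<bar> \<le> e" "\<bar>t\<bar> * e \<le> 1"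
    and C: "\<And>w. (\<Sum>k=1..<n. (H k w)^2) \<le> C"
  shows "cmod (E (\<lambda>w. iexp (t * (\<Sum>k=1..<n. H k w * xi k w)) *
            of_real (exp (t^2 / 2 * (\<Sum>k=1..<n. (H k w)^2)))) - 1)
    \<le> 4 * exp (t^2 / 2 * C) * (\<Sum>k=1..<n. E (\<lambda>w. \<bar>t\<bar> ^ 3 * e * (H k w)^2 + t^2 * ((H k w)^2 * (Y k w)^2)))"
proof -
  define Q where "Q m w = iexp (t * (\<Sum>k=1..<m. H k w * xi k w)) *
            of_real (exp (t^2 / 2 * (\<Sum>k=1..<m. (H k w)^2)))" for m w
  define B where "B k = E (\<lambda>w. \<bar>t\<bar> ^ 3 * e * (H k w)^2 + t^2 * ((H k w)^2 * (Y k w)^2))" for k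
  have "cmod (E (Q m) - 1) \<le> 4 * exp (t^2 / 2 * C) * (\<Sum>k=1..<m. B k)" if "m \<le> n" for m
    using that
  proof (induction m)
    case 0
    show ?case by (simp add: Q_def prob_space)
  next
    case (Suc m)
    show ?case
    proof (cases "m = 0")
      case True
      thus ?thesis by (simp add: Q_def prob_space)
    next
      case False
      hence m: "m \<ge> 1" "m \<in> {1..<n}" using Suc.prems by auto
      have Hd: "determined m (H k)" if "k \<in> {1..m}" for k
        using that by (intro det_mono[OF H]) auto
      have Hm: "determined m (H m)" using Hd[of m] m by simp
      have Q: "determined m (Q m)" unfolding Q_def
        by (intro det_intros det_comp[where F=iexp]) (use Hd in auto)
      \<comment> \<open>\<open>R\<close> collects all factors of \<open>Q (Suc m)\<close> except
        \<open>iexp (t H X)\<close>, which is linear in \<open>X\<close> because \<open>X\<close> is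
        1 or -1; the law of the step thus enters through its mean only. \<open>G\<close> is the
        compensated characteristic function of \<open>two_point_char_bound\<close> at
        \<open>t H\<close>, with \<open>b = a Y\<close>.\<close>
      define R where "R w = Q m w * iexp (- (a * Y m w * (t * H m w))) * of_real (exp ((t * H m w)^2 / 2))" for w
      have R: "determined m R" unfolding R_def
        by (intro det_intros det_comp[where F=iexp] Q Hm) (use m in auto)
      define G where "G w = iexp (- (a * Y m w * (t * H m w))) *
         (of_real (cos (t * H m w)) + \<i> * of_real (a * Y m w * sin (t * H m w))) * of_real (exp ((t * H m w)^2 / 2))" for w
      have cs: "determined m (\<lambda>w. cos (t * H m w))" "determined m (\<lambda>w. sin (t * H m w))"
        by (rule det_comp[OF Hm])+
      have G: "determined m G" unfolding G_def
        by (intro det_intros det_comp[where F=iexp] cs Hm) (use m in auto)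
      have Qm: "cmod (Q m w) \<le> exp (t^2 / 2 * C)" for w
      proof -
        have "(\<Sum>k=1..<m. (H k w)^2) \<le> (\<Sum>k=1..<n. (H k w)^2)" using m by (intro sum_mono2) auto
        hence "t^2 / 2 * (\<Sum>k=1..<m. (H k w)^2) \<le> t^2 / 2 * C" using C[of w] by (intro mult_left_mono) auto
        thus ?thesis by (simp add: Q_def norm_mult)
      qed
      have Qs: "Q (Suc m) w = R w * of_real (cos (t * H m w)) + (\<i> * R w * of_real (sin (t * H m w))) * of_real (X (Suc m) w)" for w
      proof -
        have "iexp (t * H m w * X (Suc m) w) = of_real (cos (t * H m w)) + \<i> * of_real (sin (t * H m w)) * of_real (X (Suc m) w)"
          using X_cases[of "Suc m" w] by (auto simp: exp_Euler simp flip: cos_of_real sin_of_real)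
        moreover have "Q (Suc m) w = R w * iexp (t * H m w * X (Suc m) w)"
          using m unfolding Q_def R_def xi_def
          by (simp add: exp_add distrib_left power_mult_distrib right_diff_distrib exp_diff exp_minus field_simps)
             (simp add: add_divide_distrib exp_add)
        ultimately show ?thesis by (simp add: algebra_simps)
      qed
      have "E (Q (Suc m)) = E (\<lambda>w. R w * of_real (cos (t * H m w))) +
          E (\<lambda>w. (\<i> * R w * of_real (sin (t * H m w))) * of_real (X (Suc m) w))"
        unfolding Qs
        by (rule expectation_add[of "Suc m"];
            intro det_intros det_mono[OF R] det_mono[OF cs(1)] det_mono[OF cs(2)]; simp)
      also have "E (\<lambda>w. (\<i> * R w * of_real (sin (t * H m w))) * of_real (X (Suc m) w)) =
          of_real a * E (\<lambda>w. (\<i> * R w * of_real (sin (t * H m w))) * of_real (Y m w))"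
        by (intro expectation_X_complex det_intros R cs m)
      also have "E (\<lambda>w. R w * of_real (cos (t * H m w))) + ... =
         E (\<lambda>w. R w * of_real (cos (t * H m w)) + of_real a * ((\<i> * R w * of_real (sin (t * H m w))) * of_real (Y m w)))"
        by (subst Bochner_Integration.integral_add; (rule integrable_determined[of "m"])?; (intro det_intros R cs)?; simp)
      also have "... = E (\<lambda>w. Q m w + Q m w * (G w - 1))"
        by (intro arg_cong[where f="lebesgue_integral M"] ext) (simp add: R_def G_def algebra_simps)
      also have "... = E (Q m) + E (\<lambda>w. Q m w * (G w - 1))"
        by (rule expectation_add[of "m"]; intro det_intros Q G)
      finally have step_eq: "E (Q (Suc m)) - 1 = (E (Q m) - 1) + E (\<lambda>w. Q m w * (G w - 1))" by simp
      have "cmod (E (Q (Suc m)) - 1) \<le> cmod (E (Q m) - 1) + cmod (E (\<lambda>w. Q m w * (G w - 1)))"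
        unfolding step_eq by (rule norm_triangle_ineq)
      also have "cmod (E (Q m) - 1) \<le> 4 * exp (t^2 / 2 * C) * (\<Sum>k=1..<m. B k)"
        using Suc by simp
      also have "cmod (E (\<lambda>w. Q m w * (G w - 1))) \<le> E (\<lambda>w. cmod (Q m w * (G w - 1)))"
        by (rule integral_norm_bound)
      also have "... \<le> E (\<lambda>w. 4 * exp (t^2 / 2 * C) * (\<bar>t\<bar> ^ 3 * e * (H m w)^2 + t^2 * ((H m w)^2 * (Y m w)^2)))"
      proof (rule expectation_mono[of m])
        fix w
        have tH: "\<bar>t * H m w\<bar> \<le> \<bar>t\<bar> * e" unfolding abs_mult using e(1)[OF m(2)] by (intro mult_left_mono) auto
        have "cmod (Q m w * (G w - 1)) \<le> exp (t^2 / 2 * C) * (4 * (\<bar>t * H m w\<bar> ^ 3 + (t * H m w)^2 * (a * Y m w)^2))"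
          unfolding norm_mult G_def
          by (intro mult_mono Qm two_point_char_bound abs_aY_le_1) (use tH e(2) in auto)
        also have "... \<le> exp (t^2 / 2 * C) * (4 * (\<bar>t\<bar> ^ 3 * e * (H m w)^2 + t^2 * ((H m w)^2 * (Y m w)^2)))"
        proof (intro mult_left_mono add_mono)
          have "\<bar>t * H m w\<bar> ^ 3 = \<bar>t\<bar> ^ 3 * \<bar>H m w\<bar> * (H m w)^2"
          proof -
            have "\<bar>y\<bar> ^ 3 = \<bar>y\<bar> * y^2" for y :: real using power_Suc[of "\<bar>y\<bar>" 2] by simp
            thus ?thesis by (simp add: abs_mult power_mult_distrib)
          qed
          also have "... \<le> \<bar>t\<bar> ^ 3 * e * (H m w)^2" using e(1)[OF m(2)] by (intro mult_left_mono mult_right_mono) auto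
          finally show "\<bar>t * H m w\<bar> ^ 3 \<le> \<bar>t\<bar> ^ 3 * e * (H m w)^2" .
          have "a^2 * (Y m w)^2 \<le> 1 * (Y m w)^2" using abs_a_le_1 by (intro mult_right_mono) (auto simp: abs_square_le_1)
          hence "(t * H m w)^2 * (a^2 * (Y m w)^2) \<le> (t * H m w)^2 * (Y m w)^2" by (intro mult_left_mono) auto
          thus "(t * H m w)^2 * (a * Y m w)^2 \<le> t^2 * ((H m w)^2 * (Y m w)^2)"
            by (simp add: power_mult_distrib mult_ac)
        qed auto
        finally show "cmod (Q m w * (G w - 1)) \<le> 4 * exp (t^2 / 2 * C) * (\<bar>t\<bar> ^ 3 * e * (H m w)^2 + t^2 * ((H m w)^2 * (Y m w)^2))"
          by (simp add: algebra_simps)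
      next
        show "determined m (\<lambda>w. cmod (Q m w * (G w - 1)))"
          by (rule det_comp[where F=cmod]) (intro det_intros Q G)
        show "determined m (\<lambda>w. 4 * exp (t^2 / 2 * C) * (\<bar>t\<bar> ^ 3 * e * (H m w)^2 + t^2 * ((H m w)^2 * (Y m w)^2)))"
          by (intro det_intros Hm) auto
      qed
      also have "E (\<lambda>w. 4 * exp (t^2 / 2 * C) * (\<bar>t\<bar> ^ 3 * e * (H m w)^2 + t^2 * ((H m w)^2 * (Y m w)^2))) =
          4 * exp (t^2 / 2 * C) * B m"
        unfolding B_def by (rule integral_mult_right_zero)
      finally show ?thesis using m by (simp add: distrib_left)
    qed
  qed
  from this[of n] show ?thesis unfolding Q_def[abs_def] B_def by simp
qed

text \<open>The norming uses the sum of the \<open>H^2\<close> instead of the conditional variance,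
  the sum of the \<open>H^2 (1 - a^2 Y^2)\<close>; the last hypothesis makes the difference
  negligible in mean. The uniform bound \<open>C\<close> keeps the compensating exponential bounded,
  so that it may be replaced by the constant \<open>exp (t^2 / 2)\<close> at a cost controlled by
  the mean distance of the sum from 1.\<close>

theorem martingale_clt:
  fixes H :: "nat \<Rightarrow> nat \<Rightarrow> 'a \<Rightarrow> real"
  assumes H: "\<And>n k. k \<ge> 1 \<Longrightarrow> determined k (H n k)"
    and e: "\<And>n k w. k \<in> {1..<n} \<Longrightarrow> \<bar>H n k w\<bar> \<le> e n" "e \<longlonglongrightarrow> 0"
    and C: "\<And>n w. (\<Sum>k=1..<n. (H n k w)^2) \<le> C"
    and V: "(\<lambda>n. E (\<lambda>w. \<bar>(\<Sum>k=1..<n. (H n k w)^2) - 1\<bar>)) \<longlonglongrightarrow> 0"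
    and HY: "(\<lambda>n. \<Sum>k=1..<n. E (\<lambda>w. (H n k w)^2 * (Y k w)^2)) \<longlonglongrightarrow> 0"
  shows "(\<lambda>n. E (\<lambda>w. iexp (t * (\<Sum>k=1..<n. H n k w * xi k w)))) \<longlonglongrightarrow> of_real (exp (- (t^2) / 2))"
proof -
  define U where "U n w = (\<Sum>k=1..<n. H n k w * xi k w)" for n w
  define Vn where "Vn n w = (\<Sum>k=1..<n. (H n k w)^2)" for n w
  define A where "A n = E (\<lambda>w. iexp (t * U n w) * of_real (exp (t^2 / 2 * Vn n w)))" for n
  define D where "D n = E (\<lambda>w. iexp (t * U n w))" for n
  have Hd: "determined n (H n k)" if "k \<in> {1..<n}" for n k
    using that by (intro det_mono[OF H]) auto
  have U: "determined n (U n)" and Vd: "determined n (Vn n)" for n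
    unfolding U_def Vn_def using Hd by (intro det_intros; auto)+
  have C0: "0 \<le> C" using C[of 0] by simp
  have "(\<lambda>n. A n - 1) \<longlonglongrightarrow> 0"
  proof (rule Lim_null_comparison)
    have "(\<lambda>n. \<bar>t\<bar> * e n) \<longlonglongrightarrow> \<bar>t\<bar> * 0" by (intro tendsto_intros e)
    hence "\<forall>\<^sub>F n in sequentially. \<bar>t\<bar> * e n < 1" by (rule order_tendstoD) simp
    moreover have "\<forall>\<^sub>F n in sequentially. n \<ge> (2::nat)" by (rule eventually_ge_at_top)
    ultimately show "\<forall>\<^sub>F n in sequentially. norm (A n - 1) \<le>
        4 * exp (t^2 / 2 * C) * (\<bar>t\<bar> ^ 3 * e n * C + t^2 * (\<Sum>k=1..<n. E (\<lambda>w. (H n k w)^2 * (Y k w)^2)))"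
    proof eventually_elim
      case (elim n)
      have e0: "0 \<le> e n" using order_trans[OF abs_ge_zero e(1)[of 1 n undefined]] elim by simp
      have i: "integrable M (\<lambda>w. (H n k w)^2)" "integrable M (\<lambda>w. (H n k w)^2 * (Y k w)^2)" if "k \<in> {1..<n}" for k
        by (rule integrable_determined[of n]; intro det_intros Hd that; use that in simp)+
      have "norm (A n - 1) \<le> 4 * exp (t^2 / 2 * C) * (\<Sum>k=1..<n. E (\<lambda>w. \<bar>t\<bar> ^ 3 * e n * (H n k w)^2 + t^2 * ((H n k w)^2 * (Y k w)^2)))"
        unfolding A_def U_def Vn_def using elim by (intro martingale_char_bound H e C) auto
      also have "(\<Sum>k=1..<n. E (\<lambda>w. \<bar>t\<bar> ^ 3 * e n * (H n k w)^2 + t^2 * ((H n k w)^2 * (Y k w)^2))) =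
          (\<Sum>k=1..<n. \<bar>t\<bar> ^ 3 * e n * E (\<lambda>w. (H n k w)^2) + t^2 * E (\<lambda>w. (H n k w)^2 * (Y k w)^2))"
        using i by (intro sum.cong refl) (simp add: Bochner_Integration.integral_add)
      also have "... = \<bar>t\<bar> ^ 3 * e n * E (Vn n) + t^2 * (\<Sum>k=1..<n. E (\<lambda>w. (H n k w)^2 * (Y k w)^2))"
        unfolding Vn_def using i by (simp add: sum.distrib sum_distrib_left Bochner_Integration.integral_sum)
      also have "E (Vn n) \<le> C"
      proof -
        have "E (Vn n) \<le> E (\<lambda>_. C)" using C by (intro expectation_mono[OF Vd det_const]) (simp add: Vn_def)
        thus ?thesis by (simp add: prob_space)
      qed
      finally show ?case using e0 by (simp add: mult_left_mono)
    qed
    have "(\<lambda>n. 4 * exp (t^2 / 2 * C) * (\<bar>t\<bar> ^ 3 * e n * C + t^2 * (\<Sum>k=1..<n. E (\<lambda>w. (H n k w)^2 * (Y k w)^2))))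
       \<longlonglongrightarrow> 4 * exp (t^2 / 2 * C) * (\<bar>t\<bar> ^ 3 * 0 * C + t^2 * 0)" by (intro tendsto_intros e HY)
    thus "(\<lambda>n. 4 * exp (t^2 / 2 * C) * (\<bar>t\<bar> ^ 3 * e n * C + t^2 * (\<Sum>k=1..<n. E (\<lambda>w. (H n k w)^2 * (Y k w)^2))))
       \<longlonglongrightarrow> 0" by simp
  qed
  moreover have "(\<lambda>n. A n - of_real (exp (t^2 / 2)) * D n) \<longlonglongrightarrow> 0"
  proof (rule Lim_null_comparison)
    show "\<forall>\<^sub>F n in sequentially. norm (A n - of_real (exp (t^2 / 2)) * D n) \<le>
        exp (t^2 / 2 * (C + 1)) * (t^2 / 2) * E (\<lambda>w. \<bar>Vn n w - 1\<bar>)"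
    proof (intro always_eventually allI)
      fix n
      define Z where "Z w = iexp (t * U n w) * of_real (exp (t^2 / 2 * Vn n w)) - of_real (exp (t^2 / 2)) * iexp (t * U n w)" for w
      have Z: "determined n Z"
        unfolding Z_def by (intro det_intros det_comp[where F=iexp] U Vd)
      have "A n - of_real (exp (t^2 / 2)) * D n = E (\<lambda>w. iexp (t * U n w) * of_real (exp (t^2 / 2 * Vn n w)))
          - E (\<lambda>w. of_real (exp (t^2 / 2)) * iexp (t * U n w))"
        by (simp add: A_def D_def)
      also have "... = E Z"
        unfolding Z_def
        by (rule Bochner_Integration.integral_diff[symmetric]; rule integrable_determined[of n];
            intro det_intros det_comp[where F=iexp] U Vd)
      also have "norm ... \<le> E (\<lambda>w. norm (Z w))"
        by (rule integral_norm_bound)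
      also have "... \<le> E (\<lambda>w. exp (t^2 / 2 * (C + 1)) * (t^2 / 2) * \<bar>Vn n w - 1\<bar>)"
      proof (rule expectation_mono[of n])
        fix w
        have "Z w =
           iexp (t * U n w) * of_real (exp (t^2 / 2 * Vn n w) - exp (t^2 / 2))" by (simp add: Z_def algebra_simps)
        hence "norm (Z w) =
           \<bar>exp (t^2 / 2 * Vn n w) - exp (t^2 / 2)\<bar>"
          by (simp only: norm_mult norm_of_real norm_exp_i_times mult_1)
        also have "... \<le> exp (t^2 / 2 * (C + 1)) * \<bar>t^2 / 2 * Vn n w - t^2 / 2\<bar>"
        proof (rule abs_exp_diff_le)
          show "t^2 / 2 * Vn n w \<le> t^2 / 2 * (C + 1)" using C[of n w] unfolding Vn_def by (intro mult_left_mono) auto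
          show "t^2 / 2 \<le> t^2 / 2 * (C + 1)" using C0 by (simp add: algebra_simps)
        qed
        also have "\<bar>t^2 / 2 * Vn n w - t^2 / 2\<bar> = t^2 / 2 * \<bar>Vn n w - 1\<bar>"
        proof -
          have "t^2 / 2 * Vn n w - t^2 / 2 = t^2 / 2 * (Vn n w - 1)" by (simp add: algebra_simps)
          thus ?thesis by (simp only: abs_mult) simp
        qed
        finally show "norm (Z w)
           \<le> exp (t^2 / 2 * (C + 1)) * (t^2 / 2) * \<bar>Vn n w - 1\<bar>" by simp
      next
        show "determined n (\<lambda>w. norm (Z w))"
          by (rule det_comp[OF Z])
      qed (intro det_intros Vd)
      finally show "norm (A n - of_real (exp (t^2 / 2)) * D n) \<le>
        exp (t^2 / 2 * (C + 1)) * (t^2 / 2) * E (\<lambda>w. \<bar>Vn n w - 1\<bar>)" by simp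
    qed
    have "(\<lambda>n. exp (t^2 / 2 * (C + 1)) * (t^2 / 2) * E (\<lambda>w. \<bar>Vn n w - 1\<bar>)) \<longlonglongrightarrow> exp (t^2 / 2 * (C + 1)) * (t^2 / 2) * 0"
      unfolding Vn_def by (intro tendsto_intros V)
    thus "(\<lambda>n. exp (t^2 / 2 * (C + 1)) * (t^2 / 2) * E (\<lambda>w. \<bar>Vn n w - 1\<bar>)) \<longlonglongrightarrow> 0" by simp
  qed
  ultimately have "(\<lambda>n. of_real (exp (- (t^2) / 2)) * (1 + (A n - 1) - (A n - of_real (exp (t^2 / 2)) * D n)))
      \<longlonglongrightarrow> of_real (exp (- (t^2) / 2)) * (1 + 0 - 0)" by (intro tendsto_intros)
  moreover have "of_real (exp (- (t^2) / 2)) * (1 + (A n - 1) - (A n - of_real (exp (t^2 / 2)) * D n)) = D n" for n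
  proof -
    have "exp (- (t^2) / 2) * exp (t^2 / 2) = 1" by (simp flip: exp_add)
    hence c: "complex_of_real (exp (- (t^2) / 2)) * of_real (exp (t^2 / 2)) = 1" by (metis of_real_1 of_real_mult)
    have "1 + (A n - 1) - (A n - z) = z" for z by simp
    thus ?thesis by (simp only: mult.assoc[symmetric] c mult_1)
  qed
  ultimately have "(\<lambda>n. D n) \<longlonglongrightarrow> of_real (exp (- (t^2) / 2)) * (1 + 0 - 0)" by (simp only:)
  thus ?thesis by (simp add: D_def U_def)
qed

end

subsection \<open>Convergence to the chi-square law\<close>

lemma chi_square_distribution_1:
  "chi_square_distribution 1 = distr std_normal_distribution borel (\<lambda>x. x^2)"
proof -
  let ?P = "PiM {..<1::nat} (\<lambda>_. std_normal_distribution)"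
  have N: "prob_space std_normal_distribution" by (rule prob_space_normal_density) simp
  have c: "(\<lambda>z. z 0) \<in> ?P \<rightarrow>\<^sub>M std_normal_distribution" by (rule measurable_component_singleton) simp
  have "chi_square_distribution 1 = distr ?P borel ((\<lambda>x. x^2) \<circ> (\<lambda>z. z 0))"
    by (simp add: chi_square_distribution_def comp_def)
  also have "... = distr (distr ?P std_normal_distribution (\<lambda>z. z 0)) borel (\<lambda>x. x^2)"
    using c by (intro distr_distr[symmetric]) auto
  also have "distr ?P std_normal_distribution (\<lambda>z. z 0) = std_normal_distribution"
    using distr_PiM_component[of "{..<1::nat}" "\<lambda>_. std_normal_distribution" 0] N by simp
  finally show ?thesis .
qed

lemma norm_iexp_diff_le: "norm (iexp (s * x) - iexp (s * y)) \<le> max 2 \<bar>s\<bar> * min 1 \<bar>x - y\<bar>"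
proof -
  have "iexp (s * x) - iexp (s * y) = iexp (s * y) * (iexp (s * (x - y)) - 1)"
    by (simp add: algebra_simps flip: exp_add)
  hence eq: "norm (iexp (s * x) - iexp (s * y)) = norm (iexp (s * (x - y)) - 1)"
    by (simp only: norm_mult norm_exp_i_times mult_1)
  also have "... \<le> \<bar>s * (x - y)\<bar>" using iexp_approx1[of "s * (x - y)" 0] by simp
  also have "... \<le> max 2 \<bar>s\<bar> * \<bar>x - y\<bar>" unfolding abs_mult by (intro mult_right_mono) auto
  finally have 1: "norm (iexp (s * x) - iexp (s * y)) \<le> max 2 \<bar>s\<bar> * \<bar>x - y\<bar>" .
  have "norm (iexp (s * x) - iexp (s * y)) \<le> norm (iexp (s * x)) + norm (iexp (s * y))"
    by (rule norm_triangle_ineq4)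
  also have "... \<le> max 2 \<bar>s\<bar>" by (simp only: norm_exp_i_times)
  finally show ?thesis using 1 by (simp add: min_def)
qed

text \<open>Slutsky's argument in the metric \<open>E (min 1 \<bar>x - y\<bar>)\<close> of
  convergence in probability, which up to a factor dominates differences of characteristic functions
  because \<open>iexp\<close> is bounded and Lipschitz. The square passes to the limit because
  \<open>iexp (s x^2)\<close> is bounded and continuous in \<open>x\<close>.\<close>

lemma (in prob_space) weak_conv_chi_square:
  fixes U R :: "nat \<Rightarrow> 'a \<Rightarrow> real"
  assumes [measurable]: "\<And>n. U n \<in> borel_measurable M" "\<And>n. R n \<in> borel_measurable M"
    and U: "\<And>t. (\<lambda>n. expectation (\<lambda>w. iexp (t * U n w))) \<longlonglongrightarrow> of_real (exp (- (t^2) / 2))"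
    and R: "(\<lambda>n. expectation (\<lambda>w. min 1 \<bar>R n w - (U n w)^2\<bar>)) \<longlonglongrightarrow> 0"
  shows "weak_conv_m (\<lambda>n. distr M borel (R n)) (chi_square_distribution 1)"
proof -
  let ?N = "std_normal_distribution"
  have rU: "real_distribution (distr M borel (U n))" and rR: "real_distribution (distr M borel (R n))" for n
    by (auto intro!: real_distribution_distr)
  have wU: "weak_conv_m (\<lambda>n. distr M borel (U n)) ?N"
    by (rule levy_continuity[OF rU real_dist_normal_dist])
       (simp add: char_std_normal_distribution char_def integral_distr U[simplified])
  show ?thesis unfolding chi_square_distribution_1
  proof (rule levy_continuity[OF rR])
    interpret N: real_distribution ?N by (rule real_dist_normal_dist)
    show "real_distribution (distr ?N borel (\<lambda>x. x^2))" by (intro N.real_distribution_distr) simp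
    fix s
    have "(\<lambda>n. integral\<^sup>L (distr M borel (U n)) (\<lambda>x. iexp (s * x^2))) \<longlonglongrightarrow> integral\<^sup>L ?N (\<lambda>x. iexp (s * x^2))"
      by (rule weak_conv_imp_integral_bdd_continuous_conv[OF rU real_dist_normal_dist wU, of _ 1])
         (intro continuous_intros, simp only: norm_exp_i_times order_refl)
    hence 1: "(\<lambda>n. expectation (\<lambda>w. iexp (s * (U n w)^2))) \<longlonglongrightarrow> char (distr ?N borel (\<lambda>x. x^2)) s"
      by (simp add: char_def integral_distr)
    have "(\<lambda>n. expectation (\<lambda>w. iexp (s * R n w)) - expectation (\<lambda>w. iexp (s * (U n w)^2))) \<longlonglongrightarrow> 0"
    proof (rule Lim_null_comparison)
      show "\<forall>\<^sub>F n in sequentially. norm (expectation (\<lambda>w. iexp (s * R n w)) - expectation (\<lambda>w. iexp (s * (U n w)^2)))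
          \<le> max 2 \<bar>s\<bar> * expectation (\<lambda>w. min 1 \<bar>R n w - (U n w)^2\<bar>)"
      proof (intro always_eventually allI)
        fix n
        have i: "integrable M (\<lambda>w. iexp (s * R n w))" "integrable M (\<lambda>w. iexp (s * (U n w)^2))"
          by (rule integrable_iexp; measurable)+
        have "norm (expectation (\<lambda>w. iexp (s * R n w)) - expectation (\<lambda>w. iexp (s * (U n w)^2))) =
           norm (expectation (\<lambda>w. iexp (s * R n w) - iexp (s * (U n w)^2)))"
          by (simp only: Bochner_Integration.integral_diff[OF i])
        also have "... \<le> expectation (\<lambda>w. norm (iexp (s * R n w) - iexp (s * (U n w)^2)))"
          by (rule integral_norm_bound)
        also have "... \<le> expectation (\<lambda>w. max 2 \<bar>s\<bar> * min 1 \<bar>R n w - (U n w)^2\<bar>)"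
        proof (rule integral_mono)
          show "integrable M (\<lambda>w. norm (iexp (s * R n w) - iexp (s * (U n w)^2)))"
            by (intro integrable_norm Bochner_Integration.integrable_diff i)
          show "integrable M (\<lambda>w. max 2 \<bar>s\<bar> * min 1 \<bar>R n w - (U n w)^2\<bar>)"
            by (intro integrable_mult_right integrable_const_bound[where B=1]) auto
        qed (rule norm_iexp_diff_le)
        finally show "norm (expectation (\<lambda>w. iexp (s * R n w)) - expectation (\<lambda>w. iexp (s * (U n w)^2)))
          \<le> max 2 \<bar>s\<bar> * expectation (\<lambda>w. min 1 \<bar>R n w - (U n w)^2\<bar>)" by simp
      qed
      show "(\<lambda>n. max 2 \<bar>s\<bar> * expectation (\<lambda>w. min 1 \<bar>R n w - (U n w)^2\<bar>)) \<longlonglongrightarrow> 0"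
        using tendsto_mult_left[OF R, of "max 2 \<bar>s\<bar>"] by simp
    qed
    from tendsto_add[OF this 1]
    show "(\<lambda>n. char (distr M borel (R n)) s) \<longlonglongrightarrow> char (distr ?N borel (\<lambda>x. x^2)) s"
      by (simp add: char_def integral_distr)
  qed
qed

subsection \<open>The case \<open>a < 1/2\<close>\<close>

lemma sum_inverse_consecutive: "n \<ge> 1 \<Longrightarrow> (\<Sum>k=1..<n. 1 / (real k * real (k + 1))) = 1 - 1 / real n"
proof (induction n rule: dec_induct)
  case (step n)
  have "(\<Sum>k=1..<Suc n. 1 / (real k * real (k + 1))) = 1 - 1 / real n + 1 / (real n * real (n + 1))"
    using step by simp
  also have "... = 1 - 1 / real (Suc n)"
  proof -
    have "0 < real n" "0 < real n + real n * real n" using step by (auto intro: add_pos_pos)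
    thus ?thesis by (simp add: field_simps)
  qed
  finally show ?case .
qed simp

text \<open>The partial sums are nondecreasing, so the terms kept form an initial segment, whose
  total is zero or a partial sum not exceeding \<open>c\<close>.\<close>

lemma sum_truncated_le:
  fixes y :: "nat \<Rightarrow> real"
  assumes "\<And>k. 0 \<le> y k" "0 \<le> c"
  shows "(\<Sum>k=1..<n. if (\<Sum>j=1..<Suc k. y j) \<le> c then y k else 0) \<le> c"
proof (induction n)
  case (Suc n)
  show ?case
  proof (cases "n \<ge> 1 \<and> (\<Sum>j=1..<Suc n. y j) \<le> c")
    case True
    have "(\<Sum>k=1..<Suc n. if (\<Sum>j=1..<Suc k. y j) \<le> c then y k else 0) \<le> (\<Sum>k=1..<Suc n. y k)"
      using assms(1) by (intro sum_mono) auto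
    also have "... \<le> c" using True by blast
    finally show ?thesis .
  next
    case False
    thus ?thesis using Suc assms(2) by (cases "n \<ge> 1") auto
  qed
qed (use assms in auto)

text \<open>\<open>K\<close> is chosen first to make \<open>2 / K\<close> small, then
  \<open>n\<close>. Splitting at a level \<open>K\<close> produces error bounds of this
  form.\<close>

lemma null_sequence_via_parameter:
  fixes x d :: "nat \<Rightarrow> real"
  assumes "d \<longlonglongrightarrow> 0" "\<And>n. 0 \<le> x n"
    and le: "\<And>K. K > 0 \<Longrightarrow> \<forall>\<^sub>F n in sequentially. x n \<le> (2 * K + 2) * d n + 2 / K"
  shows "x \<longlonglongrightarrow> 0"
proof (rule order_tendstoI)
  fix \<epsilon> :: real assume \<epsilon>: "0 < \<epsilon>"
  define K where "K = 4 / \<epsilon>"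
  have K: "K > 0" "2 / K = \<epsilon> / 2" using \<epsilon> by (auto simp: K_def)
  have "(\<lambda>n. (2 * K + 2) * d n) \<longlonglongrightarrow> (2 * K + 2) * 0" by (intro tendsto_intros assms)
  hence "\<forall>\<^sub>F n in sequentially. (2 * K + 2) * d n < \<epsilon> / 2" by (rule order_tendstoD) (use \<epsilon> in simp)
  with le[OF K(1)] show "\<forall>\<^sub>F n in sequentially. x n < \<epsilon>" by eventually_elim (use K(2) in linarith)
next
  fix \<epsilon> :: real assume "\<epsilon> < 0"
  thus "\<forall>\<^sub>F n in sequentially. \<epsilon> < x n" by (intro always_eventually allI less_le_trans[OF _ assms(2)])
qed

context reinforced_walk begin

text \<open>Integrating \<open>2 x \<bar>f g\<bar> \<le> x^2 f^2 + g^2\<close> gives a quadratic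
  inequality in \<open>x\<close>. The optimal \<open>x = P / A\<close> yields the claim; if
  \<open>A = 0\<close>, a large \<open>x\<close> forces \<open>P = 0\<close>.\<close>

lemma Cauchy_Schwarz_determined:
  fixes f g :: "'a \<Rightarrow> real"
  assumes f: "determined n f" and g: "determined n g"
  shows "E (\<lambda>w. \<bar>f w * g w\<bar>) \<le> sqrt (E (\<lambda>w. (f w)^2)) * sqrt (E (\<lambda>w. (g w)^2))"
proof -
  define A where "A = E (\<lambda>w. (f w)^2)"
  define B where "B = E (\<lambda>w. (g w)^2)"
  define P where "P = E (\<lambda>w. \<bar>f w * g w\<bar>)"
  have i: "integrable M (\<lambda>w. (f w)^2)" "integrable M (\<lambda>w. (g w)^2)" "integrable M (\<lambda>w. \<bar>f w * g w\<bar>)"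
    by (rule integrable_determined[of n]; intro det_intros f g)+
  have quad: "2 * x * P \<le> x^2 * A + B" for x
  proof -
    have "E (\<lambda>w. 2 * x * \<bar>f w * g w\<bar>) \<le> E (\<lambda>w. x^2 * (f w)^2 + (g w)^2)"
    proof (rule expectation_mono[of n])
      fix w
      have "0 \<le> (x * \<bar>f w\<bar> - \<bar>g w\<bar>)^2" by simp
      thus "2 * x * \<bar>f w * g w\<bar> \<le> x^2 * (f w)^2 + (g w)^2"
        by (simp add: power2_diff power_mult_distrib abs_mult mult_ac)
    qed (intro det_intros f g)+
    also have "... = x^2 * A + B" using i by (simp add: A_def B_def)
    finally show ?thesis by (simp add: P_def)
  qed
  have nn: "0 \<le> A" "0 \<le> B" "0 \<le> P" unfolding A_def B_def P_def by (auto intro!: expectation_nonneg)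
  have "P^2 \<le> A * B"
  proof (cases "A = 0")
    case True
    show ?thesis
    proof (cases "P = 0")
      case False
      hence "2 * ((B + 1) / (2 * P)) * P = B + 1" by simp
      hence "B + 1 \<le> B" using quad[of "(B + 1) / (2 * P)"] True by simp
      thus ?thesis by simp
    qed (use nn in simp)
  next
    case False
    thus ?thesis using quad[of "P / A"] nn by (simp add: field_simps power2_eq_square)
  qed
  hence "P \<le> sqrt (A * B)" using nn by (intro real_le_rsqrt) simp
  thus ?thesis by (simp add: A_def B_def P_def real_sqrt_mult)
qed

lemma expectation_abs_le_sqrt:
  fixes f :: "'a \<Rightarrow> real"
  assumes f: "determined n f"
  shows "E (\<lambda>w. \<bar>f w\<bar>) \<le> sqrt (E (\<lambda>w. (f w)^2))"
  using Cauchy_Schwarz_determined[OF f det_const[of n 1]] by (simp add: prob_space)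

lemma W_ge_1: "n \<ge> 2 \<Longrightarrow> 1 \<le> W n w"
  using W_mono[of 2 n w] S_1_sq[of w] by (simp add: W_def Y_def numeral_2_eq_2)

section \<open>Moments of the walk of diffusive order\<close>

lemma expectation_S_1: "E (\<lambda>w. (S 1 w)^2) = 1" "E (\<lambda>w. (S 1 w)^4) = 1"
proof -
  have "(S 1 w)^4 = 1" for w
    using S_1_sq[of w] by (metis power_mult mult_2 numeral_Bit0 power_one)
  thus "E (\<lambda>w. (S 1 w)^4) = 1" by (simp only: prob_space) (simp add: prob_space)
  show "E (\<lambda>w. (S 1 w)^2) = 1" by (simp only: S_1_sq) (simp add: prob_space)
qed

text \<open>As long as the moment at time \<open>n\<close> is at most \<open>v n\<close>, its
  increment is at most \<open>b v + 1 \<le> v\<close>. For \<open>a < 1/2\<close> the choice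
  \<open>b = max 0 (2 a)\<close>, \<open>v = 1 / (1 - b)\<close> satisfies the last condition with
  equality; the maximum covers negative \<open>a\<close>.\<close>

lemma second_moment_diffusive:
  fixes b v :: real
  assumes b: "2 * a \<le> b" "0 \<le> b" and v: "1 \<le> v" "b * v + 1 \<le> v" and n: "n \<ge> 1"
  shows "E (\<lambda>w. (S n w)^2) \<le> v * n"
  using n
proof (induction n rule: dec_induct)
  case base
  show ?case using v unfolding expectation_S_1 by simp
next
  case (step n)
  define u where "u = E (\<lambda>w. (S n w)^2)"
  have u0: "0 \<le> u" unfolding u_def by (intro expectation_nonneg) auto
  have "E (\<lambda>w. (S (Suc n) w)^2) = (1 + 2 * a / n) * u + 1"
    using second_moment_Suc[of 1 "\<lambda>_. 1" n] det_const[of 1 "1::real"] step by (simp add: prob_space u_def)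
  also have "... = u + 2 * a * (u / n) + 1" by (simp add: algebra_simps)
  also have "2 * a * (u / n) \<le> b * (u / n)" using b u0 by (intro mult_right_mono) auto
  also have "b * (u / n) \<le> b * v" using step b by (intro mult_left_mono) (auto simp: u_def field_simps)
  finally show ?case using v step.IH by (simp add: u_def algebra_simps)
qed

text \<open>The constant 6 leaves room for the terms of lower order: the main term adds
  \<open>12 v n (b v) \<le> 12 v n (v - 1)\<close>, and the spare \<open>12 v n\<close> exceeds the
  remaining \<open>11 v n\<close>.\<close>

lemma fourth_moment_diffusive:
  fixes b v :: real
  assumes b: "2 * a \<le> b" "0 \<le> b" and v: "1 \<le> v" "b * v + 1 \<le> v" and n: "n \<ge> 1"
  shows "E (\<lambda>w. (S n w)^4) \<le> 6 * v^2 * (real n)^2"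
  using n
proof (induction n rule: dec_induct)
  case base
  have "1 \<le> v^2" using v by simp
  thus ?case unfolding expectation_S_1 by simp
next
  case (step n)
  define u where "u = E (\<lambda>w. (S n w)^2)"
  define m4 where "m4 = E (\<lambda>w. (S n w)^4)"
  have u0: "0 \<le> u" "0 \<le> m4" unfolding u_def m4_def by (intro expectation_nonneg; simp)+
  have n: "1 \<le> real n" using step by simp
  have u: "u \<le> v * n" unfolding u_def using second_moment_diffusive[OF b v] step by simp
  have "E (\<lambda>w. (S (Suc n) w)^4) = (1 + 4 * a / n) * m4 + (6 + 4 * a / n) * u + 1"
    using fourth_moment_Suc[of 1 "\<lambda>_. 1" n] det_const[of 1 "1::real"] step by (simp add: prob_space u_def m4_def)
  also have "... = m4 + 2 * ((2 * a) * (m4 / n)) + (6 + 4 * a / n) * u + 1" by (simp add: algebra_simps)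
  also have "... \<le> m4 + 2 * (b * (6 * v^2 * n)) + 10 * (v * n) + v * n"
  proof (intro add_mono mult_left_mono order_refl)
    have "2 * a * (m4 / n) \<le> b * (m4 / n)" using b u0 by (intro mult_right_mono) auto
    also have "... \<le> b * (6 * v^2 * n)" using step b n by (intro mult_left_mono) (auto simp: m4_def field_simps power2_eq_square)
    finally show "2 * a * (m4 / n) \<le> b * (6 * v^2 * n)" .
    have "4 * a / n \<le> 4 / n" using abs_a_le_1 by (intro divide_right_mono) auto
    also have "... \<le> 4" using n by (simp add: field_simps)
    finally show "(6 + 4 * a / n) * u \<le> 10 * (v * n)" using u u0 by (intro mult_mono) auto
    show "1 \<le> v * n" using n v mult_mono[of 1 v 1 "real n"] by simp
  qed simp
  also have "2 * (b * (6 * v^2 * n)) = 12 * v * n * (b * v)" by (simp add: power2_eq_square)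
  also have "... \<le> 12 * v * n * (v - 1)" using v n by (intro mult_left_mono) auto
  finally have "E (\<lambda>w. (S (Suc n) w)^4) \<le> m4 + 12 * v^2 * n - v * n" by (simp add: algebra_simps power2_eq_square)
  also have "... \<le> 6 * v^2 * (real n)^2 + 12 * v^2 * n + 6 * v^2"
  proof -
    have "0 \<le> v * n" "0 \<le> 6 * v^2" using v n by auto
    thus ?thesis using step.IH unfolding m4_def by linarith
  qed
  also have "... = 6 * v^2 * (real (Suc n))^2" by (simp add: power2_eq_square algebra_simps)
  finally show ?case .
qed

text \<open>Sum of the increments of \<open>(S n)\<^sup>2 / n\<close>.\<close>

lemma W_identity:
  assumes "n \<ge> 1"
  shows "(1 - 2 * a) * W n w - harm n = (1 - 2 * a) * (\<Sum>k=1..<n. (Y k w)^2 / real (k + 1))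
     + 2 * (\<Sum>k=1..<n. (real k / real (k + 1) * Y k w) * xi k w) - (S n w)^2 / n"
  using assms
proof (induction n rule: dec_induct)
  case base
  show ?case using S_1_sq[of w] by (simp add: W_def harm_def)
next
  case (step n)
  define y where "y = Y n w"
  have n: "real n \<noteq> 0" "1 + real n \<noteq> 0" using step by auto
  have S: "S n w = n * y" using n by (simp add: Y_def y_def)
  have X: "X (Suc n) w = a * y + xi n w" by (simp add: xi_def y_def)
  have "(S (Suc n) w)^2 = (S n w)^2 + 2 * S n w * X (Suc n) w + 1"
    unfolding S_Suc power2_sum X_sq[of "Suc n", simplified] by simp
  hence S2: "(S (Suc n) w)^2 = (n * y)^2 + 2 * (n * y) * (a * y + xi n w) + 1" by (simp add: S X)
  have alg: "(1 - 2 * a) * y^2 - inverse (real (Suc n)) = (1 - 2 * a) * (y^2 / real (n + 1))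
     + 2 * ((real n / real (n + 1) * y) * xi n w) - (((n * y)^2 + 2 * (n * y) * (a * y + xi n w) + 1) / real (Suc n) - (n * y)^2 / n)"
  proof -
    define i where "i = 1 / (real n + 1)"
    have i: "i * (real n + 1) = 1" using n by (simp add: i_def)
    have "(1 - 2 * a) * y^2 - i = (1 - 2 * a) * (y^2 * i) + 2 * ((n * i * y) * xi n w)
        - (((n * y)^2 + 2 * (n * y) * (a * y + xi n w) + 1) * i - n * y^2)"
      using i by algebra
    moreover have "(n * y)^2 / n = n * y^2" using n by (simp add: power2_eq_square)
    ultimately show ?thesis by (simp add: i_def divide_inverse add.commute)
  qed
  have "(1 - 2 * a) * W (Suc n) w - harm (Suc n) = ((1 - 2 * a) * W n w - harm n) + ((1 - 2 * a) * y^2 - inverse (real (Suc n)))"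
    using step by (simp add: W_def harm_Suc y_def algebra_simps)
  also have "... = (1 - 2 * a) * (\<Sum>k=1..<n. (Y k w)^2 / real (k + 1))
     + 2 * (\<Sum>k=1..<n. (real k / real (k + 1) * Y k w) * xi k w) - (S n w)^2 / n + ((1 - 2 * a) * y^2 - inverse (real (Suc n)))"
    using step.IH by simp
  also have "... = (1 - 2 * a) * (\<Sum>k=1..<Suc n. (Y k w)^2 / real (k + 1))
     + 2 * (\<Sum>k=1..<Suc n. (real k / real (k + 1) * Y k w) * xi k w) - (S (Suc n) w)^2 / Suc n"
    unfolding alg S2 S using step by (simp add: y_def distrib_left)
  finally show ?case .
qed

text \<open>\<open>W_identity\<close> is divided by \<open>harm n\<close>. On its right-hand side
  the first sum and \<open>(S n)^2 / n\<close> have bounded mean by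
  \<open>second_moment_diffusive\<close>, and the martingale term is of order
  \<open>sqrt (harm n)\<close> in mean by orthogonality.\<close>

lemma W_over_harm:
  assumes a: "a < 1/2"
  shows "(\<lambda>n. E (\<lambda>w. \<bar>W n w / (harm n / (1 - 2 * a)) - 1\<bar>)) \<longlonglongrightarrow> 0"
proof -
  define c where "c = 1 - 2 * a"
  define b where "b = max 0 (2 * a)"
  define v where "v = 1 / (1 - b)"
  have c: "c > 0" using a by (simp add: c_def)
  have b: "2 * a \<le> b" "0 \<le> b" "b < 1" using a by (auto simp: b_def)
  have v: "1 \<le> v" "b * v + 1 \<le> v" "0 < v" using b by (auto simp: v_def field_simps)
  note mom = second_moment_diffusive[OF b(1,2) v(1,2)]
  have EY: "E (\<lambda>w. (Y k w)^2) \<le> v / k" if "k \<ge> 1" for k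
    using mom[OF that] that by (simp add: Y_def power_divide field_simps power2_eq_square)
  show ?thesis
  proof (rule Lim_null_comparison)
    have "((\<lambda>x. (c * v + v + 2 * sqrt (v * x)) / x) \<longlongrightarrow> 0) at_top" using v(3) by real_asymp
    from filterlim_compose[OF this harm_at_top]
    show "(\<lambda>n. (c * v + v + 2 * sqrt (v * harm n)) / harm n) \<longlonglongrightarrow> 0" .
    show "\<forall>\<^sub>F n in sequentially. norm (E (\<lambda>w. \<bar>W n w / (harm n / (1 - 2 * a)) - 1\<bar>)) \<le>
        (c * v + v + 2 * sqrt (v * harm n)) / harm n"
      using eventually_ge_at_top[of 1]
    proof eventually_elim
      case (elim n)
      have h: "harm n > (0::real)" using elim by simp
      define T where "T w = (\<Sum>k=1..<n. (real k / real (k + 1) * Y k w) * xi k w)" for w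
      define R where "R w = (\<Sum>k=1..<n. (Y k w)^2 / real (k + 1))" for w
      have dT: "determined n T" and dR: "determined n R" unfolding T_def R_def by (intro det_intros; simp)+
      have ET: "E (\<lambda>w. \<bar>T w\<bar>) \<le> sqrt (v * harm n)"
      proof -
        have "E (\<lambda>w. (T w)^2) \<le> (\<Sum>k=1..<n. E (\<lambda>w. (real k / real (k + 1) * Y k w)^2))"
          unfolding T_def by (rule martingale_sq_le) (auto intro!: det_intros)
        also have "... \<le> (\<Sum>k=1..<n. v / k)"
        proof (intro sum_mono)
          fix k assume k: "k \<in> {1..<n}"
          have "E (\<lambda>w. (real k / real (k + 1) * Y k w)^2) \<le> E (\<lambda>w. (Y k w)^2)"
          proof (rule expectation_mono[of k])
            fix w
            have "(real k / real (k + 1))^2 \<le> 1" by (simp add: abs_square_le_1)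
            thus "(real k / real (k + 1) * Y k w)^2 \<le> (Y k w)^2"
              unfolding power_mult_distrib by (intro mult_left_le_one_le) auto
          qed (intro det_intros; simp)+
          also have "... \<le> v / k" using EY k by simp
          finally show "E (\<lambda>w. (real k / real (k + 1) * Y k w)^2) \<le> v / k" .
        qed
        also have "... = v * (\<Sum>k=1..<n. inverse (real k))" by (simp add: sum_distrib_left divide_inverse)
        also have "... \<le> v * harm n" unfolding harm_def using v by (intro mult_left_mono sum_mono2) auto
        finally show ?thesis using expectation_abs_le_sqrt[OF dT] real_sqrt_le_mono order_trans by blast
      qed
      have ER: "E R \<le> v"
      proof -
        have "E R = (\<Sum>k=1..<n. E (\<lambda>w. (Y k w)^2) / real (k + 1))"
          unfolding R_def by (subst Bochner_Integration.integral_sum)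
            (auto intro!: integrable_determined[of n] det_intros)
        also have "... \<le> (\<Sum>k=1..<n. v * (1 / (real k * real (k + 1))))"
        proof (intro sum_mono)
          fix k assume "k \<in> {1..<n}"
          hence "E (\<lambda>w. (Y k w)^2) / real (k + 1) \<le> (v / k) / real (k + 1)"
            by (intro divide_right_mono EY) auto
          thus "E (\<lambda>w. (Y k w)^2) / real (k + 1) \<le> v * (1 / (real k * real (k + 1)))" by simp
        qed
        also have "... = v * (1 - 1 / n)" unfolding sum_distrib_left[symmetric] sum_inverse_consecutive[OF elim] ..
        also have "... \<le> v" using v by (simp add: algebra_simps)
        finally show ?thesis .
      qed
      have ES: "E (\<lambda>w. (S n w)^2 / n) \<le> v" using mom[OF elim] elim by (simp add: field_simps)
      have "E (\<lambda>w. \<bar>W n w / (harm n / (1 - 2 * a)) - 1\<bar>) \<le>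
         E (\<lambda>w. (c * R w + ((S n w)^2 / n + 2 * \<bar>T w\<bar>)) / harm n)"
      proof (rule expectation_mono[of n])
        fix w
        have R0: "0 \<le> R w" unfolding R_def by (intro sum_nonneg) auto
        have "W n w / (harm n / (1 - 2 * a)) - 1 = (c * W n w - harm n) / harm n"
        proof -
          have "harm n \<noteq> (0::real)" using h by linarith
          thus ?thesis unfolding c_def[symmetric] by (simp add: diff_divide_distrib mult.commute)
        qed
        also have "... = (c * R w + 2 * T w - (S n w)^2 / n) / harm n"
          using W_identity[OF elim, of w] by (simp add: c_def R_def T_def)
        also have "\<bar>...\<bar> = \<bar>c * R w + 2 * T w - (S n w)^2 / n\<bar> / harm n" by (simp add: abs_divide)
        also have "... \<le> (c * R w + ((S n w)^2 / n + 2 * \<bar>T w\<bar>)) / harm n"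
        proof (rule divide_right_mono)
          have "0 \<le> c * R w" "0 \<le> (S n w)^2 / n" using c R0 by auto
          thus "\<bar>c * R w + 2 * T w - (S n w)^2 / n\<bar> \<le> c * R w + ((S n w)^2 / n + 2 * \<bar>T w\<bar>)" by linarith
        qed (use h in linarith)
        finally show "\<bar>W n w / (harm n / (1 - 2 * a)) - 1\<bar> \<le> (c * R w + ((S n w)^2 / n + 2 * \<bar>T w\<bar>)) / harm n" .
      qed (intro det_intros dT dR det_W; simp)+
      also have "... = (c * E R + (E (\<lambda>w. (S n w)^2 / n) + 2 * E (\<lambda>w. \<bar>T w\<bar>))) / harm n"
      proof -
        have i: "integrable M R" "integrable M (\<lambda>w. (S n w)^2 / n)" "integrable M (\<lambda>w. \<bar>T w\<bar>)"
          by (rule integrable_determined[of n]; intro det_intros dR dT; simp)+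
        show ?thesis by (simp add: i Bochner_Integration.integral_add[OF _ Bochner_Integration.integrable_add] del: integral_divide_zero)
      qed
      also have "... \<le> (c * v + (v + 2 * sqrt (v * harm n))) / harm n"
        using ER ES ET c less_imp_le[OF h] by (intro divide_right_mono add_mono mult_left_mono) auto
      finally show ?case by (simp add: add_ac)
    qed
  qed
qed

text \<open>The weights \<open>Y / sqrt (d n)\<close> are truncated as soon as \<open>W\<close> exceeds \<open>2 d n\<close>, twice its typical size, which makes
  \<open>\<Sum>H\<^sup>2\<close> bounded without changing it on an event of probability tending to one.\<close>

theorem chi_square_diffusive:
  assumes a: "a < 1/2"
  shows "weak_conv_m (\<lambda>n. distr M borel (\<lambda>w. (N n w)^2 / W n w)) (chi_square_distribution 1)"
proof -
  define d where "d n = harm n / (1 - 2 * a)" for n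
  define H where "H n k w = (if W (Suc k) w \<le> 2 * d n then Y k w / sqrt (d n) else 0)" for n k w
  define U where "U n w = (\<Sum>k=1..<n. H n k w * xi k w)" for n w
  define D where "D n w = \<bar>W n w / d n - 1\<bar>" for n w
  have d0: "0 \<le> d n" for n using a by (simp add: d_def harm_nonneg)
  have dp: "0 < d n" if "n \<ge> 1" for n using a that by (simp add: d_def)
  have d_top: "filterlim d at_top sequentially"
    unfolding d_def divide_inverse using a
    by (intro filterlim_at_top_mult_tendsto_pos[OF tendsto_const _ harm_at_top]) auto
  have dH: "determined k (H n k)" for n k
    unfolding H_def by (intro det_intros det_W) auto
  have dH': "determined n (H n k)" if "k < n" for n k using that by (intro det_mono[OF dH]) auto
  have dU: "determined n (U n)" for n unfolding U_def by (intro det_intros dH') auto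
  have dW: "determined n (W n)" for n by (rule det_W) simp
  have dN: "determined n (N n)" for n by (rule det_N) simp
  have dD: "determined n (D n)" for n unfolding D_def by (intro det_intros dW)
  have ED: "(\<lambda>n. E (D n)) \<longlonglongrightarrow> 0" unfolding D_def d_def by (rule W_over_harm[OF a])
  have H2: "(\<Sum>k=1..<n. (H n k w)^2) \<le> 2" for n w
  proof (cases "n \<ge> 1")
    case True
    have "(\<Sum>k=1..<n. (H n k w)^2) = (\<Sum>k=1..<n. if (\<Sum>j=1..<Suc k. (Y j w)^2) \<le> 2 * d n then (Y k w)^2 else 0) / d n"
      unfolding sum_divide_distrib using d0 by (intro sum.cong) (auto simp: H_def W_def power_divide)
    also have "... \<le> 2 * d n / d n"
      using d0 by (intro divide_right_mono sum_truncated_le) auto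
    finally show ?thesis using dp[OF True] by simp
  qed simp
  have H_full: "H n k w = Y k w / sqrt (d n)" if "W n w \<le> 2 * d n" "k \<in> {1..<n}" for n k w
    using that W_mono[of "Suc k" n w] by (simp add: H_def)
  have clt: "(\<lambda>n. E (\<lambda>w. iexp (t * U n w))) \<longlonglongrightarrow> of_real (exp (- (t^2) / 2))" for t
    unfolding U_def
  proof (rule martingale_clt[where e="\<lambda>n. 1 / sqrt (d n)" and C=2])
    show "determined k (H n k)" for n k by (rule dH)
    show "\<bar>H n k w\<bar> \<le> 1 / sqrt (d n)" for n k w
      using abs_Y_le_1[of k w] d0[of n] by (auto simp: H_def abs_divide divide_right_mono)
    show "(\<lambda>n. 1 / sqrt (d n)) \<longlonglongrightarrow> 0"
      by (rule tendsto_divide_0[OF tendsto_const])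
         (rule filterlim_at_top_imp_at_infinity[OF filterlim_compose[OF sqrt_at_top d_top]])
    show "(\<Sum>k=1..<n. (H n k w)^2) \<le> 2" for n w by (rule H2)
    show "(\<lambda>n. E (\<lambda>w. \<bar>(\<Sum>k=1..<n. (H n k w)^2) - 1\<bar>)) \<longlonglongrightarrow> 0"
    proof (rule Lim_null_comparison[OF _ ED])
      show "\<forall>\<^sub>F n in sequentially. norm (E (\<lambda>w. \<bar>(\<Sum>k=1..<n. (H n k w)^2) - 1\<bar>)) \<le> E (D n)"
        using eventually_ge_at_top[of 1]
      proof eventually_elim
        case (elim n)
        have "E (\<lambda>w. \<bar>(\<Sum>k=1..<n. (H n k w)^2) - 1\<bar>) \<le> E (D n)"
        proof (rule expectation_mono[of n])
          fix w
          show "\<bar>(\<Sum>k=1..<n. (H n k w)^2) - 1\<bar> \<le> D n w"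
          proof (cases "W n w \<le> 2 * d n")
            case True
            have "(\<Sum>k=1..<n. (H n k w)^2) = W n w / d n"
              unfolding W_def sum_divide_distrib using True d0 by (intro sum.cong) (auto simp: H_full power_divide)
            thus ?thesis by (simp add: D_def)
          next
            case False
            \<comment> \<open>Truncation may have occurred, but the sum of the \<open>H^2\<close>
              lies between 0 and 2, so its distance from 1 is at most
              \<open>1 \<le> D\<close>.\<close>
            hence "D n w \<ge> 1" using dp[OF elim] by (simp add: D_def field_simps)
            moreover have "0 \<le> (\<Sum>k=1..<n. (H n k w)^2)" by (intro sum_nonneg) auto
            ultimately show ?thesis using H2[of n w] by linarith
          qed
        qed (auto intro!: det_intros dH' dD)
        thus ?case by (simp add: expectation_nonneg)
      qed
    qed
    define b where "b = max 0 (2 * a)"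
    define v where "v = 1 / (1 - b)"
    have b: "2 * a \<le> b" "0 \<le> b" "b < 1" using a by (auto simp: b_def)
    have v: "1 \<le> v" "b * v + 1 \<le> v" "0 < v" using b by (auto simp: v_def field_simps)
    \<comment> \<open>The fourth moment bound makes \<open>E (Y k)^4\<close> of order
      \<open>1 / k^2\<close>, which is summable, while \<open>d n\<close> tends to infinity.\<close>
    show "(\<lambda>n. \<Sum>k=1..<n. E (\<lambda>w. (H n k w)^2 * (Y k w)^2)) \<longlonglongrightarrow> 0"
    proof (rule Lim_null_comparison)
      show "(\<lambda>n. 12 * v^2 / d n) \<longlonglongrightarrow> 0"
        by (rule tendsto_divide_0[OF tendsto_const]) (rule filterlim_at_top_imp_at_infinity[OF d_top])
      show "\<forall>\<^sub>F n in sequentially. norm (\<Sum>k=1..<n. E (\<lambda>w. (H n k w)^2 * (Y k w)^2)) \<le> 12 * v^2 / d n"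
        using eventually_ge_at_top[of 1]
      proof eventually_elim
        case (elim n)
        have "(\<Sum>k=1..<n. E (\<lambda>w. (H n k w)^2 * (Y k w)^2)) \<le> (\<Sum>k=1..<n. 12 * v^2 / d n * (1 / (real k * real (k + 1))))"
        proof (intro sum_mono)
          fix k assume k: "k \<in> {1..<n}"
          have "E (\<lambda>w. (H n k w)^2 * (Y k w)^2) \<le> E (\<lambda>w. (S k w)^4 * (1 / (d n * (real k)^4)))"
          proof (rule expectation_mono[of k])
            fix w
            have "(H n k w)^2 \<le> (Y k w)^2 / d n" using d0[of n] by (auto simp: H_def power_divide)
            hence "(H n k w)^2 * (Y k w)^2 \<le> (Y k w)^2 / d n * (Y k w)^2" by (intro mult_right_mono) auto
            thus "(H n k w)^2 * (Y k w)^2 \<le> (S k w)^4 * (1 / (d n * (real k)^4))"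
              by (simp add: Y_def power_divide power4_eq_xxxx power2_eq_square mult_ac)
          qed (intro det_intros dH; simp)+
          also have "... \<le> 6 * v^2 * (real k)^2 * (1 / (d n * (real k)^4))"
            unfolding integral_mult_left_zero using fourth_moment_diffusive[OF b(1,2) v(1,2)] k d0
            by (intro mult_right_mono) auto
          also have "... = 6 * v^2 / d n * (1 / (real k)^2)"
            using k by (simp add: power4_eq_xxxx power2_eq_square)
          also have "... \<le> 6 * v^2 / d n * (2 / (real k * real (k + 1)))"
          proof (intro mult_left_mono)
            have "2 / (real k * (2 * real k)) \<le> 2 / (real k * real (k + 1))"
              using k by (intro divide_left_mono mult_left_mono) auto
            thus "1 / (real k)^2 \<le> 2 / (real k * real (k + 1))" by (simp add: power2_eq_square)
          qed (use d0 in auto)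
          finally show "E (\<lambda>w. (H n k w)^2 * (Y k w)^2) \<le> 12 * v^2 / d n * (1 / (real k * real (k + 1)))" by simp
        qed
        also have "... = 12 * v^2 / d n * (1 - 1 / n)" unfolding sum_distrib_left[symmetric] sum_inverse_consecutive[OF elim] ..
        also have "... \<le> 12 * v^2 / d n" using d0 elim by (intro mult_left_le) auto
        finally show ?case by (simp add: sum_nonneg expectation_nonneg)
      qed
    qed
  qed
  show ?thesis
  proof (rule weak_conv_chi_square[where U=U, OF _ _ clt])
    show "U n \<in> borel_measurable M" for n by (rule borel_measurable_determined[OF dU])
    show "(\<lambda>w. (N n w)^2 / W n w) \<in> borel_measurable M" for n
      by (rule borel_measurable_determined[of n]) (intro det_intros dN dW)
    show "(\<lambda>n. E (\<lambda>w. min 1 \<bar>(N n w)^2 / W n w - (U n w)^2\<bar>)) \<longlonglongrightarrow> 0"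
    proof (rule null_sequence_via_parameter[OF ED])
      show "0 \<le> E (\<lambda>w. min 1 \<bar>(N n w)^2 / W n w - (U n w)^2\<bar>)" for n
        by (rule expectation_nonneg) simp
      fix K :: real assume K: "K > 0"
      show "\<forall>\<^sub>F n in sequentially. E (\<lambda>w. min 1 \<bar>(N n w)^2 / W n w - (U n w)^2\<bar>) \<le> (2 * K + 2) * E (D n) + 2 / K"
        using eventually_ge_at_top[of 1]
      proof eventually_elim
        case (elim n)
        have "E (\<lambda>w. min 1 \<bar>(N n w)^2 / W n w - (U n w)^2\<bar>) \<le>
          E (\<lambda>w. (2 * K + 2) * D n w + (U n w)^2 / K)"
        proof (rule expectation_mono[of n])
          fix w
          have D0: "0 \<le> D n w" by (simp add: D_def)
          show "min 1 \<bar>(N n w)^2 / W n w - (U n w)^2\<bar> \<le> (2 * K + 2) * D n w + (U n w)^2 / K"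
          \<comment> \<open>If \<open>D \<ge> 1/2\<close> or \<open>U^2 \<ge> K\<close>, then
            \<open>2 D\<close> or \<open>U^2 / K\<close> is at least 1 and dominates the minimum.
            Otherwise \<open>W / d\<close> lies between 1/2 and 2, nothing has been truncated, and
            the two squares differ by at most \<open>2 K D\<close>.\<close>
          proof (cases "D n w \<ge> 1/2 \<or> (U n w)^2 \<ge> K")
            case True
            have "0 \<le> K * D n w" "0 \<le> (U n w)^2 / K" using K D0 by auto
            moreover have "1 \<le> (U n w)^2 / K" if "(U n w)^2 \<ge> K" using that K by simp
            ultimately show ?thesis using True D0 by (auto simp: algebra_simps min_def)
          next
            case False
            define r where "r = W n w / d n"
            have Dr: "D n w = \<bar>r - 1\<bar>" by (simp add: D_def r_def)
            have "1/2 \<le> r" "r \<le> 2" using False unfolding Dr by (auto simp: abs_if split: if_splits)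
            note r = this Dr
            have "W n w \<le> 2 * d n" using r(2) dp[OF elim] by (simp add: r_def field_simps)
            hence "U n w = N n w / sqrt (d n)"
              unfolding U_def N_def sum_divide_distrib by (intro sum.cong) (auto simp: H_full)
            hence U2: "(U n w)^2 = (N n w)^2 / d n" using d0 by (simp add: power_divide)
            have "(N n w)^2 / W n w - (U n w)^2 = (U n w)^2 * ((1 - r) / r)"
              unfolding U2 r_def using dp[OF elim] r by (simp add: r_def field_simps)
            hence "\<bar>(N n w)^2 / W n w - (U n w)^2\<bar> = (U n w)^2 * (D n w / r)"
              using r by (simp add: abs_mult abs_divide abs_minus_commute)
            also have "... \<le> K * (D n w / (1/2))"
              using False r D0 K by (intro mult_mono divide_left_mono) auto
            finally have "\<bar>(N n w)^2 / W n w - (U n w)^2\<bar> \<le> 2 * K * D n w" by simp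
            moreover have "0 \<le> (U n w)^2 / K" using K by simp
            ultimately show ?thesis using D0 by (simp add: algebra_simps min_def)
          qed
        next
          show "determined n (\<lambda>w. min 1 \<bar>(N n w)^2 / W n w - (U n w)^2\<bar>)"
            by (rule det_comp[where F="min 1"]) (intro det_intros dN dW dU)
        qed (intro det_intros dD dU)
        also have "... = (2 * K + 2) * E (D n) + E (\<lambda>w. (U n w)^2) / K"
        proof -
          have "integrable M (D n)" "integrable M (\<lambda>w. (U n w)^2)"
            by (rule integrable_determined[of n]; intro det_intros dD dU)+
          thus ?thesis by simp
        qed
        also have "E (\<lambda>w. (U n w)^2) \<le> 2"
        proof -
          have "E (\<lambda>w. (U n w)^2) \<le> (\<Sum>k=1..<n. E (\<lambda>w. (H n k w)^2))"
            unfolding U_def by (rule martingale_sq_le) (auto intro: dH)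
          also have "... = E (\<lambda>w. \<Sum>k=1..<n. (H n k w)^2)"
            by (rule Bochner_Integration.integral_sum[symmetric]) (auto intro!: integrable_determined[of n] det_intros dH')
          also have "... \<le> E (\<lambda>w. 2)"
            by (rule expectation_mono[of n]; (rule H2)?; intro det_intros dH'; simp)
          finally show ?thesis by (simp add: prob_space)
        qed
        finally show ?case using K by (simp add: divide_right_mono)
      qed
    qed
  qed
qed

end

subsection \<open>The case \<open>a > 1/2\<close>\<close>

text \<open>Toeplitz's averaging argument: the finitely many indices with large \<open>x\<close>
  contribute a constant, which the diverging total weight outgrows.\<close>

lemma weighted_average_null:
  fixes w x :: "nat \<Rightarrow> real"
  assumes w: "\<And>k. 0 \<le> w k" "filterlim (\<lambda>n. \<Sum>k=1..<n. w k) at_top sequentially"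
    and x: "x \<longlonglongrightarrow> 0" "\<And>k. 0 \<le> x k"
  shows "(\<lambda>n. (\<Sum>k=1..<n. w k * x k) / (\<Sum>k=1..<n. w k)) \<longlonglongrightarrow> 0"
proof (rule order_tendstoI)
  fix \<epsilon> :: real assume \<epsilon>: "0 < \<epsilon>"
  have "\<forall>\<^sub>F k in sequentially. x k < \<epsilon> / 2" using x(1) by (rule order_tendstoD) (use \<epsilon> in simp)
  then obtain m where "\<forall>k\<ge>m. x k < \<epsilon> / 2" by (auto simp: eventually_sequentially)
  hence m: "\<And>k. k \<ge> m \<Longrightarrow> x k \<le> \<epsilon> / 2" by (simp add: less_imp_le)
  define C where "C = (\<Sum>k=1..<m. w k * x k)"
  have "\<forall>\<^sub>F n in sequentially. (\<Sum>k=1..<n. w k) > max 0 (2 * C / \<epsilon>)"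
    using w(2) unfolding filterlim_at_top_dense by blast
  thus "\<forall>\<^sub>F n in sequentially. (\<Sum>k=1..<n. w k * x k) / (\<Sum>k=1..<n. w k) < \<epsilon>"
  proof eventually_elim
    case (elim n)
    have "(\<Sum>k=1..<n. w k * x k) \<le> (\<Sum>k=1..<n. (if k < m then w k * x k else 0) + \<epsilon> / 2 * w k)"
    proof (intro sum_mono)
      fix k
      show "w k * x k \<le> (if k < m then w k * x k else 0) + \<epsilon> / 2 * w k"
      proof (cases "k < m")
        case False
        thus ?thesis using mult_left_mono[OF m[of k] w(1)[of k]] by (simp add: mult.commute)
      qed (use w(1)[of k] \<epsilon> in simp)
    qed
    also have "... = (\<Sum>k\<in>{1..<n} \<inter> {k. k < m}. w k * x k) + \<epsilon> / 2 * (\<Sum>k=1..<n. w k)"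
      by (simp add: sum.distrib sum.If_cases sum_distrib_left)
    also have "(\<Sum>k\<in>{1..<n} \<inter> {k. k < m}. w k * x k) \<le> C"
      unfolding C_def using w x by (intro sum_mono2) auto
    finally have "(\<Sum>k=1..<n. w k * x k) \<le> C + \<epsilon> / 2 * (\<Sum>k=1..<n. w k)" by simp
    also have "C < \<epsilon> / 2 * (\<Sum>k=1..<n. w k)" using elim \<epsilon> by (simp add: field_simps)
    finally show ?case using elim by (simp add: field_simps)
  qed
next
  fix \<epsilon> :: real assume "\<epsilon> < 0"
  moreover have "0 \<le> (\<Sum>k=1..<n. w k * x k) / (\<Sum>k=1..<n. w k)" for n
    using w x by (intro divide_nonneg_nonneg sum_nonneg) auto
  ultimately show "\<forall>\<^sub>F n in sequentially. \<epsilon> < (\<Sum>k=1..<n. w k * x k) / (\<Sum>k=1..<n. w k)"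
    by (intro always_eventually allI) (rule less_le_trans)
qed

text \<open>\<open>a > 1/2\<close> makes the increments of the rescaled walk square summable
  (\<open>summable_inc\<close>). \<open>a < 1\<close> lets the weights \<open>h\<close> tend to zero
  and keeps the conditional variance of \<open>xi\<close> at least
  \<open>1 - a^2 > 0\<close>.\<close>

locale superdiffusive_walk = reinforced_walk +
  assumes a_gt: "1 / 2 < a" and a_less: "a < 1"
begin

text \<open>\<open>L n = S n / gr n\<close> is a square integrable martingale with increments \<open>xi n / gr (Suc n)\<close>.\<close>

definition gr :: "nat \<Rightarrow> real" where "gr n = (\<Prod>k=1..<n. 1 + a / real k)"
definition h :: "nat \<Rightarrow> real" where "h n = gr n / real n"
definition s :: "nat \<Rightarrow> real" where "s n = (\<Sum>k=1..<n. (h k)^2)"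
definition L :: "nat \<Rightarrow> 'a \<Rightarrow> real" where "L n w = S n w / gr n"
text \<open>As \<open>Y k = h k * L k\<close>, \<open>Z\<close> and \<open>s\<close> are
  \<open>N\<close> and \<open>W\<close> with every \<open>L k\<close> replaced by 1.\<close>

definition Z :: "nat \<Rightarrow> 'a \<Rightarrow> real" where "Z n w = (\<Sum>k=1..<n. h k * xi k w)"
definition inc :: "nat \<Rightarrow> real" where "inc k = 1 / (gr (Suc k))^2"
definition rest :: "nat \<Rightarrow> real" where "rest m = (\<Sum>k. inc (k + m))"

section \<open>Growth of the deterministic weights\<close>

lemma gr_Suc: "n \<ge> 1 \<Longrightarrow> gr (Suc n) = gr n * (1 + a / real n)"
  by (simp add: gr_def)

lemma gr_ge_powr: "n \<ge> 1 \<Longrightarrow> real n powr a \<le> gr n"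
proof (induction n rule: dec_induct)
  case base
  show ?case by (simp add: gr_def)
next
  case (step n)
  have n: "real n \<ge> 1" using step by simp
  have "real (Suc n) = real n * (1 + 1 / n)" using n by (simp add: field_simps)
  hence "real (Suc n) powr a = real n powr a * (1 + 1 / n) powr a" using n by (simp add: powr_mult)
  \<comment> \<open>Weighted geometric and arithmetic means of \<open>1 + 1 / n\<close> and 1, with
    weights \<open>a\<close> and \<open>1 - a\<close>.\<close>
  also have "(1 + 1 / n) powr a \<le> 1 + a / n"
    using Youngs_inequality_0[of a "1 - a" "1 + 1 / n" 1] a_gt a_less n by (simp add: field_simps)
  also have "real n powr a * (1 + a / n) \<le> gr n * (1 + a / n)"
    using step.IH a_gt by (intro mult_right_mono) auto
  finally show ?case using step by (simp add: gr_Suc mult_left_mono)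
qed

lemma gr_ge_1: "1 \<le> gr n"
  unfolding gr_def using a_gt by (intro prod_ge_1) auto

lemma gr_pos: "0 < gr n"
  using gr_ge_1[of n] by simp

text \<open>From \<open>n\<close> to \<open>n + 1\<close>, \<open>h\<close> changes by the factor
  \<open>1 - (1 - a) / (n + 1)\<close>; bounding each factor by an exponential turns the product
  into a harmonic sum.\<close>

lemma h_le_exp: "n \<ge> 1 \<Longrightarrow> h n \<le> exp (- (1 - a) * (harm n - 1))"
proof (induction n rule: dec_induct)
  case base
  show ?case by (simp add: h_def gr_def harm_def)
next
  case (step n)
  have n: "real n \<ge> 1" using step by simp
  have "h (Suc n) = h n * (1 + - (1 - a) / real (Suc n))"
    using n step by (simp add: h_def gr_Suc field_simps)
  also have "... \<le> h n * exp (- (1 - a) / real (Suc n))"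
    using gr_pos[of n] by (intro mult_left_mono exp_ge_add_one_self) (simp add: h_def)
  also have "... \<le> exp (- (1 - a) * (harm n - 1)) * exp (- (1 - a) / real (Suc n))"
    using step.IH by (intro mult_right_mono) auto
  also have "... = exp (- (1 - a) * (harm (Suc n) - 1))"
    by (simp add: harm_Suc algebra_simps divide_inverse flip: exp_add)
  finally show ?case .
qed

lemma h_nonneg: "0 \<le> h n"
  using gr_pos[of n] by (simp add: h_def)

lemma h_le_1: "h n \<le> 1"
proof (cases "n \<ge> 1")
  case True
  have "harm 1 \<le> (harm n :: real)" by (rule harm_mono) (rule True)
  hence "1 \<le> (harm n :: real)" by (simp add: harm_def)
  hence "- (1 - a) * (harm n - 1) \<le> 0" using a_less by (intro mult_nonpos_nonneg) auto
  thus ?thesis using h_le_exp[OF True] by (meson exp_le_one_iff order_trans)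
qed (simp add: h_def not_le)

lemma h_tendsto_0: "h \<longlonglongrightarrow> 0"
proof (rule Lim_null_comparison)
  show "\<forall>\<^sub>F n in sequentially. norm (h n) \<le> exp (- (1 - a) * (harm n - 1))"
    using eventually_ge_at_top[of 1] by eventually_elim (use h_le_exp h_nonneg in auto)
  have "((\<lambda>x. exp (- (1 - a) * (x - 1))) \<longlongrightarrow> 0) at_top" using a_less by real_asymp
  from filterlim_compose[OF this harm_at_top] show "(\<lambda>n. exp (- (1 - a) * (harm n - 1))) \<longlonglongrightarrow> 0" .
qed

text \<open>\<open>h k \<ge> k powr (a - 1)\<close> and \<open>a > 1/2\<close> give
  \<open>(h k)^2 \<ge> 1 / k\<close>.\<close>

lemma s_at_top: "filterlim s at_top sequentially"
proof (rule filterlim_at_top_mono)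
  show "filterlim (\<lambda>n. harm n - 1 :: real) at_top sequentially"
    using filterlim_tendsto_add_at_top[OF tendsto_const[of "-1"] harm_at_top] by simp
  show "\<forall>\<^sub>F n in sequentially. harm n - 1 \<le> s n"
    using eventually_ge_at_top[of 1]
  proof eventually_elim
    case (elim n)
    have "inverse (real k) \<le> (h k)^2" if "k \<in> {1..<n}" for k
    proof -
      have k: "real k \<ge> 1" using that by simp
      have "inverse (real k) = real k powr (-1)" using k by (simp add: powr_minus)
      also have "... \<le> real k powr (2 * (a - 1))" using k a_gt by (intro powr_mono) auto
      also have "... = (real k powr (a - 1))^2" using k by (simp add: powr_power)
      also have "real k powr (a - 1) = real k powr a / real k" using k by (simp add: powr_diff)
      also have "(real k powr a / real k)^2 \<le> (h k)^2" unfolding h_def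
        using that k gr_ge_powr[of k] by (intro power_mono divide_right_mono) auto
      finally show ?thesis .
    qed
    hence "(\<Sum>k=1..<n. inverse (real k)) \<le> s n" unfolding s_def by (intro sum_mono) auto
    moreover have "harm n = (\<Sum>k=1..<n. inverse (real k)) + inverse (real n)"
      using elim by (simp add: harm_def sum.last_plus)
    moreover have "inverse (real n) \<le> 1" using elim by (simp add: inverse_le_1_iff)
    ultimately show ?case by linarith
  qed
qed

lemma inc_pos: "0 < inc k"
  using gr_pos[of "Suc k"] by (simp add: inc_def)

lemma summable_inc: "summable inc"
proof (rule summable_comparison_test')
  have "summable (\<lambda>k. real k powr (- (2 * a)))" using a_gt by (subst summable_real_powr_iff) simp
  thus "summable (\<lambda>k. real (Suc k) powr (- (2 * a)))" by (subst summable_Suc_iff)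
  fix k :: nat
  have "real (Suc k) powr (2 * a) = (real (Suc k) powr a)^2" by (simp add: powr_power mult.commute)
  also have "... \<le> (gr (Suc k))^2" using gr_ge_powr[of "Suc k"] by (intro power_mono) auto
  finally have "1 / (gr (Suc k))^2 \<le> 1 / real (Suc k) powr (2 * a)"
    using gr_pos[of "Suc k"] by (intro divide_left_mono mult_pos_pos) auto
  thus "norm (inc k) \<le> real (Suc k) powr (- (2 * a))" by (simp add: inc_def powr_minus divide_inverse)
qed

lemma sum_inc_le_rest: "(\<Sum>k=m..<n. inc k) \<le> rest m"
proof -
  have "(\<Sum>k=m..<n. inc k) = (\<Sum>k<n - m. inc (k + m))"
    by (rule sum.reindex_bij_witness[of _ "\<lambda>k. k + m" "\<lambda>k. k - m"]) auto
  also have "... \<le> rest m" unfolding rest_def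
    using summable_inc inc_pos by (intro sum_le_suminf) (auto simp: less_imp_le summable_iff_shift)
  finally show ?thesis .
qed

lemma rest_nonneg: "0 \<le> rest m"
  using sum_inc_le_rest[of m m] by simp

lemma rest_tendsto_0: "rest \<longlonglongrightarrow> 0"
  unfolding rest_def using suminf_exist_split2[OF summable_inc] .

section \<open>Moments of the martingale \<open>L\<close>\<close>

lemma det_L: "k \<le> n \<Longrightarrow> determined n (L k)"
  unfolding L_def by (intro det_intros)

lemma det_Z: "k \<le> n \<Longrightarrow> determined n (Z k)"
  unfolding Z_def by (intro det_intros) auto

lemma Y_eq: "Y k w = h k * L k w"
  using gr_pos[of k] by (simp add: Y_def h_def L_def)

lemma L_Suc: "n \<ge> 1 \<Longrightarrow> L (Suc n) w = L n w + xi n w / gr (Suc n)"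
proof -
  assume n: "n \<ge> 1"
  have "S (Suc n) w = S n w * (1 + a / n) + xi n w"
    by (simp add: S_Suc xi_def Y_def algebra_simps)
  hence "L (Suc n) w = S n w * (1 + a / n) / gr (Suc n) + xi n w / gr (Suc n)"
    by (simp add: L_def add_divide_distrib)
  moreover have "1 + a / n \<noteq> 0" using a_gt by (intro less_imp_neq[THEN not_sym] add_pos_nonneg) auto
  ultimately show ?thesis using n by (simp add: gr_Suc L_def)
qed

lemma L_diff:
  assumes "1 \<le> m" "m \<le> n"
  shows "L n w - L m w = (\<Sum>k=m..<n. 1 / gr (Suc k) * xi k w)"
  using assms(2)
proof (induction n rule: dec_induct)
  case (step n)
  thus ?case using assms(1) L_Suc[of n w] by simp
qed simp

lemma expectation_L_diff_sq:
  assumes "1 \<le> m" "m \<le> n"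
  shows "E (\<lambda>w. (L n w - L m w)^2) \<le> rest m"
proof -
  have "E (\<lambda>w. (L n w - L m w)^2) \<le> (\<Sum>k=m..<n. E (\<lambda>w. (1 / gr (Suc k))^2))"
    unfolding L_diff[OF assms] by (rule martingale_sq_le) (use assms in \<open>auto intro: det_const\<close>)
  also have "... = (\<Sum>k=m..<n. inc k)" by (simp add: inc_def power_divide prob_space)
  finally show ?thesis using sum_inc_le_rest[of m n] by simp
qed

definition Lbound :: real where "Lbound = 2 + 2 * rest 1"

lemma Lbound_ge: "2 \<le> Lbound"
  using rest_nonneg[of 1] by (simp add: Lbound_def)

lemma expectation_L_sq: "n \<ge> 1 \<Longrightarrow> E (\<lambda>w. (L n w)^2) \<le> Lbound"
proof -
  assume n: "n \<ge> 1"
  have L1: "(L 1 w)^2 = 1" for w using S_1_sq[of w] by (simp add: L_def gr_def)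
  have i: "integrable M (\<lambda>w. (L n w - L 1 w)^2)"
    by (rule integrable_determined[of n]) (intro det_intros det_L; use n in simp)
  have "E (\<lambda>w. (L n w)^2) \<le> E (\<lambda>w. 2 + 2 * (L n w - L 1 w)^2)"
  proof (rule expectation_mono[of n])
    fix w
    have "0 \<le> (L n w - 2 * L 1 w)^2" by simp
    thus "(L n w)^2 \<le> 2 + 2 * (L n w - L 1 w)^2" using L1[of w] by (simp add: power2_diff power_mult_distrib)
  qed (intro det_intros det_L; use n in simp)+
  also have "... = 2 + 2 * E (\<lambda>w. (L n w - L 1 w)^2)" using i by (simp add: prob_space)
  also have "... \<le> Lbound" using expectation_L_diff_sq[of 1 n] n by (simp add: Lbound_def)
  finally show ?thesis .
qed

text \<open>Each step adds \<open>inc n\<close> times the conditional variance of \<open>xi\<close>,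
  which lies between \<open>1 - a^2\<close> and 1. The lower bound supplies the spread for
  \<open>escape\<close>.\<close>

lemma L_second_moment:
  fixes f :: "'a \<Rightarrow> real"
  assumes f: "determined m f" "\<And>w. 0 \<le> f w" and m: "1 \<le> m" "m \<le> n"
  defines "E0 \<equiv> E (\<lambda>w. f w * (L m w)^2)" and "r \<equiv> \<Sum>k=m..<n. inc k"
  shows "E0 + (1 - a^2) * r * E f \<le> E (\<lambda>w. f w * (L n w)^2)"
    and "E (\<lambda>w. f w * (L n w)^2) \<le> E0 + r * E f"
proof -
  have one_step: "E (\<lambda>w. f w * (L (Suc n) w)^2) = E (\<lambda>w. f w * (L n w)^2)
      + inc n * E (\<lambda>w. f w * (1 - a^2 * (Y n w)^2))" if "m \<le> n" for n
  proof -
    have n: "n \<ge> 1" using that m by simp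
    have fn: "determined n f" by (rule det_mono[OF f(1) that])
    have "E (\<lambda>w. f w * (L (Suc n) w)^2) = E (\<lambda>w. f w * (L n w)^2
       + ((f w * (2 * L n w / gr (Suc n))) * xi n w + inc n * (f w * (xi n w)^2)))"
      unfolding L_Suc[OF n] by (simp add: inc_def power2_sum power_divide algebra_simps)
    also have "... = E (\<lambda>w. f w * (L n w)^2) +
      (E (\<lambda>w. (f w * (2 * L n w / gr (Suc n))) * xi n w) + E (\<lambda>w. inc n * (f w * (xi n w)^2)))"
      by (rule expectation_add3[of "Suc n"]; intro det_intros det_L det_mono[OF fn]; simp)
    also have "E (\<lambda>w. (f w * (2 * L n w / gr (Suc n))) * xi n w) = 0"
      by (rule expectation_xi[OF n]) (intro det_intros det_L fn; simp)
    also have "E (\<lambda>w. inc n * (f w * (xi n w)^2)) = inc n * E (\<lambda>w. f w * (1 - a^2 * (Y n w)^2))"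
      using expectation_xi_sq[OF n fn] by simp
    finally show ?thesis by simp
  qed
  have lo: "(1 - a^2) * E f \<le> E (\<lambda>w. f w * (1 - a^2 * (Y n w)^2))"
    and hi: "E (\<lambda>w. f w * (1 - a^2 * (Y n w)^2)) \<le> E f" if "m \<le> n" for n
  proof -
    have d: "determined n f" "determined n (\<lambda>w. f w * (1 - a^2 * (Y n w)^2))" "determined n (\<lambda>w. f w * (1 - a^2))"
      by (intro det_intros det_mono[OF f(1) that]; simp)+
    show "(1 - a^2) * E f \<le> E (\<lambda>w. f w * (1 - a^2 * (Y n w)^2))"
      using expectation_mono[OF d(3,2)] mult_left_mono[OF one_minus_aY_bounds(1) f(2)] by (simp add: mult.commute)
    show "E (\<lambda>w. f w * (1 - a^2 * (Y n w)^2)) \<le> E f"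
      using expectation_mono[OF d(2,1)] mult_left_mono[OF one_minus_aY_bounds(3) f(2)] by simp
  qed
  have "E0 + (1 - a^2) * (\<Sum>k=m..<n. inc k) * E f \<le> E (\<lambda>w. f w * (L n w)^2)
    \<and> E (\<lambda>w. f w * (L n w)^2) \<le> E0 + (\<Sum>k=m..<n. inc k) * E f"
    using m(2)
  proof (induction n rule: dec_induct)
    case base
    show ?case by (simp add: E0_def)
  next
    case (step n)
    have "inc n * ((1 - a^2) * E f) \<le> inc n * E (\<lambda>w. f w * (1 - a^2 * (Y n w)^2))"
      "inc n * E (\<lambda>w. f w * (1 - a^2 * (Y n w)^2)) \<le> inc n * E f"
      using lo[OF step(1)] hi[OF step(1)] inc_pos[of n] by (auto intro!: mult_left_mono)
    thus ?case using one_step[OF step(1)] step by (simp add: algebra_simps)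
  qed
  thus "E0 + (1 - a^2) * r * E f \<le> E (\<lambda>w. f w * (L n w)^2)"
    and "E (\<lambda>w. f w * (L n w)^2) \<le> E0 + r * E f" by (auto simp: r_def)
qed

text \<open>The increment \<open>y\<close> of \<open>L\<close> satisfies
  \<open>y^2 \<le> 4 * inc n\<close>, as \<open>\<bar>xi\<bar> \<le> 2\<close>. Once the term with
  \<open>x y^3\<close> is absorbed, \<open>8 x^2 y^2 + 3 y^4\<close> remains besides
  \<open>x^4\<close> and a term of mean zero, whence 32 and 48; the common factor
  \<open>80 = 32 + 48\<close> suffices for the sum over all steps.\<close>

lemma L_fourth_moment:
  fixes f :: "'a \<Rightarrow> real"
  assumes f: "determined m f" "\<And>w. 0 \<le> f w" and m: "1 \<le> m" "m \<le> n"
  defines "r \<equiv> \<Sum>k=m..<n. inc k"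
  shows "E (\<lambda>w. f w * (L n w)^4) \<le> 80 * E (\<lambda>w. f w * ((L m w)^2 + r)^2)"
proof -
  define F where "F = E f"
  define E2 where "E2 = E (\<lambda>w. f w * (L m w)^2)"
  define E4 where "E4 = E (\<lambda>w. f w * (L m w)^4)"
  have pos: "0 \<le> F" "0 \<le> E2" "0 \<le> E4" unfolding F_def E2_def E4_def using f(2) by (auto intro!: expectation_nonneg)
  have one_step: "E (\<lambda>w. f w * (L (Suc n) w)^4) \<le> E (\<lambda>w. f w * (L n w)^4)
      + (32 * inc n * E (\<lambda>w. f w * (L n w)^2) + 48 * (inc n)^2 * F)" if "m \<le> n" for n
  proof -
    have n: "n \<ge> 1" using that m by simp
    have fn: "determined n f" by (rule det_mono[OF f(1) that])
    have "E (\<lambda>w. f w * (L (Suc n) w)^4) \<le> E (\<lambda>w. f w * (L n w)^4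
       + ((f w * (4 * (L n w)^3 / gr (Suc n))) * xi n w + (32 * inc n * (f w * (L n w)^2) + 48 * (inc n)^2 * f w)))"
    proof (rule expectation_mono[of "Suc n"])
      fix w
      define x where "x = L n w"
      define y where "y = xi n w / gr (Suc n)"
      have y2: "y^2 \<le> 4 * inc n"
      proof -
        have "(xi n w)^2 \<le> 2^2" using abs_xi_le[of n w] by (metis abs_ge_zero power2_abs power_mono)
        thus ?thesis by (simp add: y_def inc_def power_divide divide_right_mono)
      qed
      have "(x + y)^4 = x^4 + 4 * x^3 * y + 6 * (x^2 * y^2) + 4 * (x * y) * y^2 + (y^2)^2"
        by (simp add: power4_eq_xxxx power3_eq_cube power2_eq_square algebra_simps)
      also have "4 * (x * y) * y^2 \<le> 2 * (x^2 * y^2) + 2 * (y^2)^2"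
      proof -
        have "0 \<le> 2 * ((x - y)^2 * y^2)" by simp
        thus ?thesis by (simp add: power2_diff algebra_simps power2_eq_square)
      qed
      finally have "(x + y)^4 \<le> x^4 + 4 * x^3 * y + (8 * (x^2 * y^2) + 3 * (y^2)^2)" by simp
      also have "x^2 * y^2 \<le> x^2 * (4 * inc n)" using y2 by (intro mult_left_mono) auto
      also have "(y^2)^2 \<le> (4 * inc n)^2" using y2 by (intro power_mono) auto
      finally have "(x + y)^4 \<le> x^4 + 4 * x^3 * y + (32 * inc n * x^2 + 48 * (inc n)^2)"
        by (simp add: power_mult_distrib algebra_simps)
      hence "f w * (x + y)^4 \<le> f w * (x^4 + 4 * x^3 * y + (32 * inc n * x^2 + 48 * (inc n)^2))"
        using f(2) by (intro mult_left_mono)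
      thus "f w * (L (Suc n) w)^4 \<le> f w * (L n w)^4
       + ((f w * (4 * (L n w)^3 / gr (Suc n))) * xi n w + (32 * inc n * (f w * (L n w)^2) + 48 * (inc n)^2 * f w))"
        unfolding L_Suc[OF n] x_def[symmetric] y_def[symmetric] by (simp add: y_def algebra_simps)
    qed (intro det_intros det_L det_mono[OF fn]; simp)+
    also have "... = E (\<lambda>w. f w * (L n w)^4) +
      (E (\<lambda>w. (f w * (4 * (L n w)^3 / gr (Suc n))) * xi n w) +
       E (\<lambda>w. 32 * inc n * (f w * (L n w)^2) + 48 * (inc n)^2 * f w))"
      by (rule expectation_add3[of "Suc n"]; intro det_intros det_L det_mono[OF fn]; simp)
    also have "E (\<lambda>w. (f w * (4 * (L n w)^3 / gr (Suc n))) * xi n w) = 0"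
      by (rule expectation_xi[OF n]) (intro det_intros det_L fn; simp)
    also have "E (\<lambda>w. 32 * inc n * (f w * (L n w)^2) + 48 * (inc n)^2 * f w) =
       E (\<lambda>w. 32 * inc n * (f w * (L n w)^2)) + E (\<lambda>w. 48 * (inc n)^2 * f w)"
      by (rule expectation_add[of n]; intro det_intros det_L fn; simp)
    finally show ?thesis by (simp add: F_def)
  qed
  have ind: "E (\<lambda>w. f w * (L n w)^4) \<le> E4 + 32 * (\<Sum>k=m..<n. inc k) * E2 + 80 * (\<Sum>k=m..<n. inc k)^2 * F"
    using m(2)
  proof (induction n rule: dec_induct)
    case base
    show ?case by (simp add: E4_def)
  next
    case (step n)
    define R where "R = (\<Sum>k=m..<n. inc k)"
    have R0: "0 \<le> R" unfolding R_def using inc_pos by (intro sum_nonneg less_imp_le)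
    have q: "0 \<le> inc n" using inc_pos less_imp_le by blast
    have L2: "E (\<lambda>w. f w * (L n w)^2) \<le> E2 + R * F"
      unfolding R_def F_def E2_def by (rule L_second_moment(2)[OF f m(1) step(1)])
    have "E (\<lambda>w. f w * (L (Suc n) w)^4) \<le> (E4 + 32 * R * E2 + 80 * R^2 * F) + (32 * inc n * (E2 + R * F) + 48 * (inc n)^2 * F)"
      using one_step[OF step(1)] step.IH mult_left_mono[OF L2, of "32 * inc n"] q unfolding R_def[symmetric] by linarith
    also have "... \<le> E4 + 32 * (R + inc n) * E2 + 80 * (R + inc n)^2 * F"
    proof -
      have "0 \<le> (128 * inc n * R + 32 * (inc n)^2) * F" using R0 q pos by auto
      thus ?thesis by (simp add: power2_sum algebra_simps)
    qed
    finally show ?case using step(1) by (simp add: R_def)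
  qed
  have r0: "0 \<le> r" unfolding r_def using inc_pos by (intro sum_nonneg less_imp_le)
  have "80 * E (\<lambda>w. f w * ((L m w)^2 + r)^2) =
     80 * E (\<lambda>w. f w * (L m w)^4 + (2 * r * (f w * (L m w)^2) + r^2 * f w))"
    by (simp add: power2_sum algebra_simps flip: power_mult)
  also have "... = 80 * (E4 + (2 * r * E2 + r^2 * F))"
  proof -
    have i: "integrable M (\<lambda>w. f w * (L m w)^4)" "integrable M (\<lambda>w. f w * (L m w)^2)" "integrable M f"
      by (rule integrable_determined[of m]; intro det_intros det_L f; simp)+
    show ?thesis
      by (simp add: i E4_def E2_def F_def Bochner_Integration.integral_add[OF _ Bochner_Integration.integrable_add])
  qed
  finally have "80 * E (\<lambda>w. f w * ((L m w)^2 + r)^2) = 80 * E4 + 160 * (r * E2) + 80 * r^2 * F" by simp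
  moreover have "0 \<le> r * E2" using r0 pos by simp
  ultimately show ?thesis using ind pos unfolding r_def[symmetric] by (simp add: mult.assoc)
qed


section \<open>Small balls around zero\<close>

definition theta :: real where "theta = (1 - a^2) / 2"
text \<open>With \<open>c = 1 - a^2\<close> and \<open>theta = c / 2\<close>, the proof of
  \<open>escape\<close> arrives at the factor
  \<open>1 + \<alpha> * theta - \<alpha> * c + 20 * \<alpha>^2\<close>. Its minimum over
  \<open>\<alpha>\<close>, attained at \<open>c / 80\<close>, is
  \<open>1 - c^2 / 320\<close>.\<close>

definition kappa :: real where "kappa = (1 - a^2)^2 / 320"

lemma a_sq_less: "a^2 < 1"
  using a_gt a_less by (simp add: abs_square_less_1)

lemma theta_pos: "0 < theta" and kappa_pos: "0 < kappa" and kappa_less: "kappa < 1"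
proof -
  show "0 < theta" "0 < kappa" using a_sq_less by (auto simp: theta_def kappa_def)
  have "\<bar>1 - a^2\<bar> \<le> 1" using a_sq_less zero_le_power2[of a] by linarith
  hence "(1 - a^2)^2 \<le> 1" by (simp only: abs_square_le_1)
  thus "kappa < 1" by (simp add: kappa_def)
qed

lemma det_indicator_le: "determined n f \<Longrightarrow> determined n (\<lambda>w. of_bool (f w \<le> (c::real)) :: real)"
  by (rule det_comp[where F="\<lambda>x. of_bool (x \<le> c)"])

text \<open>Whatever the value of \<open>L m\<close>, the steps from \<open>m\<close> to
  \<open>n\<close> spread \<open>(L n)^2\<close> at the scale \<open>\<beta> = (L m)^2 + r\<close>:
  given time \<open>m\<close>, its mean is at least \<open>(1 - a^2) * \<beta>\<close> and its
  second moment at most \<open>80 * \<beta>^2\<close>. Hence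
  \<open>(L n)^2 > theta * \<beta> \<ge> t\<close> with conditional probability at least
  \<open>kappa\<close>. The random \<open>\<beta>\<close> may be moved into the weight since it is
  determined at time \<open>m\<close>.\<close>

lemma escape:
  fixes f :: "'a \<Rightarrow> real"
  assumes f: "determined m f" "\<And>w. 0 \<le> f w" and m: "1 \<le> m" "m < n" and t: "t \<le> theta * (\<Sum>k=m..<n. inc k)"
  shows "E (\<lambda>w. f w * of_bool ((L n w)^2 \<le> t)) \<le> (1 - kappa) * E f"
proof -
  define r where "r = (\<Sum>k=m..<n. inc k)"
  define c where "c = 1 - a^2"
  define \<alpha> where "\<alpha> = c / 80"
  define \<beta> where "\<beta> w = (L m w)^2 + r" for w
  have c: "0 < c" "c \<le> 1" using a_sq_less by (auto simp: c_def)
  have r: "0 < r" unfolding r_def using m inc_pos by (intro sum_pos) auto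
  have \<beta>: "r \<le> \<beta> w" "0 < \<beta> w" for w using r by (auto simp: \<beta>_def add_nonneg_pos)
  have mn: "m \<le> n" using m by simp
  have d\<beta>: "determined m \<beta>" unfolding \<beta>_def by (intro det_intros det_L) simp
  have fn: "determined n f" and \<beta>n: "determined n \<beta>" by (rule det_mono[OF f(1) mn] det_mono[OF d\<beta> mn])+
  have dI: "determined n (\<lambda>w. of_bool ((L n w)^2 \<le> t) :: real)" by (intro det_indicator_le det_intros det_L) simp
  define f1 where "f1 w = f w / \<beta> w" for w
  define f2 where "f2 w = f w / (\<beta> w)^2" for w
  have df: "determined m f1" "determined m f2" unfolding f1_def f2_def by (intro det_intros f d\<beta>)+
  have f0: "0 \<le> f1 w" "0 \<le> f2 w" for w using f(2) \<beta>(2)[of w] by (auto simp: f1_def f2_def)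
  have dfn: "determined n f1" "determined n f2" by (rule det_mono[OF df(1) mn] det_mono[OF df(2) mn])+
  have E1: "c * E f \<le> E (\<lambda>w. f1 w * (L n w)^2)"
  proof -
    have "c * E f = E (\<lambda>w. c * (f1 w * \<beta> w))"
      using \<beta>(2) by (simp add: f1_def less_imp_neq[THEN not_sym])
    also have "... \<le> E (\<lambda>w. f1 w * (L m w)^2 + c * r * f1 w)"
    proof (rule expectation_mono[of m])
      fix w
      have "c * (f1 w * (L m w)^2) \<le> 1 * (f1 w * (L m w)^2)" using c f0 by (intro mult_right_mono) auto
      thus "c * (f1 w * \<beta> w) \<le> f1 w * (L m w)^2 + c * r * f1 w" by (simp add: \<beta>_def algebra_simps)
    qed (intro det_intros df d\<beta> det_L; simp)+
    also have "... = E (\<lambda>w. f1 w * (L m w)^2) + c * r * E f1"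
    proof -
      have "integrable M (\<lambda>w. f1 w * (L m w)^2)" "integrable M f1"
        by (rule integrable_determined[of m]; intro det_intros df det_L; simp)+
      thus ?thesis by simp
    qed
    also have "... \<le> E (\<lambda>w. f1 w * (L n w)^2)"
      using L_second_moment(1)[OF df(1) f0(1) m(1) mn] by (simp add: c_def r_def)
    finally show ?thesis .
  qed
  have E2: "E (\<lambda>w. f2 w * (L n w)^4) \<le> 80 * E f"
  proof -
    have "E (\<lambda>w. f2 w * (L n w)^4) \<le> 80 * E (\<lambda>w. f2 w * (\<beta> w)^2)"
      unfolding \<beta>_def r_def by (rule L_fourth_moment[OF df(2) f0(2) m(1) mn])
    also have "(\<lambda>w. f2 w * (\<beta> w)^2) = f"
      using \<beta>(2) by (intro ext) (simp add: f2_def less_imp_neq[THEN not_sym])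
    finally show ?thesis .
  qed
  \<comment> \<open>Paley--Zygmund in linear form: \<open>of_bool (x \<le> theta) \<le> 1 - (\<alpha> x - \<alpha>^2 x^2 / 4 - \<alpha> theta)\<close>
    for \<open>x = (L n)^2 / \<beta>\<close>, the quadratic on the right being at most \<open>1\<close>.\<close>
  have "E (\<lambda>w. f w * of_bool ((L n w)^2 \<le> t)) \<le>
     E (\<lambda>w. (1 + \<alpha> * theta) * f w + (- \<alpha> * (f1 w * (L n w)^2) + \<alpha>^2 / 4 * (f2 w * (L n w)^4)))"
  proof (rule expectation_mono[of n])
    fix w
    define x where "x = (L n w)^2 / \<beta> w"
    have x0: "0 \<le> x" using \<beta>(2)[of w] by (simp add: x_def)
    have \<alpha>0: "0 \<le> \<alpha>" using c by (simp add: \<alpha>_def)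
    have "of_bool ((L n w)^2 \<le> t) \<le> (1 + \<alpha> * theta) - \<alpha> * x + \<alpha>^2 / 4 * x^2"
    proof (cases "(L n w)^2 \<le> t")
      case True
      have "t \<le> theta * \<beta> w" using t \<beta>(1)[of w] theta_pos unfolding r_def
        by (meson order_trans mult_left_mono less_imp_le)
      hence "x \<le> theta" using True \<beta>(2)[of w] by (simp add: x_def divide_le_eq)
      hence "\<alpha> * x \<le> \<alpha> * theta" using \<alpha>0 by (intro mult_left_mono)
      moreover have "0 \<le> \<alpha>^2 / 4 * x^2" by simp
      ultimately have "1 \<le> (1 + \<alpha> * theta) - \<alpha> * x + \<alpha>^2 / 4 * x^2" by linarith
      thus ?thesis using True by simp
    next
      case False
      have "0 \<le> (\<alpha> * x / 2 - 1)^2" by simp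
      hence "0 \<le> 1 - \<alpha> * x + \<alpha>^2 / 4 * x^2" by (simp add: power2_diff power_mult_distrib power_divide)
      moreover have "0 \<le> \<alpha> * theta" using \<alpha>0 theta_pos by simp
      ultimately have "0 \<le> (1 + \<alpha> * theta) - \<alpha> * x + \<alpha>^2 / 4 * x^2" by linarith
      thus ?thesis using False by simp
    qed
    hence "f w * of_bool ((L n w)^2 \<le> t) \<le> f w * ((1 + \<alpha> * theta) - \<alpha> * x + \<alpha>^2 / 4 * x^2)"
      using f(2) by (intro mult_left_mono)
    moreover have "f1 w * (L n w)^2 = f w * x" by (simp add: f1_def x_def)
    moreover have "f2 w * (L n w)^4 = f w * x^2" by (simp add: f2_def x_def power_divide flip: power_mult)
    ultimately show "f w * of_bool ((L n w)^2 \<le> t) \<le>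
        (1 + \<alpha> * theta) * f w + (- \<alpha> * (f1 w * (L n w)^2) + \<alpha>^2 / 4 * (f2 w * (L n w)^4))"
      by (simp add: algebra_simps)
  next
    show "determined n (\<lambda>w. f w * of_bool ((L n w)^2 \<le> t))" by (intro det_intros fn dI)
  qed (intro det_intros fn dfn det_L; simp)
  also have "... = (1 + \<alpha> * theta) * E f + (- \<alpha> * E (\<lambda>w. f1 w * (L n w)^2) +
      \<alpha>^2 / 4 * E (\<lambda>w. f2 w * (L n w)^4))"
  proof -
    have i: "integrable M f" "integrable M (\<lambda>w. f1 w * (L n w)^2)" "integrable M (\<lambda>w. f2 w * (L n w)^4)"
      by (rule integrable_determined[of n]; intro det_intros fn dfn det_L; simp)+
    show ?thesis by (simp add: i Bochner_Integration.integral_add[OF _ Bochner_Integration.integrable_add])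
  qed
  also have "... \<le> (1 + \<alpha> * theta) * E f + (- \<alpha> * (c * E f) + \<alpha>^2 / 4 * (80 * E f))"
  proof (intro add_left_mono add_mono)
    show "- \<alpha> * E (\<lambda>w. f1 w * (L n w)^2) \<le> - \<alpha> * (c * E f)"
      using E1 c by (intro mult_left_mono_neg) (auto simp: \<alpha>_def)
    show "\<alpha>^2 / 4 * E (\<lambda>w. f2 w * (L n w)^4) \<le> \<alpha>^2 / 4 * (80 * E f)"
      using E2 by (intro mult_left_mono) auto
  qed
  also have "... = (1 - kappa) * E f"
  proof -
    have tk: "theta = c / 2" "kappa = c^2 / 320" by (simp_all add: theta_def kappa_def c_def)
    show ?thesis unfolding tk \<alpha>_def by (simp add: power2_eq_square field_simps)
  qed
  finally show ?thesis .
qed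

definition ball_prob :: "real \<Rightarrow> nat \<Rightarrow> real" where
  "ball_prob \<epsilon> n = E (\<lambda>w. of_bool ((L n w)^2 \<le> \<epsilon>))"

text \<open>If \<open>(L n)^2 \<le> t \<le> \<epsilon> / 4\<close>, then either
  \<open>(L m)^2 \<le> \<epsilon>\<close>, where \<open>escape\<close> gives the factor
  \<open>1 - kappa\<close>, or \<open>L\<close> has moved by at least half of
  \<open>sqrt \<epsilon>\<close> since time \<open>m\<close>, which has probability at most
  \<open>4 * rest m / \<epsilon>\<close> by Chebyshev's inequality.\<close>

lemma ball_prob_step:
  assumes \<epsilon>: "0 < \<epsilon>" and m: "1 \<le> m" "m < n" and t: "t \<le> theta * inc m" "t \<le> \<epsilon> / 4"
  shows "ball_prob t n \<le> (1 - kappa) * ball_prob \<epsilon> m + 4 * rest m / \<epsilon>"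
proof -
  have mn: "m \<le> n" using m by simp
  have d: "determined m (\<lambda>w. of_bool ((L m w)^2 \<le> \<epsilon>) :: real)" by (intro det_indicator_le det_intros det_L) simp
  have dn: "determined n (\<lambda>w. of_bool ((L n w)^2 \<le> t) :: real)" by (intro det_indicator_le det_intros det_L) simp
  have "ball_prob t n \<le> E (\<lambda>w. of_bool ((L m w)^2 \<le> \<epsilon>) * of_bool ((L n w)^2 \<le> t) + 4 / \<epsilon> * (L n w - L m w)^2)"
    unfolding ball_prob_def
  proof (rule expectation_mono[of n])
    fix w
    show "of_bool ((L n w)^2 \<le> t) \<le> of_bool ((L m w)^2 \<le> \<epsilon>) * of_bool ((L n w)^2 \<le> t) + 4 / \<epsilon> * (L n w - L m w)^2"
    proof (cases "(L n w)^2 \<le> t \<and> (L m w)^2 > \<epsilon>")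
      case True
      have "0 \<le> (L m w - 2 * L n w)^2" by simp
      hence "(L m w)^2 \<le> 2 * (L n w - L m w)^2 + 2 * (L n w)^2"
        by (simp add: power2_diff power_mult_distrib mult.commute)
      hence "\<epsilon> \<le> 4 * (L n w - L m w)^2" using True t(2) by linarith
      thus ?thesis using True \<epsilon> by (simp add: field_simps)
    qed (use \<epsilon> in auto)
  qed (intro det_intros dn det_mono[OF d] det_L; use mn in simp)+
  also have "... = E (\<lambda>w. of_bool ((L m w)^2 \<le> \<epsilon>) * of_bool ((L n w)^2 \<le> t)) + E (\<lambda>w. 4 / \<epsilon> * (L n w - L m w)^2)"
    by (rule expectation_add[of n];
        intro det_intros dn det_mono[OF d] det_L; use mn in simp)
  also have "... \<le> (1 - kappa) * ball_prob \<epsilon> m + 4 / \<epsilon> * rest m"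
  proof (rule add_mono)
    have "inc m \<le> (\<Sum>k=m..<n. inc k)" using m inc_pos by (intro member_le_sum) (auto simp: less_imp_le)
    from order_trans[OF t(1) mult_left_mono[OF this less_imp_le[OF theta_pos]]]
    show "E (\<lambda>w. of_bool ((L m w)^2 \<le> \<epsilon>) * of_bool ((L n w)^2 \<le> t)) \<le> (1 - kappa) * ball_prob \<epsilon> m"
      unfolding ball_prob_def by (intro escape[OF d _ m]) auto
    show "E (\<lambda>w. 4 / \<epsilon> * (L n w - L m w)^2) \<le> 4 / \<epsilon> * rest m"
      unfolding integral_mult_right_zero using \<epsilon> by (intro mult_left_mono expectation_L_diff_sq m mn) auto
  qed
  finally show ?thesis by simp
qed

text \<open>The limit of \<open>L n\<close> has no atom at \<open>0\<close>, expressed without the limit: the infimum \<open>g\<close> of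
  the asymptotic bounds on small-ball probabilities satisfies \<open>g \<le> (1 - kappa) * g\<close>.\<close>
lemma small_ball:
  assumes \<eta>: "0 < \<eta>"
  shows "\<exists>\<epsilon>>0. \<forall>\<^sub>F n in sequentially. ball_prob \<epsilon> n \<le> \<eta>"
proof -
  define G where "G = {\<eta>. \<exists>\<epsilon>>0. \<forall>\<^sub>F n in sequentially. ball_prob \<epsilon> n \<le> \<eta>}"
  have bp0: "0 \<le> ball_prob \<epsilon> n" for \<epsilon> n
    unfolding ball_prob_def by (rule expectation_nonneg) simp
  have bp1: "ball_prob \<epsilon> n \<le> 1" for \<epsilon> n
  proof -
    have "ball_prob \<epsilon> n \<le> E (\<lambda>_. 1)" unfolding ball_prob_def
      by (rule expectation_mono[of n]; (intro det_indicator_le det_intros det_L)?; simp add: of_bool_def)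
    thus ?thesis by (simp add: prob_space)
  qed
  have one: "1 \<in> G" unfolding G_def using bp1 by (auto intro!: exI[of _ 1])
  have lower: "0 \<le> g" if g: "g \<in> G" for g
  proof -
    obtain \<epsilon> where "\<forall>\<^sub>F n in sequentially. ball_prob \<epsilon> n \<le> g" using g unfolding G_def by blast
    then obtain n where "ball_prob \<epsilon> n \<le> g" by (auto simp: eventually_sequentially)
    thus ?thesis using bp0 order_trans by blast
  qed
  hence bdd: "bdd_below G" by (rule bdd_belowI)
  have improve: "(1 - kappa) * g + z \<in> G" if g: "g \<in> G" and z: "0 < z" for g z
  proof -
    obtain \<epsilon> where \<epsilon>: "\<epsilon> > 0" "\<forall>\<^sub>F n in sequentially. ball_prob \<epsilon> n \<le> g" using g unfolding G_def by blast
    have "(\<lambda>m. 4 * rest m / \<epsilon>) \<longlonglongrightarrow> 4 * 0 / \<epsilon>" by (intro tendsto_intros rest_tendsto_0) (use \<epsilon> in auto)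
    hence "\<forall>\<^sub>F m in sequentially. 4 * rest m / \<epsilon> < z" by (rule order_tendstoD) (use z in simp)
    with \<epsilon>(2) eventually_ge_at_top[of 1]
    have "\<forall>\<^sub>F m in sequentially. ball_prob \<epsilon> m \<le> g \<and> 4 * rest m / \<epsilon> < z \<and> 1 \<le> m" by eventually_elim auto
    then obtain m where m: "ball_prob \<epsilon> m \<le> g" "4 * rest m / \<epsilon> < z" "1 \<le> m" by (auto simp: eventually_sequentially)
    \<comment> \<open>\<open>m\<close> is fixed by now, so that \<open>t\<close> is a positive
      number serving all later \<open>n\<close>.\<close>
    define t where "t = min (theta * inc m) (\<epsilon> / 4)"
    have "t > 0" using theta_pos inc_pos \<epsilon> by (simp add: t_def)
    moreover have "\<forall>\<^sub>F n in sequentially. ball_prob t n \<le> (1 - kappa) * g + z"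
      using eventually_gt_at_top[of m]
    proof eventually_elim
      case (elim n)
      have "ball_prob t n \<le> (1 - kappa) * ball_prob \<epsilon> m + 4 * rest m / \<epsilon>"
        by (rule ball_prob_step) (use elim m \<epsilon> in \<open>auto simp: t_def\<close>)
      also have "... \<le> (1 - kappa) * g + z" using m kappa_less by (intro add_mono mult_left_mono) auto
      finally show ?case .
    qed
    ultimately show ?thesis unfolding G_def by blast
  qed
  have "Inf G = 0"
  proof (rule ccontr)
    assume "Inf G \<noteq> 0"
    moreover have "0 \<le> Inf G" using one lower by (intro cInf_greatest) auto
    ultimately have I: "0 < Inf G" by simp
    \<comment> \<open>Two errors of size \<open>z\<close> enter below, and the gain
      \<open>kappa * Inf G = 3 * z\<close> outweighs them.\<close>
    define z where "z = kappa * Inf G / 3"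
    have z: "0 < z" using I kappa_pos by (simp add: z_def)
    obtain g where g: "g \<in> G" "g < Inf G + z"
      using cInf_lessD[of G "Inf G + z"] one z by auto
    have "Inf G \<le> (1 - kappa) * g + z" by (intro cInf_lower improve g z bdd)
    also have "... \<le> (1 - kappa) * (Inf G + z) + z" using g kappa_less by (intro add_right_mono mult_left_mono) auto
    also have "... = Inf G + 2 * z - kappa * Inf G - kappa * z" by (simp add: algebra_simps)
    also have "kappa * Inf G = 3 * z" by (simp add: z_def)
    also have "Inf G + 2 * z - 3 * z - kappa * z = Inf G - (z + kappa * z)" by simp
    also have "... < Inf G" using z mult_pos_pos[OF kappa_pos z] by linarith
    finally show False by simp
  qed
  then obtain g where "g \<in> G" "g < \<eta>" using cInf_lessD[of G \<eta>] one \<eta> by auto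
  thus ?thesis unfolding G_def by (auto elim!: eventually_mono)
qed


section \<open>Replacing \<open>L\<close> by its value at a fixed time\<close>

lemma s_nonneg: "0 \<le> s n"
  unfolding s_def by (intro sum_nonneg) auto

lemma s_pos: "2 \<le> n \<Longrightarrow> 0 < s n"
proof -
  assume "2 \<le> n"
  hence "(h 1)^2 \<le> s n" unfolding s_def by (intro member_le_sum) auto
  thus ?thesis by (simp add: h_def gr_def)
qed

lemma expectation_Y_sq: "k \<ge> 1 \<Longrightarrow> E (\<lambda>w. (Y k w)^2) \<le> Lbound * (h k)^2"
  unfolding Y_eq power_mult_distrib integral_mult_right_zero
  using mult_left_mono[OF expectation_L_sq[of k], of "(h k)^2"] by (simp add: mult.commute)

lemma expectation_Z_sq: "E (\<lambda>w. (Z n w)^2) \<le> s n"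
proof -
  have "E (\<lambda>w. (Z n w)^2) \<le> (\<Sum>k=1..<n. E (\<lambda>w. (h k)^2))"
    unfolding Z_def by (rule martingale_sq_le) (auto intro: det_const)
  thus ?thesis by (simp add: s_def prob_space)
qed

lemma expectation_N_sq: "E (\<lambda>w. (N n w)^2) \<le> Lbound * s n"
proof -
  have "E (\<lambda>w. (N n w)^2) \<le> (\<Sum>k=1..<n. E (\<lambda>w. (Y k w)^2))"
    unfolding N_def by (rule martingale_sq_le) (auto intro: det_Y)
  also have "... \<le> (\<Sum>k=1..<n. Lbound * (h k)^2)" by (intro sum_mono expectation_Y_sq) auto
  finally show ?thesis by (simp add: s_def sum_distrib_left)
qed

lemma expectation_add_sq_le:
  fixes f g :: "'a \<Rightarrow> real"
  assumes "determined n f" "determined n g"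
  shows "E (\<lambda>w. (f w + g w)^2) \<le> 2 * E (\<lambda>w. (f w)^2) + 2 * E (\<lambda>w. (g w)^2)"
proof -
  have i: "integrable M (\<lambda>w. (f w)^2)" "integrable M (\<lambda>w. (g w)^2)"
    by (rule integrable_determined[of n]; intro det_intros assms)+
  have "E (\<lambda>w. (f w + g w)^2) \<le> E (\<lambda>w. 2 * (f w)^2 + 2 * (g w)^2)"
  proof (rule expectation_mono[of n])
    fix w
    have "0 \<le> (f w - g w)^2" by simp
    thus "(f w + g w)^2 \<le> 2 * (f w)^2 + 2 * (g w)^2" by (simp add: power2_sum power2_diff)
  qed (intro det_intros assms)+
  thus ?thesis using i by simp
qed

text \<open>The terms before \<open>m\<close> are bounded crudely, by \<open>2 * Lbound\<close>
  each. From \<open>m\<close> on, \<open>(L k)^2 - (L m)^2\<close> is factored, and Cauchy-Schwarz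
  uses that \<open>L k - L m\<close> has mean square at most \<open>rest m\<close>.\<close>

lemma expectation_W_approx:
  assumes m: "1 \<le> m" and n: "m \<le> n"
  shows "E (\<lambda>w. \<bar>W n w - (L m w)^2 * s n\<bar>) \<le> 2 * Lbound * m + 2 * sqrt (Lbound * rest m) * s n"
proof -
  have B: "0 \<le> Lbound" using Lbound_ge by simp
  have dW: "determined n (W n)" by (rule det_W) simp
  have L0: "E (\<lambda>w. \<bar>(L k w)^2 - (L m w)^2\<bar>) \<le> 2 * Lbound" if "1 \<le> k" for k
  proof -
    have i: "integrable M (\<lambda>w. (L k w)^2)" "integrable M (\<lambda>w. (L m w)^2)"
      by (rule integrable_determined[of "max k m"]; intro det_intros det_L; simp)+
    have "E (\<lambda>w. \<bar>(L k w)^2 - (L m w)^2\<bar>) \<le> E (\<lambda>w. (L k w)^2 + (L m w)^2)"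
    proof (rule expectation_mono[of "max k m"])
      fix w
      have "0 \<le> (L k w)^2" "0 \<le> (L m w)^2" by auto
      thus "\<bar>(L k w)^2 - (L m w)^2\<bar> \<le> (L k w)^2 + (L m w)^2" by linarith
    qed (intro det_intros det_L; simp)+
    also have "... \<le> Lbound + Lbound" using expectation_L_sq[OF that] expectation_L_sq[OF m] i by simp
    finally show ?thesis by simp
  qed
  have L1: "E (\<lambda>w. \<bar>(L k w)^2 - (L m w)^2\<bar>) \<le> 2 * sqrt (Lbound * rest m)" if k: "m \<le> k" for k
  proof -
    have d: "determined k (\<lambda>w. L k w - L m w)" "determined k (\<lambda>w. L k w + L m w)"
      by (intro det_intros det_L; use k in simp)+
    have dL: "determined k (L k)" "determined k (L m)" using k by (auto intro: det_L)
    have "E (\<lambda>w. \<bar>(L k w)^2 - (L m w)^2\<bar>) = E (\<lambda>w. \<bar>(L k w - L m w) * (L k w + L m w)\<bar>)"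
      by (simp add: power2_eq_square algebra_simps)
    also have "... \<le> sqrt (E (\<lambda>w. (L k w - L m w)^2)) * sqrt (E (\<lambda>w. (L k w + L m w)^2))"
      by (rule Cauchy_Schwarz_determined[OF d])
    also have "... \<le> sqrt (rest m) * sqrt (4 * Lbound)"
    proof (intro mult_mono real_sqrt_le_mono)
      show "E (\<lambda>w. (L k w - L m w)^2) \<le> rest m" by (rule expectation_L_diff_sq[OF m k])
      show "E (\<lambda>w. (L k w + L m w)^2) \<le> 4 * Lbound"
        using expectation_add_sq_le[OF dL] expectation_L_sq[of k] expectation_L_sq[OF m] m k by simp
    qed (auto intro: expectation_nonneg rest_nonneg)
    also have "... = 2 * sqrt (Lbound * rest m)" by (simp add: real_sqrt_mult)
    finally show ?thesis .
  qed
  have "E (\<lambda>w. \<bar>W n w - (L m w)^2 * s n\<bar>) \<le>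
     E (\<lambda>w. \<Sum>k=1..<n. (h k)^2 * \<bar>(L k w)^2 - (L m w)^2\<bar>)"
  proof (rule expectation_mono[of n])
    fix w
    have "W n w - (L m w)^2 * s n = (\<Sum>k=1..<n. (h k)^2 * ((L k w)^2 - (L m w)^2))"
      by (simp add: W_def s_def Y_eq power_mult_distrib sum_distrib_left sum_subtractf[symmetric] algebra_simps)
    also have "\<bar>...\<bar> \<le> (\<Sum>k=1..<n. \<bar>(h k)^2 * ((L k w)^2 - (L m w)^2)\<bar>)" by (rule sum_abs)
    finally show "\<bar>W n w - (L m w)^2 * s n\<bar> \<le> (\<Sum>k=1..<n. (h k)^2 * \<bar>(L k w)^2 - (L m w)^2\<bar>)"
      by (simp add: abs_mult)
  qed (intro det_intros dW det_L; use n in auto)+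
  also have "... = (\<Sum>k=1..<n. (h k)^2 * E (\<lambda>w. \<bar>(L k w)^2 - (L m w)^2\<bar>))"
    using n by (subst Bochner_Integration.integral_sum) (auto intro!: integrable_determined[of n] det_intros det_L)
  also have "... \<le> (\<Sum>k=1..<n. (if k < m then 2 * Lbound else 0) + 2 * sqrt (Lbound * rest m) * (h k)^2)"
  proof (intro sum_mono)
    fix k assume k: "k \<in> {1..<n}"
    have h1: "(h k)^2 \<le> 1" using h_le_1[of k] h_nonneg[of k] by (simp add: abs_square_le_1)
    have q: "0 \<le> 2 * sqrt (Lbound * rest m) * (h k)^2" using B rest_nonneg by simp
    show "(h k)^2 * E (\<lambda>w. \<bar>(L k w)^2 - (L m w)^2\<bar>) \<le> (if k < m then 2 * Lbound else 0) + 2 * sqrt (Lbound * rest m) * (h k)^2"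
    proof (cases "k < m")
      case True
      have "(h k)^2 * E (\<lambda>w. \<bar>(L k w)^2 - (L m w)^2\<bar>) \<le> 1 * (2 * Lbound)"
        using h1 L0[of k] k by (intro mult_mono) (auto intro: expectation_nonneg)
      thus ?thesis using True q by simp
    next
      case False
      thus ?thesis using mult_left_mono[OF L1[of k], of "(h k)^2"] by (simp add: mult_ac)
    qed
  qed
  also have "... = 2 * Lbound * card ({1..<n} \<inter> {k. k < m}) + 2 * sqrt (Lbound * rest m) * s n"
    by (simp add: sum.distrib sum.If_cases s_def sum_distrib_left)
  also have "real (card ({1..<n} \<inter> {k. k < m})) \<le> m"
  proof -
    have "card ({1..<n} \<inter> {k. k < m}) \<le> card {..<m}" by (intro card_mono) auto
    thus ?thesis by simp
  qed
  finally show ?thesis using B by (simp add: mult_left_mono)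
qed

lemma expectation_N_approx:
  assumes m: "1 \<le> m" and n: "m \<le> n"
  shows "E (\<lambda>w. (N n w - L m w * Z n w)^2) \<le> 32 * real m ^ 4 + 2 * rest m * s n"
proof -
  define P1 where "P1 w = (\<Sum>k=1..<m. h k * (L k w - L m w) * xi k w)" for w
  define P2 where "P2 w = (\<Sum>k=m..<n. h k * (L k w - L m w) * xi k w)" for w
  have d: "determined n P1" "determined n P2" unfolding P1_def P2_def by (intro det_intros det_L; use n in auto)+
  have "N n w - L m w * Z n w = P1 w + P2 w" for w
  proof -
    have "N n w - L m w * Z n w = (\<Sum>k=1..<n. h k * (L k w - L m w) * xi k w)"
      by (simp add: N_def Z_def Y_eq sum_distrib_left sum_subtractf[symmetric] algebra_simps)
    also have "... = P1 w + P2 w" unfolding P1_def P2_def by (rule sum.atLeastLessThan_concat[symmetric]; use m n in simp)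
    finally show ?thesis .
  qed
  hence "E (\<lambda>w. (N n w - L m w * Z n w)^2) = E (\<lambda>w. (P1 w + P2 w)^2)" by simp
  also have "... \<le> 2 * E (\<lambda>w. (P1 w)^2) + 2 * E (\<lambda>w. (P2 w)^2)"
    by (rule expectation_add_sq_le[OF d])
  also have "E (\<lambda>w. (P1 w)^2) \<le> 16 * real m ^ 4"
  proof -
    have absL: "\<bar>L k w\<bar> \<le> m" if "k \<le> m" for k w
    proof -
      have "\<bar>L k w\<bar> \<le> \<bar>S k w\<bar> / 1" unfolding L_def abs_divide
        using gr_ge_1[of k] by (intro divide_left_mono) auto
      thus ?thesis using abs_S_le[of k w] that by simp
    qed
    have "\<bar>P1 w\<bar> \<le> 4 * real m ^ 2" for w
    proof -
      have "\<bar>P1 w\<bar> \<le> (\<Sum>k=1..<m. \<bar>h k * (L k w - L m w) * xi k w\<bar>)" unfolding P1_def by (rule sum_abs)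
      also have "... \<le> (\<Sum>k=1..<m. 1 * (real m + real m) * 2)"
      proof (intro sum_mono)
        fix k assume "k \<in> {1..<m}"
        hence "\<bar>L k w - L m w\<bar> \<le> real m + real m" using absL[of k w] absL[of m w] by simp
        thus "\<bar>h k * (L k w - L m w) * xi k w\<bar> \<le> 1 * (real m + real m) * 2"
          unfolding abs_mult using h_nonneg[of k] h_le_1[of k] abs_xi_le[of k w] by (intro mult_mono) auto
      qed
      also have "... = 4 * real m * real (m - 1)" by simp
      also have "... \<le> 4 * real m * real m" by (intro mult_left_mono) auto
      finally show ?thesis by (simp add: power2_eq_square)
    qed
    hence P: "(P1 w)^2 \<le> (4 * real m ^ 2)^2" for w by (metis abs_ge_zero power2_abs power_mono)
    have "E (\<lambda>w. (P1 w)^2) \<le> E (\<lambda>w. (4 * real m ^ 2)^2)"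
      by (rule expectation_mono[of n]; (rule P)?; intro det_intros d)
    thus ?thesis by (simp add: prob_space power_mult_distrib flip: power_mult)
  qed
  also have "E (\<lambda>w. (P2 w)^2) \<le> rest m * s n"
  proof -
    have "E (\<lambda>w. (P2 w)^2) \<le> (\<Sum>k=m..<n. E (\<lambda>w. (h k * (L k w - L m w))^2))"
      unfolding P2_def by (rule martingale_sq_le[OF m]) (intro det_intros det_L; simp)
    also have "... \<le> (\<Sum>k=m..<n. (h k)^2 * rest m)"
      unfolding power_mult_distrib integral_mult_right_zero using m
      by (intro sum_mono mult_left_mono expectation_L_diff_sq) auto
    also have "... \<le> (\<Sum>k=1..<n. (h k)^2 * rest m)" using m rest_nonneg by (intro sum_mono2) auto
    finally show ?thesis by (simp add: s_def sum_distrib_left mult.commute)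
  qed
  finally show ?thesis by simp
qed

text \<open>The difference of squares is \<open>f * g\<close> with \<open>g = 2 N - f\<close>, so
  the mean square of \<open>g\<close> is controlled without a bound on the product
  \<open>L m * Z n\<close>.\<close>

lemma expectation_sq_approx:
  assumes m: "1 \<le> m" and n: "m \<le> n" "2 \<le> n"
  defines "D \<equiv> 32 * real m ^ 4 / s n + 2 * rest m"
  shows "E (\<lambda>w. \<bar>(N n w)^2 / s n - (L m w)^2 * ((Z n w)^2 / s n)\<bar>) \<le> sqrt D * sqrt (8 * Lbound + 2 * D)"
proof -
  have s: "0 < s n" by (rule s_pos[OF n(2)])
  define f where "f w = N n w - L m w * Z n w" for w
  define g where "g w = N n w + L m w * Z n w" for w
  have dN: "determined n (N n)" by (rule det_N) simp
  have d: "determined n f" "determined n g" unfolding f_def g_def by (intro det_intros dN det_L det_Z; use n in simp)+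
  have d2: "determined n (\<lambda>w. 2 * N n w)" "determined n (\<lambda>w. - f w)" by (intro det_intros dN d)+
  have Ef: "E (\<lambda>w. (f w)^2) \<le> s n * D"
    using expectation_N_approx[OF m n(1)] s by (simp add: D_def f_def algebra_simps)
  have "E (\<lambda>w. (g w)^2) = E (\<lambda>w. (2 * N n w + - f w)^2)" by (simp add: f_def g_def)
  also have "... \<le> 2 * E (\<lambda>w. (2 * N n w)^2) + 2 * E (\<lambda>w. (- f w)^2)"
    by (rule expectation_add_sq_le[OF d2])
  also have "... \<le> s n * (8 * Lbound + 2 * D)"
    using Ef expectation_N_sq[of n] by (simp add: power_mult_distrib algebra_simps)
  finally have Eg: "E (\<lambda>w. (g w)^2) \<le> s n * (8 * Lbound + 2 * D)" .
  have D0: "0 \<le> D" unfolding D_def using s rest_nonneg by simp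
  have eq: "\<bar>(N n w)^2 / s n - (L m w)^2 * ((Z n w)^2 / s n)\<bar> = \<bar>f w * g w\<bar> / s n" for w
  proof -
    have "(N n w)^2 / s n - (L m w)^2 * ((Z n w)^2 / s n) = f w * g w / s n"
      by (simp add: f_def g_def power2_eq_square diff_divide_distrib[symmetric] algebra_simps)
    thus ?thesis using s by (simp add: abs_divide)
  qed
  have "E (\<lambda>w. \<bar>f w * g w\<bar>) \<le> sqrt (E (\<lambda>w. (f w)^2)) * sqrt (E (\<lambda>w. (g w)^2))"
    by (rule Cauchy_Schwarz_determined[OF d])
  also have "... \<le> sqrt (s n * D) * sqrt (s n * (8 * Lbound + 2 * D))"
    using Ef Eg D0 s by (intro mult_mono real_sqrt_le_mono) (auto intro: expectation_nonneg)
  also have "... = s n * (sqrt D * sqrt (8 * Lbound + 2 * D))" using s by (simp add: real_sqrt_mult)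
  finally have "E (\<lambda>w. \<bar>f w * g w\<bar>) / s n \<le> sqrt D * sqrt (8 * Lbound + 2 * D)"
    using s by (simp add: field_simps)
  thus ?thesis unfolding eq by simp
qed

text \<open>The weights are deterministic and, from \<open>n = 2\<close> on, their squares sum to
  exactly 1. The condition on \<open>Y\<close> becomes an average of multiples of
  \<open>(h k)^2\<close> with weights \<open>(h k)^2\<close>, and \<open>h\<close> tends to
  zero.\<close>

lemma Z_clt:
  "(\<lambda>n. E (\<lambda>w. iexp (t * (Z n w / sqrt (s n))))) \<longlonglongrightarrow> of_real (exp (- (t^2) / 2))"
proof -
  have H2: "(\<Sum>k=1..<n. (h k / sqrt (s n))^2) = s n / s n" for n
  proof -
    have "(\<Sum>k=1..<n. (h k / sqrt (s n))^2) = (\<Sum>k=1..<n. (h k)^2) / s n"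
      unfolding sum_divide_distrib using s_nonneg[of n] by (simp add: power_divide)
    thus ?thesis by (simp add: s_def)
  qed
  have "(\<lambda>n. E (\<lambda>w. iexp (t * (\<Sum>k=1..<n. h k / sqrt (s n) * xi k w)))) \<longlonglongrightarrow> of_real (exp (- (t^2) / 2))"
  proof (rule martingale_clt[where H="\<lambda>n k w. h k / sqrt (s n)" and e="\<lambda>n. 1 / sqrt (s n)" and C=1])
    show "\<bar>h k / sqrt (s n)\<bar> \<le> 1 / sqrt (s n)" for n k
      using h_nonneg[of k] h_le_1[of k] s_nonneg[of n] by (simp add: abs_divide divide_right_mono)
    show "(\<lambda>n. 1 / sqrt (s n)) \<longlonglongrightarrow> 0"
      by (rule tendsto_divide_0[OF tendsto_const])
         (rule filterlim_at_top_imp_at_infinity[OF filterlim_compose[OF sqrt_at_top s_at_top]])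
    show "(\<Sum>k=1..<n. (h k / sqrt (s n))^2) \<le> 1" for n unfolding H2 by simp
    show "(\<lambda>n. E (\<lambda>w. \<bar>(\<Sum>k=1..<n. (h k / sqrt (s n))^2) - 1\<bar>)) \<longlonglongrightarrow> 0"
    proof (rule tendsto_eventually)
      show "\<forall>\<^sub>F n in sequentially. E (\<lambda>w. \<bar>(\<Sum>k=1..<n. (h k / sqrt (s n))^2) - 1\<bar>) = 0"
        using eventually_ge_at_top[of 2]
      proof eventually_elim
        case (elim n)
        show ?case using s_pos[OF elim] unfolding H2 by simp
      qed
    qed
    show "(\<lambda>n. \<Sum>k=1..<n. E (\<lambda>w. (h k / sqrt (s n))^2 * (Y k w)^2)) \<longlonglongrightarrow> 0"
    proof (rule Lim_null_comparison)
      have "(\<lambda>k. Lbound * (h k)^2) \<longlonglongrightarrow> Lbound * 0^2" by (intro tendsto_intros h_tendsto_0)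
      thus "(\<lambda>n. (\<Sum>k=1..<n. (h k)^2 * (Lbound * (h k)^2)) / (\<Sum>k=1..<n. (h k)^2)) \<longlonglongrightarrow> 0"
        using s_at_top Lbound_ge by (intro weighted_average_null) (auto simp: s_def[abs_def])
      show "\<forall>\<^sub>F n in sequentially. norm (\<Sum>k=1..<n. E (\<lambda>w. (h k / sqrt (s n))^2 * (Y k w)^2)) \<le>
         (\<Sum>k=1..<n. (h k)^2 * (Lbound * (h k)^2)) / (\<Sum>k=1..<n. (h k)^2)"
      proof (intro always_eventually allI)
        fix n
        have "(\<Sum>k=1..<n. E (\<lambda>w. (h k / sqrt (s n))^2 * (Y k w)^2)) =
           (\<Sum>k=1..<n. (h k)^2 * E (\<lambda>w. (Y k w)^2)) / s n"
          using s_nonneg[of n] by (simp add: power_divide sum_divide_distrib)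
        also have "... \<le> (\<Sum>k=1..<n. (h k)^2 * (Lbound * (h k)^2)) / s n"
          using s_nonneg by (intro divide_right_mono sum_mono mult_left_mono expectation_Y_sq) auto
        finally show "norm (\<Sum>k=1..<n. E (\<lambda>w. (h k / sqrt (s n))^2 * (Y k w)^2)) \<le>
         (\<Sum>k=1..<n. (h k)^2 * (Lbound * (h k)^2)) / (\<Sum>k=1..<n. (h k)^2)"
          by (simp add: s_def sum_nonneg expectation_nonneg)
      qed
    qed
  qed (auto intro: det_const)
  thus ?thesis unfolding Z_def by (simp only: sum_divide_distrib times_divide_eq_left)
qed

text \<open>With \<open>m\<close> fixed and large, \<open>N n\<close> is close to \<open>L m * Z n\<close> and \<open>W n\<close> to \<open>(L m)\<^sup>2 * s n\<close>, so that \<open>L m\<close> cancels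
  in \<open>(N n)\<^sup>2 / W n\<close>; in particular its sign plays no role.\<close>

theorem chi_square_superdiffusive:
  "weak_conv_m (\<lambda>n. distr M borel (\<lambda>w. (N n w)^2 / W n w)) (chi_square_distribution 1)"
proof (rule weak_conv_chi_square[where U="\<lambda>n w. Z n w / sqrt (s n)", OF _ _ Z_clt])
  have dN: "determined n (N n)" and dW: "determined n (W n)" and dZ: "determined n (Z n)" for n
    by (intro det_N det_W det_Z; simp)+
  show "(\<lambda>w. Z n w / sqrt (s n)) \<in> borel_measurable M" for n
    by (rule borel_measurable_determined[of n]) (intro det_intros dZ)
  show "(\<lambda>w. (N n w)^2 / W n w) \<in> borel_measurable M" for n
    by (rule borel_measurable_determined[of n]) (intro det_intros dN dW)
  define u where "u n w = (Z n w)^2 / s n" for n w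
  have u_eq: "(Z n w / sqrt (s n))^2 = u n w" for n w
    using s_nonneg[of n] by (simp add: u_def power_divide)
  have du: "determined n (u n)" for n unfolding u_def by (intro det_intros dZ)
  define x where "x n = E (\<lambda>w. min 1 \<bar>(N n w)^2 / W n w - u n w\<bar>)" for n
  have x0: "0 \<le> x n" for n unfolding x_def by (rule expectation_nonneg) simp
  define D where "D m n = 32 * real m ^ 4 / s n + 2 * rest m" for m n
  define F1 where "F1 m n = sqrt (D m n) * sqrt (8 * Lbound + 2 * D m n)" for m n
  define F2 where "F2 m n = (2 * Lbound * m) / s n + 2 * sqrt (Lbound * rest m)" for m n
  have bound: "x n \<le> ball_prob (2 * \<epsilon>) m + (F1 m n + (K + 1) * F2 m n) / \<epsilon> + 1 / K"
    if \<epsilon>: "0 < \<epsilon>" and K: "0 < K" and m: "1 \<le> m" and n: "m \<le> n" "2 \<le> n" for \<epsilon> K m n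
  proof -
    have s: "0 < s n" by (rule s_pos[OF n(2)])
    define T1 where "T1 w = \<bar>(N n w)^2 / s n - (L m w)^2 * u n w\<bar>" for w
    define T2 where "T2 w = \<bar>W n w - (L m w)^2 * s n\<bar> / s n" for w
    define I where "I w = (of_bool ((L m w)^2 \<le> 2 * \<epsilon>) :: real)" for w
    have d: "determined n T1" "determined n T2" "determined n I"
      unfolding T1_def T2_def I_def by (intro det_indicator_le det_intros du dW dN det_L; use n in simp)+
    have ET1: "E T1 \<le> F1 m n"
      unfolding T1_def F1_def D_def u_def by (rule expectation_sq_approx[OF m n])
    have ET2: "E T2 \<le> F2 m n"
      using expectation_W_approx[OF m n(1)] s unfolding T2_def F2_def by (simp add: field_simps)
    have "E (u n) = E (\<lambda>w. (Z n w)^2) / s n" by (simp add: u_def[abs_def])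
    hence Eu: "E (u n) \<le> 1" using expectation_Z_sq[of n] s by simp
    have "x n \<le> E (\<lambda>w. I w + ((1 / \<epsilon> * T1 w + (K + 1) / \<epsilon> * T2 w) + 1 / K * u n w))"
      unfolding x_def
    proof (rule expectation_mono[of n])
      fix w
      have u0: "0 \<le> u n w" using s by (simp add: u_def)
      have T0: "0 \<le> T1 w" "0 \<le> T2 w" using s by (auto simp: T1_def T2_def)
      have I0: "0 \<le> I w" by (simp add: I_def)
      define r where "r = W n w / s n"
      have T2w: "T2 w = \<bar>r - (L m w)^2\<bar>"
      proof -
        have "T2 w = \<bar>(W n w - (L m w)^2 * s n) / s n\<bar>" using s by (simp add: T2_def abs_divide)
        also have "(W n w - (L m w)^2 * s n) / s n = r - (L m w)^2" using s by (simp add: r_def diff_divide_distrib)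
        finally show ?thesis .
      qed
      have split: "(K + 1) / \<epsilon> * T2 w = K / \<epsilon> * T2 w + T2 w / \<epsilon>" by (simp add: add_divide_distrib algebra_simps)
      have nn: "0 \<le> 1 / \<epsilon> * T1 w" "0 \<le> K / \<epsilon> * T2 w" "0 \<le> T2 w / \<epsilon>" "0 \<le> 1 / K * u n w"
        using \<epsilon> K T0 u0 by auto
      \<comment> \<open>A large \<open>u\<close> is paid for by \<open>u / K\<close>. If
        \<open>W / s < \<epsilon>\<close>, then either \<open>L m\<close> lies in the small ball or
        \<open>T2 \<ge> \<epsilon>\<close>. In the remaining case
        \<open>W / s \<ge> \<epsilon>\<close> makes the division safe.\<close>
      consider "K \<le> u n w" | "r < \<epsilon>" | "u n w < K" "\<epsilon> \<le> r" by linarith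
      thus "min 1 \<bar>(N n w)^2 / W n w - u n w\<bar> \<le> I w + ((1 / \<epsilon> * T1 w + (K + 1) / \<epsilon> * T2 w) + 1 / K * u n w)"
      proof cases
        case 1
        hence "1 \<le> 1 / K * u n w" using K by simp
        thus ?thesis using nn I0 unfolding split by linarith
      next
        case 2
        have "1 \<le> I w + T2 w / \<epsilon>"
        proof (cases "(L m w)^2 \<le> 2 * \<epsilon>")
          case False
          hence "\<epsilon> \<le> T2 w" using 2 unfolding T2w by linarith
          hence "1 \<le> T2 w / \<epsilon>" using \<epsilon> by simp
          thus ?thesis using I0 by linarith
        qed (use nn in \<open>simp add: I_def\<close>)
        thus ?thesis using nn unfolding split by linarith
      next
        case 3
        have r: "0 < r" using 3 \<epsilon> by simp
        have "(N n w)^2 / W n w = ((N n w)^2 / s n) / r" using s by (simp add: r_def)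
        hence "(N n w)^2 / W n w - u n w = (((N n w)^2 / s n - (L m w)^2 * u n w) + ((L m w)^2 - r) * u n w) / r"
          using r by (simp add: field_simps)
        hence "\<bar>(N n w)^2 / W n w - u n w\<bar> = \<bar>((N n w)^2 / s n - (L m w)^2 * u n w) + ((L m w)^2 - r) * u n w\<bar> / r"
          using r by (simp add: abs_divide)
        also have "... \<le> (T1 w + T2 w * u n w) / r"
          unfolding T1_def T2w using r u0
          by (intro divide_right_mono order_trans[OF abs_triangle_ineq]) (auto simp: abs_mult abs_minus_commute)
        also have "... \<le> (T1 w + T2 w * K) / \<epsilon>"
          using 3 r \<epsilon> T0 u0 by (intro frac_le add_mono mult_left_mono) auto
        also have "... = 1 / \<epsilon> * T1 w + K / \<epsilon> * T2 w" by (simp add: add_divide_distrib mult.commute)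
        finally show ?thesis using nn I0 unfolding split by linarith
      qed
    next
      show "determined n (\<lambda>w. min 1 \<bar>(N n w)^2 / W n w - u n w\<bar>)"
        by (rule det_comp[where F="min 1"]) (intro det_intros dN dW du)
    qed (intro det_intros d du)
    also have "... = E I + ((1 / \<epsilon> * E T1 + (K + 1) / \<epsilon> * E T2) + 1 / K * E (u n))"
    proof -
      have i: "integrable M I" "integrable M T1" "integrable M T2" "integrable M (u n)"
        by (rule integrable_determined[of n]; intro d du)+
      show ?thesis
        using i by (simp add: Bochner_Integration.integral_add)
    qed
    also have "... \<le> ball_prob (2 * \<epsilon>) m + ((1 / \<epsilon> * F1 m n + (K + 1) / \<epsilon> * F2 m n) + 1 / K * 1)"
      using ET1 ET2 Eu \<epsilon> K unfolding I_def ball_prob_def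
      by (intro add_mono mult_left_mono order_refl) auto
    also have "1 / \<epsilon> * F1 m n + (K + 1) / \<epsilon> * F2 m n = (F1 m n + (K + 1) * F2 m n) / \<epsilon>"
      by (simp add: add_divide_distrib distrib_right)
    finally show ?thesis by simp
  qed
  have "x \<longlonglongrightarrow> 0"
  proof (rule order_tendstoI)
    fix \<eta> :: real assume \<eta>: "0 < \<eta>"
    obtain e where e: "e > 0" "\<forall>\<^sub>F n in sequentially. ball_prob e n \<le> \<eta> / 4"
      using small_ball[of "\<eta> / 4"] \<eta> by auto
    define \<epsilon> where "\<epsilon> = e / 2"
    define K where "K = 4 / \<eta>"
    have eK: "0 < \<epsilon>" "0 < K" "1 / K = \<eta> / 4" "2 * \<epsilon> = e" using e \<eta> by (auto simp: \<epsilon>_def K_def)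
    \<comment> \<open>\<open>lim m\<close> is the limit over \<open>n\<close> of the approximation
      error in \<open>bound\<close>. The order of choices is: the radius from
      \<open>small_ball\<close> and the level \<open>K\<close>, then the freezing time
      \<open>m\<close>, and finally \<open>n\<close>.\<close>
    define lim where "lim m = (sqrt (2 * rest m) * sqrt (8 * Lbound + 2 * (2 * rest m)) + (K + 1) * (2 * sqrt (Lbound * rest m))) / \<epsilon>" for m
    have "lim \<longlonglongrightarrow> (sqrt (2 * 0) * sqrt (8 * Lbound + 2 * (2 * 0)) + (K + 1) * (2 * sqrt (Lbound * 0))) / \<epsilon>"
      unfolding lim_def using eK by (intro tendsto_intros rest_tendsto_0) auto
    hence "lim \<longlonglongrightarrow> 0" by simp
    hence "\<forall>\<^sub>F m in sequentially. lim m < \<eta> / 4" by (rule order_tendstoD) (use \<eta> in simp)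
    with e(2) eventually_ge_at_top[of 1]
    have "\<forall>\<^sub>F m in sequentially. ball_prob e m \<le> \<eta> / 4 \<and> lim m < \<eta> / 4 \<and> 1 \<le> m" by eventually_elim auto
    then obtain m where m: "ball_prob e m \<le> \<eta> / 4" "lim m < \<eta> / 4" "1 \<le> m" by (auto simp: eventually_sequentially)
    have inv: "(\<lambda>n. c / s n) \<longlonglongrightarrow> 0" for c
      by (rule tendsto_divide_0[OF tendsto_const]) (rule filterlim_at_top_imp_at_infinity[OF s_at_top])
    have "(\<lambda>n. D m n) \<longlonglongrightarrow> 0 + 2 * rest m" unfolding D_def by (intro tendsto_intros inv)
    hence D: "(\<lambda>n. D m n) \<longlonglongrightarrow> 2 * rest m" by simp
    have F2: "(\<lambda>n. F2 m n) \<longlonglongrightarrow> 0 + 2 * sqrt (Lbound * rest m)" unfolding F2_def by (intro tendsto_intros inv)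
    have "(\<lambda>n. (F1 m n + (K + 1) * F2 m n) / \<epsilon>) \<longlonglongrightarrow>
       (sqrt (2 * rest m) * sqrt (8 * Lbound + 2 * (2 * rest m)) + (K + 1) * (0 + 2 * sqrt (Lbound * rest m))) / \<epsilon>"
      unfolding F1_def using eK by (intro tendsto_intros D F2) auto
    hence "(\<lambda>n. (F1 m n + (K + 1) * F2 m n) / \<epsilon>) \<longlonglongrightarrow> lim m" by (simp add: lim_def)
    hence "\<forall>\<^sub>F n in sequentially. (F1 m n + (K + 1) * F2 m n) / \<epsilon> < \<eta> / 4" by (rule order_tendstoD) (rule m(2))
    with eventually_ge_at_top[of m] eventually_ge_at_top[of 2] show "\<forall>\<^sub>F n in sequentially. x n < \<eta>"
    proof eventually_elim
      case (elim n)
      thus ?case using bound[OF eK(1,2) m(3) elim(1,2)] m(1) \<eta> unfolding eK(3,4) by linarith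
    qed
  next
    fix \<eta> :: real assume "\<eta> < 0"
    thus "\<forall>\<^sub>F n in sequentially. \<eta> < x n" by (intro always_eventually allI less_le_trans[OF _ x0])
  qed
  thus "(\<lambda>n. E (\<lambda>w. min 1 \<bar>(N n w)^2 / W n w - (Z n w / sqrt (s n))^2\<bar>)) \<longlonglongrightarrow> 0"
    unfolding u_eq x_def .
qed

end

subsection \<open>The elephant random walk\<close>

context elephant_random_walk begin

text \<open>Modifies the steps on a null set, in order that they take the values \<open>\<plusminus>1\<close> everywhere.\<close>

definition X' :: "nat \<Rightarrow> 'a \<Rightarrow> real" where "X' n w = (if X n w = 1 then 1 else -1)"

lemma X'_measurable: "n \<ge> 1 \<Longrightarrow> X' n \<in> borel_measurable M"
  using X_measurable[of n] unfolding X'_def[abs_def] by measurable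

section \<open>Law and independence of the remembered index\<close>

lemma K_measurable: "n \<ge> 1 \<Longrightarrow> K n \<in> M \<rightarrow>\<^sub>M count_space UNIV"
  and B_measurable: "n \<ge> 1 \<Longrightarrow> B n \<in> M \<rightarrow>\<^sub>M count_space UNIV"
proof -
  assume n: "n \<ge> 1"
  show "K n \<in> M \<rightarrow>\<^sub>M count_space UNIV"
    using measurable_compose[OF KB_measurable[OF n], of fst "count_space UNIV"] by simp
  show "B n \<in> M \<rightarrow>\<^sub>M count_space UNIV"
    using measurable_compose[OF KB_measurable[OF n], of snd "count_space UNIV"] by simp
qed

lemma prob_KB:
  assumes n: "n \<ge> 1" and k: "k \<in> {1..n}"
  shows "prob {w \<in> space M. K n w = k \<and> B n w = b} = (if b then p else 1 - p) / n"
proof -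
  have "prob {w \<in> space M. K n w = k \<and> B n w = b} =
      measure (distr M (count_space UNIV) (\<lambda>w. (K n w, B n w))) {(k, b)}"
    using KB_measurable[OF n] by (subst measure_distr) (auto intro!: arg_cong[where f=prob])
  also have "... = pmf (pair_pmf (pmf_of_set {1..n}) (bernoulli_pmf p)) (k, b)"
    unfolding KB_law[OF n] by (simp add: measure_pmf_single)
  also have "... = (if b then p else 1 - p) / n"
    using n k p_range by (simp add: pmf_pair)
  finally show ?thesis .
qed

lemma AE_K_range:
  assumes n: "n \<ge> 1" shows "AE w in M. K n w \<in> {1..n}"
proof -
  have "AE z in distr M (count_space UNIV) (\<lambda>w. (K n w, B n w)). fst z \<in> {1..n}"
    unfolding KB_law[OF n] using n by (auto simp: AE_measure_pmf_iff)
  thus ?thesis using KB_measurable[OF n] by (subst (asm) AE_distr_iff) auto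
qed

lemma AE_X_cases: "n \<ge> 1 \<Longrightarrow> AE w in M. X n w = 1 \<or> X n w = -1"
proof (induction n rule: less_induct)
  case (less n)
  show ?case
  proof (cases "n = 1")
    case True
    have [measurable]: "X 1 \<in> borel_measurable M" by (rule X_measurable) simp
    have "prob {w \<in> space M. X 1 w = 1 \<or> X 1 w = -1} =
       prob ({w \<in> space M. X 1 w = 1} \<union> {w \<in> space M. X 1 w = -1})"
      by (rule arg_cong[where f=prob]) auto
    also have "... = prob {w \<in> space M. X 1 w = 1} + prob {w \<in> space M. X 1 w = -1}"
      by (rule finite_measure_Union) (auto simp del: One_nat_def)
    also have "... = 1" by (simp add: first_step del: One_nat_def)
    finally show ?thesis unfolding True by (subst (asm) prob_Collect_eq_1) (auto simp del: One_nat_def)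
  next
    case False
    then obtain m where m: "n = Suc m" "m \<ge> 1" using less.prems by (cases n) auto
    have "AE w in M. \<forall>k\<in>{1..m}. X k w = 1 \<or> X k w = -1"
      using less.IH m by (intro AE_finite_allI) auto
    with AE_K_range[OF m(2)] next_step[OF m(2)] show ?thesis unfolding m(1)
      by eventually_elim auto
  qed
qed

lemma AE_X_eq: "AE w in M. \<forall>n\<ge>1. X n w = X' n w"
proof -
  have "AE w in M. \<forall>n. n \<ge> 1 \<longrightarrow> X n w = 1 \<or> X n w = -1"
    using AE_X_cases by (subst AE_all_countable) auto
  thus ?thesis by eventually_elim (auto simp: X'_def)
qed

text \<open>\<open>indep_past\<close> concerns events. A function of the first \<open>n\<close>
  modified steps is a finite linear combination of indicators of the events \<open>H = h\<close>,
  and these belong to the sigma algebra of the original steps, because \<open>X'\<close> depends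
  only on whether \<open>X\<close> equals 1.\<close>

lemma expectation_determined_indep:
  fixes f :: "'a \<Rightarrow> real"
  assumes n: "n \<ge> 1" and f: "\<And>w w'. (\<And>k. k \<in> {1..n} \<Longrightarrow> X' k w = X' k w') \<Longrightarrow> f w = f w'"
  shows "integrable M f"
    and "expectation (\<lambda>w. f w * of_bool (K n w = k \<and> B n w = b)) =
      expectation f * prob {w \<in> space M. K n w = k \<and> B n w = b}"
proof -
  define H where "H w = {k \<in> {1..n}. X k w = 1}" for w
  define g where "g h = f (SOME w. H w = h)" for h
  have fg: "f w = (\<Sum>h\<in>Pow {1..n}. g h * indicator {w \<in> space M. H w = h} w)" if "w \<in> space M" for w
  proof -
    define w' where "w' = (SOME w'. H w' = H w)"
    have "H w' = H w" unfolding w'_def by (rule someI) (rule refl)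
    hence "X k w' = 1 \<longleftrightarrow> X k w = 1" if "k \<in> {1..n}" for k
      using that unfolding H_def by blast
    hence "X' k w' = X' k w" if "k \<in> {1..n}" for k using that by (simp add: X'_def)
    hence "g (H w) = f w" unfolding g_def w'_def[symmetric] by (rule f)
    moreover have "H w \<in> Pow {1..n}" by (auto simp: H_def)
    moreover have "(\<Sum>h\<in>Pow {1..n}. g h * indicator {w \<in> space M. H w = h} w) = (\<Sum>h\<in>Pow {1..n}. if h = H w then g h else 0)"
      using that by (intro sum.cong) (auto simp: indicator_def)
    ultimately show ?thesis by simp
  qed
  define \<A> where "\<A> = sigma_sets (space M) {X k -` A \<inter> space M | k A. k \<in> {1..n} \<and> A \<in> sets borel}"
  have "{X k -` A \<inter> space M | k A. k \<in> {1..n} \<and> A \<in> sets borel} \<subseteq> Pow (space M)" by auto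
  then interpret \<A>: sigma_algebra "space M" \<A> unfolding \<A>_def by (rule sigma_algebra_sigma_sets)
  have HA: "{w \<in> space M. H w = h} \<in> \<A>" if h: "h \<in> Pow {1..n}" for h
  proof -
    have "{w \<in> space M. H w = h} = {w \<in> space M. \<forall>k\<in>{1..n}. (X k w = 1 \<longleftrightarrow> k \<in> h)}"
    proof (intro set_eqI iffI)
      fix w assume "w \<in> {w \<in> space M. \<forall>k\<in>{1..n}. (X k w = 1 \<longleftrightarrow> k \<in> h)}"
      thus "w \<in> {w \<in> space M. H w = h}" using h unfolding H_def by blast
    qed (auto simp: H_def)
    also have "... \<in> \<A>"
    proof (rule \<A>.sets_Collect_finite_All)
      fix k assume k: "k \<in> {1..n}"
      have "X k -` {1} \<inter> space M \<in> \<A>" unfolding \<A>_def using k by (intro sigma_sets.Basic) (auto intro!: exI[of _ k] exI[of _ "{1}"])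
      moreover have "X k -` {1} \<inter> space M = {w \<in> space M. X k w = 1}" by auto
      ultimately have "{w \<in> space M. X k w = 1} \<in> \<A>" by simp
      thus "{w \<in> space M. X k w = 1 \<longleftrightarrow> k \<in> h} \<in> \<A>"
        using \<A>.sets_Collect_neg by (cases "k \<in> h") auto
    qed auto
    finally show ?thesis .
  qed
  note indep = indep_past[OF n, folded \<A>_def]
  have KBset: "{w \<in> space M. K n w = k \<and> B n w = b} = (\<lambda>w. (K n w, B n w)) -` {(k, b)} \<inter> space M" by auto
  have \<A>M: "\<A> \<subseteq> events" using indep unfolding indep_set_def indep_sets_def by (auto split: bool.splits)
  have Hev[measurable]: "{w \<in> space M. H w = h} \<in> events" if "h \<in> Pow {1..n}" for h using HA[OF that] \<A>M by blast
  have KBev[measurable]: "{w \<in> space M. K n w = k \<and> B n w = b} \<in> events"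
    unfolding KBset by (rule measurable_sets[OF KB_measurable[OF n]]) simp
  have int: "integrable M (\<lambda>w. \<Sum>h\<in>Pow {1..n}. g h * indicator {w \<in> space M. H w = h} w)"
    using Hev by (intro Bochner_Integration.integrable_sum integrable_mult_right integrable_real_indicator) (auto simp: emeasure_eq_measure)
  thus "integrable M f" by (subst Bochner_Integration.integrable_cong[OF refl fg]) auto
  have Ef: "expectation f = (\<Sum>h\<in>Pow {1..n}. g h * prob {w \<in> space M. H w = h})"
    by (subst Bochner_Integration.integral_cong[OF refl fg], assumption, subst Bochner_Integration.integral_sum)
       (use Hev in \<open>auto intro!: integrable_mult_right integrable_real_indicator sum.cong simp: emeasure_eq_measure Int_absorb2 subset_iff\<close>)
  have "expectation (\<lambda>w. f w * of_bool (K n w = k \<and> B n w = b)) =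
    expectation (\<lambda>w. \<Sum>h\<in>Pow {1..n}. g h * indicator ({w \<in> space M. H w = h} \<inter> {w \<in> space M. K n w = k \<and> B n w = b}) w)"
  proof (rule Bochner_Integration.integral_cong[OF refl])
    fix w assume w: "w \<in> space M"
    show "f w * of_bool (K n w = k \<and> B n w = b) =
       (\<Sum>h\<in>Pow {1..n}. g h * indicator ({w \<in> space M. H w = h} \<inter> {w \<in> space M. K n w = k \<and> B n w = b}) w)"
      unfolding fg[OF w] sum_distrib_right using w by (intro sum.cong) (auto simp: indicator_def)
  qed
  also have "... = (\<Sum>h\<in>Pow {1..n}. g h * prob ({w \<in> space M. H w = h} \<inter> {w \<in> space M. K n w = k \<and> B n w = b}))"
    by (subst Bochner_Integration.integral_sum)
       (use Hev KBev in \<open>auto intro!: integrable_mult_right integrable_real_indicator sum.cong arg_cong[where f=prob] simp: emeasure_eq_measure\<close>)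
  also have "... = (\<Sum>h\<in>Pow {1..n}. g h * (prob {w \<in> space M. H w = h} * prob {w \<in> space M. K n w = k \<and> B n w = b}))"
    by (intro sum.cong refl arg_cong2[where f="(*)"] indep_setD[OF indep] HA) (use KBset in blast)+
  also have "... = expectation f * prob {w \<in> space M. K n w = k \<and> B n w = b}"
    unfolding Ef sum_distrib_right by (simp add: mult.assoc)
  finally show "expectation (\<lambda>w. f w * of_bool (K n w = k \<and> B n w = b)) =
      expectation f * prob {w \<in> space M. K n w = k \<and> B n w = b}" .
qed

text \<open>The next step is decomposed according to the remembered index and the choice between
  repetition and reversal. Each index \<open>k\<close> then contributes
  \<open>(p - (1 - p)) / n\<close> times \<open>E (f * X' k)\<close>.\<close>

lemma reinforced_walk: "reinforced_walk M (2 * p - 1) X'"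
proof
  show "\<bar>2 * p - 1\<bar> \<le> 1" using p_range by simp
  show "X' n \<in> borel_measurable M" if "n \<ge> 1" for n by (rule X'_measurable[OF that])
  show "X' n w = 1 \<or> X' n w = -1" for n w by (simp add: X'_def)
  fix n :: nat and f :: "'a \<Rightarrow> real"
  assume n: "n \<ge> 1" and f: "\<And>w w'. (\<And>k. k \<in> {1..n} \<Longrightarrow> X' k w = X' k w') \<Longrightarrow> f w = f w'"
  define J where "J b k w = (of_bool (K n w = k \<and> B n w = b) :: real)" for b k w
  have det: "f w * X' k w = f w' * X' k w'" if "\<And>j. j \<in> {1..n} \<Longrightarrow> X' j w = X' j w'" "k \<in> {1..n}" for k w w'
    using f[OF that(1)] that(1)[OF that(2)] by simp
  have EJ: "expectation (\<lambda>w. (f w * X' k w) * J b k w) = expectation (\<lambda>w. f w * X' k w) * ((if b then p else 1 - p) / n)"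
    and iJ: "integrable M (\<lambda>w. (f w * X' k w) * J b k w)" and iX: "integrable M (\<lambda>w. f w * X' k w)"
    if k: "k \<in> {1..n}" for b k
  proof -
    note e = expectation_determined_indep[OF n, of "\<lambda>w. f w * X' k w", OF det[OF _ k]]
    show "expectation (\<lambda>w. (f w * X' k w) * J b k w) = expectation (\<lambda>w. f w * X' k w) * ((if b then p else 1 - p) / n)"
      unfolding J_def prob_KB[OF n k, symmetric] by (rule e(2)) auto
    show i: "integrable M (\<lambda>w. f w * X' k w)" by (rule e(1)) auto
    have [measurable]: "K n \<in> M \<rightarrow>\<^sub>M count_space UNIV" "B n \<in> M \<rightarrow>\<^sub>M count_space UNIV"
      by (rule K_measurable[OF n] B_measurable[OF n])+
    have "J b k \<in> borel_measurable M" unfolding J_def[abs_def] of_bool_def by measurable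
    thus "integrable M (\<lambda>w. (f w * X' k w) * J b k w)"
      using i by (intro Bochner_Integration.integrable_bound[OF i]) (auto simp: J_def)
  qed
  have "expectation (\<lambda>w. f w * X' (Suc n) w) =
     expectation (\<lambda>w. \<Sum>k=1..n. (f w * X' k w) * J True k w - (f w * X' k w) * J False k w)"
  proof (rule integral_cong_AE)
    have [measurable]: "f \<in> borel_measurable M" "X' (Suc n) \<in> borel_measurable M"
      using expectation_determined_indep(1)[OF n f] X'_measurable[of "Suc n"] by auto
    show "(\<lambda>w. f w * X' (Suc n) w) \<in> borel_measurable M" by measurable
    show "(\<lambda>w. \<Sum>k=1..n. (f w * X' k w) * J True k w - (f w * X' k w) * J False k w) \<in> borel_measurable M"
      using iJ by (intro borel_measurable_sum borel_measurable_diff) auto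
    from AE_K_range[OF n] next_step[OF n] AE_X_eq
    show "AE w in M. f w * X' (Suc n) w = (\<Sum>k=1..n. (f w * X' k w) * J True k w - (f w * X' k w) * J False k w)"
    proof eventually_elim
      case (elim w)
      have "(\<Sum>k=1..n. (f w * X' k w) * J True k w - (f w * X' k w) * J False k w) =
        (\<Sum>k=1..n. if k = K n w then (if B n w then f w * X' k w else - (f w * X' k w)) else 0)"
        by (intro sum.cong) (auto simp: J_def)
      also have "... = f w * (if B n w then X' (K n w) w else - X' (K n w) w)" using elim(1) by simp
      also have "... = f w * X' (Suc n) w" using elim by (auto split: if_splits)
      finally show ?case by simp
    qed
  qed
  also have "... = (\<Sum>k=1..n. expectation (\<lambda>w. (f w * X' k w) * J True k w) - expectation (\<lambda>w. (f w * X' k w) * J False k w))"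
    using iJ by (subst Bochner_Integration.integral_sum) (auto intro!: sum.cong Bochner_Integration.integral_diff)
  also have "... = (\<Sum>k=1..n. (2 * p - 1) * (expectation (\<lambda>w. f w * X' k w) / n))"
  proof (intro sum.cong refl)
    fix k assume k: "k \<in> {1..n}"
    show "expectation (\<lambda>w. (f w * X' k w) * J True k w) - expectation (\<lambda>w. (f w * X' k w) * J False k w) =
        (2 * p - 1) * (expectation (\<lambda>w. f w * X' k w) / n)"
      unfolding EJ[OF k] by (simp add: algebra_simps diff_divide_distrib)
  qed
  also have "... = (2 * p - 1) * (expectation (\<lambda>w. \<Sum>k=1..n. f w * X' k w) / n)"
    using iX by (subst Bochner_Integration.integral_sum) (auto simp: sum_distrib_left sum_divide_distrib)
  also have "expectation (\<lambda>w. \<Sum>k=1..n. f w * X' k w) / n = expectation (\<lambda>w. f w * ((\<Sum>k=1..n. X' k w) / real n))"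
    by (simp add: sum_distrib_left flip: integral_divide_zero)
  finally show "expectation (\<lambda>w. f w * X' (Suc n) w) = (2 * p - 1) * expectation (\<lambda>w. f w * ((\<Sum>k=1..n. X' k w) / real n))" .
qed

sublocale walk: reinforced_walk M "2 * p - 1" X'
  by (rule reinforced_walk)

text \<open>\<open>X (k + 1) = (2 p - 1) Y k + xi k\<close>, so adding \<open>Y k\<close> as in the
  estimator produces \<open>2 p Y k + xi k\<close>, and the estimation error is
  \<open>(N + 2 (p - p0) W) / (2 W)\<close>. From \<open>n = 2\<close> on, \<open>W \<ge> 1\<close>
  rules out a division by zero.\<close>

lemma statistic_eq:
  assumes eq: "\<forall>n\<ge>1. X n w = X' n w" and n: "n \<ge> 2"
  shows "erw_V X n w * (erw_estimator X n w - p0)^2 =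
    (walk.N n w + 2 * (p - p0) * walk.W n w)^2 / walk.W n w"
proof -
  have S: "erw_position X k w = walk.S k w" for k
    unfolding erw_position_def walk.S_def using eq by (intro sum.cong) auto
  have I: "{1..n - 1} = {1..<n}" using n by auto
  have W: "(\<Sum>k=1..n-1. (erw_position X k w / real k)^2) = walk.W n w"
    unfolding I walk.W_def walk.Y_def S ..
  have "(\<Sum>k=1..n-1. erw_position X k w / real k * (X (k+1) w + erw_position X k w / real k)) =
     (\<Sum>k=1..<n. walk.Y k w * walk.xi k w + 2 * p * (walk.Y k w)^2)"
  proof (unfold I, intro sum.cong refl)
    fix k assume "k \<in> {1..<n}"
    define y z where "y = walk.Y k w" and "z = walk.xi k w"
    have "X (k + 1) w = (2 * p - 1) * y + z" using eq walk.X_Suc_eq[of k w] by (simp add: y_def z_def)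
    moreover have "erw_position X k w / real k = y" by (simp add: S y_def walk.Y_def)
    ultimately show "erw_position X k w / real k * (X (k + 1) w + erw_position X k w / real k) =
        walk.Y k w * walk.xi k w + 2 * p * (walk.Y k w)^2"
      unfolding y_def[symmetric] z_def[symmetric] by (simp add: power2_eq_square algebra_simps)
  qed
  also have "... = walk.N n w + 2 * p * walk.W n w"
    by (simp add: walk.N_def walk.W_def sum.distrib sum_distrib_left)
  finally have est: "erw_estimator X n w = (walk.N n w + 2 * p * walk.W n w) / (2 * walk.W n w)"
    unfolding erw_estimator_def W by simp
  have w: "walk.W n w > 0" using walk.W_ge_1[OF n, of w] by simp
  have "erw_estimator X n w - p0 = (walk.N n w + 2 * (p - p0) * walk.W n w) / (2 * walk.W n w)"
    unfolding est using w by (simp add: field_simps)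
  thus ?thesis using w unfolding erw_V_def W by (simp add: power_divide power_mult_distrib power2_eq_square)
qed

end

theorem theorem3p13:
  fixes M :: "'a measure" and p q p0 :: real
    and X :: "nat \<Rightarrow> 'a \<Rightarrow> real" and K :: "nat \<Rightarrow> 'a \<Rightarrow> nat" and B :: "nat \<Rightarrow> 'a \<Rightarrow> bool"
  assumes "elephant_random_walk M p q X K B"
    and "0 < p0" "p0 < 1" "p0 \<noteq> 3/4"
  shows "(p = p0 \<longrightarrow>
            weak_conv_m
              (\<lambda>n. distr M borel (\<lambda>\<omega>. erw_V X n \<omega> * (erw_estimator X n \<omega> - p0)\<^sup>2))
              (chi_square_distribution 1)) \<and>
         (p \<noteq> p0 \<longrightarrow>
            (AE \<omega> in M. filterlim (\<lambda>n. erw_V X n \<omega> * (erw_estimator X n \<omega> - p0)\<^sup>2)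
              at_top sequentially))"
proof (intro conjI impI)
  interpret elephant_random_walk M p q X K B by fact
  let ?T = "\<lambda>n w. erw_V X n w * (erw_estimator X n w - p0)^2"
  {
    assume p: "p = p0"
    let ?R = "\<lambda>n w. (walk.N n w)^2 / walk.W n w"
    have "weak_conv_m (\<lambda>n. distr M borel (?R n)) (chi_square_distribution 1)"
    proof (cases "2 * p - 1 < 1 / 2")
      case True
      thus ?thesis by (rule walk.chi_square_diffusive)
    next
      case False
      \<comment> \<open>\<open>p0 \<noteq> 3/4\<close> excludes \<open>a = 1/2\<close>, and
        \<open>p0 < 1\<close> excludes \<open>a = 1\<close>.\<close>
      interpret superdiffusive_walk M "2 * p - 1" X'
        by unfold_locales (use False p assms in auto)
      show ?thesis by (rule chi_square_superdiffusive)
    qed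
    moreover have "\<forall>\<^sub>F n in sequentially. distr M borel (?R n) = distr M borel (?T n)"
      using eventually_ge_at_top[of 2]
    proof eventually_elim
      case (elim n)
      show ?case
      proof (rule distr_cong_AE[OF refl refl])
        show "AE w in M. ?R n w = ?T n w"
          using AE_X_eq by eventually_elim (use statistic_eq[OF _ elim] p in simp)
        have dN: "walk.determined n (walk.N n)" and dW: "walk.determined n (walk.W n)"
          by (rule walk.det_N walk.det_W; simp)+
        show "?R n \<in> borel_measurable M"
          by (rule walk.borel_measurable_determined[of n]) (intro walk.det_intros dN dW)
        have X: "X k \<in> borel_measurable M" if "k \<in> {1..n}" for k using that by (intro X_measurable) auto
        show "?T n \<in> borel_measurable M"
          unfolding erw_V_def erw_estimator_def erw_position_def
          by (intro borel_measurable_times borel_measurable_power borel_measurable_diff borel_measurable_divide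
              borel_measurable_sum borel_measurable_add borel_measurable_const X) (use elim in auto)
      qed
    qed
    ultimately show "weak_conv_m (\<lambda>n. distr M borel (?T n)) (chi_square_distribution 1)"
      unfolding weak_conv_m_def weak_conv_def
      by (auto elim!: Lim_transform_eventually eventually_mono)
  }
  {
    assume "p \<noteq> p0"
    hence "2 * (p - p0) \<noteq> 0" by simp
    from walk.AE_statistic_at_top[OF this] AE_X_eq
    show "AE w in M. filterlim (\<lambda>n. ?T n w) at_top sequentially"
    proof eventually_elim
      case (elim w)
      have "\<forall>\<^sub>F n in sequentially. ?T n w = (walk.N n w + 2 * (p - p0) * walk.W n w)^2 / walk.W n w"
        using eventually_ge_at_top[of 2] by eventually_elim (rule statistic_eq[OF elim(2)])
      thus ?case using elim(1) by (subst filterlim_cong[OF refl refl])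
    qed
  }
qed

end
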